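(* Let $q,k\ge 2$ be integers and let $\mathcal{F}$ be a nonempty family of functions $f:\mathbb{Z}_q^k\to\{0,1\}$, none of which is identically zero. If $\alpha$ is such that there exists a randomized single-pass streaming $\alpha$-approximation algorithm for $\textsf{Max-CSP}(\mathcal{F})$ using $o(n)$ space, then $\alpha\le q\cdot\rho_{\min}(\mathcal{F})$. (Consequently, if $\textsf{Max-CSP}(\mathcal{F})$ is $\alpha$-approximable then $\alpha\in[\rho_{\min}(\mathcal{F}),\,q\cdot\rho_{\min}(\mathcal{F})]$.)
   Context: An instance $\Psi$ of $\textsf{Max-CSP}(\mathcal{F})$ on $n$ variables taking values in $\mathbb{Z}_q$ is a list of constraints, each given by some $f\in\mathcal{F}$ and a $k$-tuple $(j_1,\dots,j_k)$ of distinct indices in $[n]$, satisfied by $\boldsymbol\nu\in\mathbb{Z}_q^n$ iff $f(\nu_{j_1},\dots,\nu_{j_k})=1$. $\textsf{val}_\Psi$ is the maximum over assignments of the fraction of satisfied constraints; $\rho_{\min}(\mathcal{F})$ is the infimum of $\textsf{val}_\Psi$ over all instances. A randomized single-pass streaming algorithm reads the constraints one at a time with bounded memory (space) and is an $\alpha$-approximation algorithm if on every instance it outputs, with probability at least $2/3$, a value $\eta$ with $\alpha\,\textsf{val}_\Psi\le\eta\le\textsf{val}_\Psi$. $\textsf{Max-CSP}(\mathcal{F})$ is $\alpha$-approximable if $\alpha$ is the largest constant for which an $\alpha$-approximation algorithm using $o(n)$ space exists. *)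

theory Defs
  imports "HOL-Probability.Probability_Mass_Function" "HOL-Library.Landau_Symbols"
begin

text \<open>Values of \<open>\<int>_q\<close> are represented by naturals in \<open>{0..<q}\<close>.
  A constraint function \<open>f : \<int>_q^k \<rightarrow> {0,1}\<close> is a predicate on lists
  (only its values on lists of length k with entries below q matter).
  A constraint is a pair (f, index list).\<close>

type_synonym constr = "(nat list \<Rightarrow> bool) \<times> nat list"

definition valid_constraint ::
  "(nat list \<Rightarrow> bool) set \<Rightarrow> nat \<Rightarrow> nat \<Rightarrow> constr \<Rightarrow> bool" where
  "valid_constraint F k n c \<longleftrightarrow>
     fst c \<in> F \<and> length (snd c) = k \<and> distinct (snd c) \<and> set (snd c) \<subseteq> {..<n}"

definition is_instance ::
  "(nat list \<Rightarrow> bool) set \<Rightarrow> nat \<Rightarrow> nat \<Rightarrow> constr list \<Rightarrow> bool" where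
  "is_instance F k n \<Psi> \<longleftrightarrow> \<Psi> \<noteq> [] \<and> (\<forall>c\<in>set \<Psi>. valid_constraint F k n c)"

text \<open>An assignment in \<open>\<int>_q^n\<close> (coordinates at indices \<open>\<ge> n\<close> are irrelevant).\<close>
definition assignment :: "nat \<Rightarrow> nat \<Rightarrow> (nat \<Rightarrow> nat) \<Rightarrow> bool" where
  "assignment q n \<nu> \<longleftrightarrow> (\<forall>j<n. \<nu> j < q)"

definition satisfies :: "(nat \<Rightarrow> nat) \<Rightarrow> constr \<Rightarrow> bool" where
  "satisfies \<nu> c \<longleftrightarrow> fst c (map \<nu> (snd c))"

definition num_sat :: "(nat \<Rightarrow> nat) \<Rightarrow> constr list \<Rightarrow> nat" where
  "num_sat \<nu> \<Psi> = length (filter (satisfies \<nu>) \<Psi>)"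

definition csp_val :: "nat \<Rightarrow> nat \<Rightarrow> constr list \<Rightarrow> real" where
  "csp_val q n \<Psi> =
     Max {real (num_sat \<nu> \<Psi>) / real (length \<Psi>) | \<nu>. assignment q n \<nu>}"

definition rho_min :: "(nat list \<Rightarrow> bool) set \<Rightarrow> nat \<Rightarrow> nat \<Rightarrow> real" where
  "rho_min F q k = Inf {csp_val q n \<Psi> | n \<Psi>. is_instance F k n \<Psi>}"

text \<open>A randomized single-pass streaming algorithm: memory states are naturals;
  random initial state, random state transition on reading a constraint,
  random output computed from the final state.\<close>
record salg =
  init :: "nat pmf"
  step :: "constr \<Rightarrow> nat \<Rightarrow> nat pmf"
  out :: "nat \<Rightarrow> real pmf"

definition run :: "salg \<Rightarrow> constr list \<Rightarrow> real pmf" where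
  "run A \<Psi> = bind_pmf (fold (\<lambda>c p. bind_pmf p (step A c)) \<Psi> (init A)) (out A)"

text \<open>Space s (bits): the memory never leaves the \<open>2^s\<close> states \<open>{..<2^s}\<close>
  while processing constraints of instances on n variables.\<close>
definition space_bounded ::
  "(nat list \<Rightarrow> bool) set \<Rightarrow> nat \<Rightarrow> nat \<Rightarrow> nat \<Rightarrow> salg \<Rightarrow> bool" where
  "space_bounded F k n s A \<longleftrightarrow>
     set_pmf (init A) \<subseteq> {..<2^s} \<and>
     (\<forall>c \<sigma>. valid_constraint F k n c \<longrightarrow> \<sigma> < 2^s \<longrightarrow> set_pmf (step A c \<sigma>) \<subseteq> {..<2^s})"

definition is_approx_alg ::
  "(nat list \<Rightarrow> bool) set \<Rightarrow> nat \<Rightarrow> nat \<Rightarrow> nat \<Rightarrow> real \<Rightarrow> salg \<Rightarrow> bool" where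
  "is_approx_alg F q k n \<alpha> A \<longleftrightarrow>
     (\<forall>\<Psi>. is_instance F k n \<Psi> \<longrightarrow>
        measure_pmf.prob (run A \<Psi>)
          {\<eta>. \<alpha> * csp_val q n \<Psi> \<le> \<eta> \<and> \<eta> \<le> csp_val q n \<Psi>} \<ge> 2/3)"

definition has_sublinear_approx ::
  "(nat list \<Rightarrow> bool) set \<Rightarrow> nat \<Rightarrow> nat \<Rightarrow> real \<Rightarrow> bool" where
  "has_sublinear_approx F q k \<alpha> \<longleftrightarrow>
     (\<exists>A :: nat \<Rightarrow> salg. \<exists>s :: nat \<Rightarrow> nat.
        (\<lambda>n. real (s n)) \<in> o(\<lambda>n. real n) \<and>
        (\<forall>n. space_bounded F k n (s n) (A n) \<and> is_approx_alg F q k n \<alpha> (A n)))"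

definition approximable ::
  "(nat list \<Rightarrow> bool) set \<Rightarrow> nat \<Rightarrow> nat \<Rightarrow> real \<Rightarrow> bool" where
  "approximable F q k \<alpha> \<longleftrightarrow>
     has_sublinear_approx F q k \<alpha> \<and> (\<forall>\<beta>. has_sublinear_approx F q k \<beta> \<longrightarrow> \<beta> \<le> \<alpha>)"

end

theory Submission
  imports Defs
begin

text \<open>
  Fix a hidden assignment \<open>x\<close>. In every round each variable is thrown into one of \<open>12 n\<close> random slots
  and the stream shows constraints built from \<open>y = x + u\<close>, where \<open>u\<close> is a fresh uniform shift constant
  on slots (YES), or from a fresh uniform \<open>y\<close> (NO). In the YES case one of the \<open>q\<close> global shifts of
  \<open>x\<close> satisfies a fraction \<open>1/q\<close> of the constraints; in the NO case the constraints are random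
  lifts of an instance of value close to \<open>rho_min\<close>, so that, by bounded differences over a constant number
  of rounds and a union bound, no assignment beats that value noticeably.

  That \<open>o(n)\<close> memory does not distinguish the two cases is shown by following, for the function
  \<open>F\<^sub>t(\<sigma>, x)\<close> giving the probability of memory state \<open>\<sigma>\<close> after \<open>t\<close> rounds, the total mass
  of the Fourier coefficients on each level, summed over all states: one round sends a level
  \<open>w\<close> to nearby levels because the new characters must cancel on slots. Low levels are handled by a
  level inequality derived from hypercontractivity on slots, high levels by Parseval and the
  small probability that a large random set meets no slot in a single element.
\<close>


text \<open>Averaged over \<open>x\<close>, a YES round has exactly the law of a NO round; the cases
  differ only by correlations between rounds that the memory carries. Conditioning on one memory
  state is too costly, as its probability may be as small as \<open>exp (- S)\<close>. Summed over
  states with their weights, the level inequality loses only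
  \<open>card \<Sigma> powr (1 - 1 / p)\<close>, and taking \<open>p - 1\<close> proportional to the
  level \<open>l\<close> reduces this loss to \<open>exp l\<close>, which the invariant absorbs in a
  constant. Every round exponentiates that constant and shrinks the range of levels, so the argument
  reaches a bounded number of rounds only. This suffices: for a fixed assignment the exponential
  moment of a NO stream falls by a factor exponentially small in \<open>n\<close> per round, so
  constantly many rounds pay for a union bound over \<open>q ^ n\<close> assignments. Slots are used
  because they treat the variables independently: cancellation probabilities and concentration are
  then obtained one variable at a time. With 12 n of them, the bound on the cancellation probability
  decreases in the size of the set, up to size n.\<close>

definition avg :: "'a set \<Rightarrow> ('a \<Rightarrow> 'b::real_normed_field) \<Rightarrow> 'b" where
  "avg S f = (\<Sum>x\<in>S. f x) / of_nat (card S)"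

lemma avg_cong: "(\<And>x. x \<in> S \<Longrightarrow> f x = g x) \<Longrightarrow> avg S f = avg S g"
  unfolding avg_def by simp

lemma avg_mono:
  fixes f g :: "'a \<Rightarrow> real"
  shows "(\<And>x. x \<in> S \<Longrightarrow> f x \<le> g x) \<Longrightarrow> avg S f \<le> avg S g"
  unfolding avg_def by (intro divide_right_mono sum_mono) auto

lemma avg_nonneg:
  fixes f :: "'a \<Rightarrow> real"
  shows "(\<And>x. x \<in> S \<Longrightarrow> 0 \<le> f x) \<Longrightarrow> 0 \<le> avg S f"
  unfolding avg_def by (intro divide_nonneg_nonneg sum_nonneg) auto

lemma avg_add: "avg S (\<lambda>x. f x + g x) = avg S f + avg S g"
  unfolding avg_def by (simp add: sum.distrib add_divide_distrib)

lemma avg_diff: "avg S (\<lambda>x. f x - g x) = avg S f - avg S g"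
  unfolding avg_def by (simp add: sum_subtractf diff_divide_distrib)

lemma avg_cmult: "avg S (\<lambda>x. c * f x) = c * avg S f"
  unfolding avg_def by (simp add: sum_distrib_left)

lemma avg_multc: "avg S (\<lambda>x. f x * c) = avg S f * c"
  unfolding avg_def by (simp add: sum_distrib_right)

lemma avg_sum: "avg S (\<lambda>x. \<Sum>i\<in>I. f i x) = (\<Sum>i\<in>I. avg S (f i))"
  unfolding avg_def by (simp add: sum.swap[of _ S I] sum_divide_distrib)

lemma avg_swap: "avg S (\<lambda>x. avg R (\<lambda>y. f x y)) = avg R (\<lambda>y. avg S (\<lambda>x. f x y))"
  unfolding avg_def by (simp add: sum_divide_distrib[symmetric] sum.swap[of _ S R] mult.commute)

lemma avg_const: "finite S \<Longrightarrow> S \<noteq> {} \<Longrightarrow> avg S (\<lambda>x. c) = c"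
  unfolding avg_def by simp

lemma avg_le_const:
  fixes f :: "'a \<Rightarrow> real"
  shows "finite S \<Longrightarrow> S \<noteq> {} \<Longrightarrow> (\<And>x. x \<in> S \<Longrightarrow> f x \<le> c) \<Longrightarrow> avg S f \<le> c"
  using avg_mono[of S f "\<lambda>_. c"] by (simp add: avg_const)

lemma norm_avg_le: "norm (avg S f) \<le> avg S (\<lambda>x. norm (f x))"
  unfolding avg_def by (simp add: norm_divide divide_right_mono norm_sum)

lemma avg_bij: "bij_betw \<phi> S S \<Longrightarrow> avg S (\<lambda>x. f (\<phi> x)) = avg S f"
  unfolding avg_def by (simp add: sum.reindex_bij_betw)

lemma avg_square_le:
  fixes f :: "'a \<Rightarrow> real"
  shows "(avg S f)\<^sup>2 \<le> avg S (\<lambda>x. (f x)\<^sup>2)"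
proof (cases "card S = 0")
  case False
  have "(\<Sum>x\<in>S. f x * 1)\<^sup>2 \<le> (\<Sum>x\<in>S. (f x)\<^sup>2) * (\<Sum>x\<in>S. 1\<^sup>2)"
    by (rule Cauchy_Schwarz_ineq_sum)
  then show ?thesis
    using False unfolding avg_def by (simp add: field_simps power2_eq_square)
qed (simp add: avg_def)

lemma avg_sqrt_le:
  fixes f :: "'a \<Rightarrow> real"
  assumes "\<And>x. x \<in> S \<Longrightarrow> 0 \<le> f x"
  shows "avg S (\<lambda>x. sqrt (f x)) \<le> sqrt (avg S f)"
proof (rule real_le_rsqrt)
  have "(avg S (\<lambda>x. sqrt (f x)))\<^sup>2 \<le> avg S (\<lambda>x. (sqrt (f x))\<^sup>2)"
    by (rule avg_square_le)
  also have "\<dots> = avg S f"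
    using assms by (intro avg_cong) simp
  finally show "(avg S (\<lambda>x. sqrt (f x)))\<^sup>2 \<le> avg S f" .
qed

lemma sum_sqrt_mult_le:
  fixes f g :: "'a \<Rightarrow> real"
  assumes "\<And>x. x \<in> S \<Longrightarrow> 0 \<le> f x" "\<And>x. x \<in> S \<Longrightarrow> 0 \<le> g x"
  shows "(\<Sum>x\<in>S. sqrt (f x) * sqrt (g x)) \<le> sqrt (\<Sum>x\<in>S. f x) * sqrt (\<Sum>x\<in>S. g x)"
proof -
  have "(\<Sum>x\<in>S. sqrt (f x) * sqrt (g x))\<^sup>2
      \<le> (\<Sum>x\<in>S. (sqrt (f x))\<^sup>2) * (\<Sum>x\<in>S. (sqrt (g x))\<^sup>2)"
    by (rule Cauchy_Schwarz_ineq_sum)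
  also have "\<dots> = (\<Sum>x\<in>S. f x) * (\<Sum>x\<in>S. g x)"
    using assms by (intro arg_cong2[where f="(*)"] sum.cong) auto
  finally show ?thesis
    by (metis real_le_rsqrt real_sqrt_mult)
qed

lemma sum_sqrt_le:
  fixes f :: "'a \<Rightarrow> real"
  assumes "\<And>x. x \<in> S \<Longrightarrow> 0 \<le> f x"
  shows "(\<Sum>x\<in>S. sqrt (f x)) \<le> sqrt (card S) * sqrt (\<Sum>x\<in>S. f x)"
  using sum_sqrt_mult_le[of S "\<lambda>_. 1" f] assms by simp

text \<open>Resampling one coordinate preserves the uniform law: exchanging \<open>c\<close> with
  \<open>y v\<close> is an involution of the pairs, so it serves as its own inverse in the
  reindexing.\<close>

lemma avg_fun_upd:
  assumes "v \<in> V" "finite S" "S \<noteq> {}"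
  shows "avg (V \<rightarrow>\<^sub>E S) f = avg (V \<rightarrow>\<^sub>E S) (\<lambda>y. avg S (\<lambda>c. f (y(v := c))))"
proof -
  have "(\<Sum>y\<in>V \<rightarrow>\<^sub>E S. \<Sum>c\<in>S. f (y(v := c))) = (\<Sum>(y,c)\<in>(V \<rightarrow>\<^sub>E S) \<times> S. f (y(v := c)))"
    by (simp add: sum.cartesian_product)
  also have "\<dots> = (\<Sum>(y,c)\<in>(V \<rightarrow>\<^sub>E S) \<times> S. f y)"
    by (rule sum.reindex_bij_witness[where i = "\<lambda>(y,c). (y(v := c), y v)"
          and j = "\<lambda>(y,c). (y(v := c), y v)"])
       (use assms in \<open>auto simp: PiE_iff extensional_def\<close>)
  also have "\<dots> = of_nat (card S) * (\<Sum>y\<in>V \<rightarrow>\<^sub>E S. f y)"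
    by (simp add: sum.cartesian_product[symmetric] sum_distrib_left)
  finally show ?thesis
    using assms by (simp add: avg_def sum_divide_distrib[symmetric])
qed

section \<open>Hypercontractivity for blocks of coordinates\<close>


lemma override_on_PiE:
  assumes "y \<in> V \<rightarrow>\<^sub>E S" "a \<in> B \<rightarrow>\<^sub>E S" "B \<subseteq> V"
  shows "override_on y a B \<in> V \<rightarrow>\<^sub>E S"
  using assms by (auto simp: PiE_iff extensional_def override_on_def)

lemma avg_override_on:
  assumes "B \<subseteq> V" "finite V" "finite S" "S \<noteq> {}"
  shows "avg (V \<rightarrow>\<^sub>E S) f = avg (V \<rightarrow>\<^sub>E S) (\<lambda>y. avg (B \<rightarrow>\<^sub>E S) (\<lambda>a. f (override_on y a B)))"
proof -
  have fB: "finite B" using assms finite_subset by blast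
  have "(\<Sum>y\<in>V \<rightarrow>\<^sub>E S. \<Sum>a\<in>B \<rightarrow>\<^sub>E S. f (override_on y a B))
      = (\<Sum>(y,a)\<in>(V \<rightarrow>\<^sub>E S) \<times> (B \<rightarrow>\<^sub>E S). f (override_on y a B))"
    by (simp add: sum.cartesian_product)
  also have "\<dots> = (\<Sum>(y,a)\<in>(V \<rightarrow>\<^sub>E S) \<times> (B \<rightarrow>\<^sub>E S). f y)"
    by (rule sum.reindex_bij_witness[where i = "\<lambda>(y,a). (override_on y a B, restrict y B)"
          and j = "\<lambda>(y,a). (override_on y a B, restrict y B)"])
       (use assms in \<open>auto simp: PiE_iff extensional_def override_on_def fun_eq_iff\<close>)
  also have "\<dots> = of_nat (card (B \<rightarrow>\<^sub>E S)) * (\<Sum>y\<in>V \<rightarrow>\<^sub>E S. f y)"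
    by (simp add: sum.cartesian_product[symmetric] sum_distrib_left)
  finally show ?thesis
    using assms fB by (simp add: avg_def sum_divide_distrib[symmetric] card_PiE)
qed

text \<open>The inequality \<open>ln s \<le> s - 1\<close> at \<open>s = 1 / sqrt t\<close> gives
  the lower bound \<open>2 * t - 2 * sqrt t\<close>, which exceeds \<open>t - 1\<close> by exactly
  the square of \<open>sqrt t - 1\<close>. The factor \<open>4 * M\<close> bounds the square of
  \<open>sqrt t + 1\<close>.\<close>

lemma mult_ln_ge:
  fixes t M :: real
  assumes "0 < t" "t \<le> M" "1 \<le> M"
  shows "t * ln t \<ge> (t - 1) + (t - 1)\<^sup>2 / (4 * M)"
proof -
  have st: "0 < sqrt t" "(sqrt t)\<^sup>2 = t" using assms by auto
  have "ln (1 / sqrt t) \<le> 1 / sqrt t - 1"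
    using st by (intro ln_le_minus_one) auto
  moreover have "ln (1 / sqrt t) = - (ln t / 2)"
    using assms by (simp add: ln_div ln_sqrt)
  ultimately have "ln t \<ge> 2 - 2 / sqrt t" by simp
  then have "t * ln t \<ge> t * (2 - 2 / sqrt t)" using assms by (intro mult_left_mono) auto
  also have "t * (2 - 2 / sqrt t) = 2 * t - 2 * sqrt t"
    using st by (simp add: field_simps power2_eq_square)
  finally have 1: "t * ln t \<ge> 2 * t - 2 * sqrt t" .
  have "(t - 1)\<^sup>2 = (sqrt t - 1)\<^sup>2 * (sqrt t + 1)\<^sup>2"
    using st by (metis (no_types) mult.commute power_mult_distrib square_diff_one_factored
        power2_eq_square)
  also have "(sqrt t + 1)\<^sup>2 \<le> (2 * sqrt M)\<^sup>2"
  proof (rule power_mono)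
    have "sqrt t \<le> sqrt M" "1 \<le> sqrt M" using assms by auto
    then show "sqrt t + 1 \<le> 2 * sqrt M" by linarith
  qed (use st in simp)
  then have "(sqrt t - 1)\<^sup>2 * (sqrt t + 1)\<^sup>2 \<le> (sqrt t - 1)\<^sup>2 * (4 * M)"
    using assms by (intro mult_left_mono) (auto simp: power_mult_distrib)
  finally have "(t - 1)\<^sup>2 / (4 * M) \<le> (sqrt t - 1)\<^sup>2"
    using assms by (simp add: field_simps)
  also have "(sqrt t - 1)\<^sup>2 = t - 2 * sqrt t + 1"
    using st by (simp add: power2_diff)
  finally show ?thesis using 1 by linarith
qed

text \<open>Convexity with a quadratic gain proportional to \<open>p - 1\<close>, which matters
  because \<open>p\<close> is later taken close to 1. It comes from \<open>exp x \<ge> 1 + x\<close>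
  applied to \<open>t * exp ((p - 1) * ln t)\<close>.\<close>

lemma powr_ge_quadratic:
  fixes t M p :: real
  assumes "0 \<le> t" "t \<le> M" "1 \<le> M" "1 \<le> p" "p \<le> 2"
  shows "t powr p \<ge> 1 + p * (t - 1) + (p - 1) * (t - 1)\<^sup>2 / (4 * M)"
proof (cases "t = 0")
  case True
  have "(p - 1) / (4 * M) \<le> (p - 1) / 1" using assms by (intro divide_left_mono) auto
  then show ?thesis using True assms by simp
next
  case False
  then have t: "0 < t" using assms by simp
  have "t powr p = t * exp ((p - 1) * ln t)"
    using t by (simp add: powr_def left_diff_distrib exp_diff)
  also have "\<dots> \<ge> t * (1 + (p - 1) * ln t)"
    using t by (intro mult_left_mono exp_ge_add_one_self) auto
  finally have "t powr p \<ge> t + (p - 1) * (t * ln t)" by (simp add: algebra_simps)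
  moreover have "(p - 1) * (t * ln t) \<ge> (p - 1) * ((t - 1) + (t - 1)\<^sup>2 / (4 * M))"
    using mult_ln_ge[of t M] t assms by (intro mult_left_mono) auto
  ultimately show ?thesis by (simp add: algebra_simps)
qed

text \<open>Hypercontractivity of a single block. After scaling to mean 1 the left side is
  \<open>1 + \<rho> * v\<close> with \<open>v\<close> the variance, and
  \<open>powr_ge_quadratic\<close> finds as much in the p-th moment. The size of \<open>A\<close>
  enters because a nonnegative function of mean 1 is at most \<open>card A\<close>.\<close>

lemma avg_two_norm_le:
  fixes u :: "'a \<Rightarrow> real" and \<rho> p :: real
  assumes fin: "finite A" "A \<noteq> {}" and u: "\<And>a. a \<in> A \<Longrightarrow> 0 \<le> u a"
    and \<rho>: "0 \<le> \<rho>" "4 * \<rho> * card A \<le> p - 1" "p \<le> 2"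
  shows "\<rho> * avg A (\<lambda>a. (u a)\<^sup>2) + (1 - \<rho>) * (avg A u)\<^sup>2 \<le> (avg A (\<lambda>a. u a powr p)) powr (2/p)"
proof -
  have cA: "card A \<ge> 1" using fin by (simp add: Suc_leI card_gt_0_iff)
  have p1: "1 \<le> p" using \<rho> by (smt (verit) mult_nonneg_nonneg of_nat_0_le_iff)
  define w where "w = avg A u"
  have w0: "0 \<le> w" unfolding w_def using u by (rule avg_nonneg)
  show ?thesis
  proof (cases "w = 0")
    case True
    then have "(\<Sum>a\<in>A. u a) = 0" using cA fin by (simp add: w_def avg_def)
    then have "\<And>a. a \<in> A \<Longrightarrow> u a = 0" using u fin by (simp add: sum_nonneg_eq_0_iff)
    then have "avg A (\<lambda>a. (u a)\<^sup>2) = 0" by (simp add: avg_def)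
    then show ?thesis using True by (simp add: w_def)
  next
    case False
    then have w: "0 < w" using w0 by simp
    define t where "t a = u a / w" for a
    have t0: "0 \<le> t a" if "a \<in> A" for a using u[OF that] w by (simp add: t_def)
    have tM: "t a \<le> card A" if "a \<in> A" for a
    proof -
      have "u a \<le> (\<Sum>a\<in>A. u a)" using u fin that by (intro member_le_sum) auto
      also have "\<dots> = card A * w" using cA by (simp add: w_def avg_def)
      finally show ?thesis using w by (simp add: t_def field_simps)
    qed
    have avt: "avg A t = 1"
      using w unfolding t_def by (simp add: divide_inverse avg_multc w_def[symmetric])
    define v where "v = avg A (\<lambda>a. (t a - 1)\<^sup>2)"
    have v0: "0 \<le> v" unfolding v_def by (rule avg_nonneg) auto
    have sq: "avg A (\<lambda>a. (t a)\<^sup>2) = 1 + v"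
    proof -
      have "v = avg A (\<lambda>a. (t a)\<^sup>2 - (2 * t a - 1))"
        unfolding v_def by (rule avg_cong) (simp add: power2_diff algebra_simps)
      also have "\<dots> = avg A (\<lambda>a. (t a)\<^sup>2) - (2 * avg A t - 1)"
        using fin by (simp add: avg_diff avg_cmult avg_const)
      finally show ?thesis using avt by simp
    qed
    have "avg A (\<lambda>a. t a powr p) \<ge> avg A (\<lambda>a. 1 + p * (t a - 1) + (p - 1) / (4 * card A) * (t a - 1)\<^sup>2)"
    proof (rule avg_mono)
      fix a assume "a \<in> A"
      then show "1 + p * (t a - 1) + (p - 1) / (4 * card A) * (t a - 1)\<^sup>2 \<le> t a powr p"
        using powr_ge_quadratic[of "t a" "card A" p] t0 tM cA p1 \<rho> by simp
    qed
    also have "avg A (\<lambda>a. 1 + p * (t a - 1) + (p - 1) / (4 * card A) * (t a - 1)\<^sup>2)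
        = 1 + (p - 1) / (4 * card A) * v"
      unfolding avg_add avg_cmult avg_diff avt v_def using fin by (simp add: avg_const)
    finally have 1: "avg A (\<lambda>a. t a powr p) \<ge> 1 + (p - 1) / (4 * card A) * v" .
    have "\<rho> \<le> (p - 1) / (4 * card A)" using \<rho> cA by (simp add: field_simps)
    then have 2: "avg A (\<lambda>a. t a powr p) \<ge> 1 + \<rho> * v"
      using 1 v0 by (smt (verit) mult_right_mono)
    have "1 + \<rho> * v = (1 + \<rho> * v) powr 1" using \<rho> v0 by simp
    also have "\<dots> \<le> (1 + \<rho> * v) powr (2/p)"
      using p1 \<rho> v0 by (intro powr_mono) auto
    also have "\<dots> \<le> (avg A (\<lambda>a. t a powr p)) powr (2/p)"
      using 2 \<rho> v0 p1 by (intro powr_mono2) auto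
    finally have 3: "1 + \<rho> * v \<le> (avg A (\<lambda>a. t a powr p)) powr (2/p)" .
    have ut: "u a = w * t a" for a using w by (simp add: t_def)
    have "\<rho> * avg A (\<lambda>a. (u a)\<^sup>2) + (1 - \<rho>) * (avg A u)\<^sup>2 = w\<^sup>2 * (1 + \<rho> * v)"
      unfolding w_def[symmetric] unfolding ut power_mult_distrib avg_cmult sq
      by (simp add: algebra_simps)
    also have "\<dots> \<le> w\<^sup>2 * (avg A (\<lambda>a. t a powr p)) powr (2/p)"
      using 3 by (intro mult_left_mono) auto
    also have "\<dots> = (avg A (\<lambda>a. u a powr p)) powr (2/p)"
    proof -
      have "avg A (\<lambda>a. u a powr p) = w powr p * avg A (\<lambda>a. t a powr p)"
        unfolding avg_cmult[symmetric] ut using w t0 by (intro avg_cong) (simp add: powr_mult)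
      then show ?thesis
        using w p1 by (simp add: powr_mult avg_nonneg powr_powr)
    qed
    finally show ?thesis .
  qed
qed

text \<open>The power mean inequality, as the case \<open>\<rho> = 0\<close> of the previous lemma.
  Through it the number of memory states enters the estimate of the low frequencies.\<close>

lemma sum_powr_inverse_le:
  fixes \<mu> :: "'a \<Rightarrow> real"
  assumes fin: "finite A" "A \<noteq> {}" and \<mu>: "\<And>a. a \<in> A \<Longrightarrow> 0 \<le> \<mu> a" "(\<Sum>a\<in>A. \<mu> a) = 1"
    and p: "1 \<le> p" "p \<le> 2"
  shows "(\<Sum>a\<in>A. \<mu> a powr (1/p)) \<le> card A powr (1 - 1/p)"
proof -
  have cA: "0 < real (card A)" using fin by (simp add: card_gt_0_iff)
  have "(avg A (\<lambda>a. \<mu> a powr (1/p)))\<^sup>2 \<le> (avg A (\<lambda>a. (\<mu> a powr (1/p)) powr p)) powr (2/p)"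
    using avg_two_norm_le[of A "\<lambda>a. \<mu> a powr (1/p)" 0 p] fin p by simp
  also have "avg A (\<lambda>a. (\<mu> a powr (1/p)) powr p) = avg A \<mu>"
    using \<mu> p by (intro avg_cong) (simp add: powr_powr)
  also have "avg A \<mu> = 1 / card A" using \<mu> by (simp add: avg_def)
  also have "(1 / card A) powr (2/p) = ((1 / card A) powr (1/p))\<^sup>2"
    using cA by (simp add: power2_eq_square powr_add[symmetric])
  finally have "avg A (\<lambda>a. \<mu> a powr (1/p)) \<le> (1 / card A) powr (1/p)"
    by (rule power2_le_imp_le) simp
  then have "(\<Sum>a\<in>A. \<mu> a powr (1/p)) \<le> card A * (1 / card A) powr (1/p)"
    using cA by (simp add: avg_def field_simps)
  also have "\<dots> = card A powr (1 - 1/p)"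
    using cA by (simp add: powr_diff powr_divide)
  finally show ?thesis .
qed


text \<open>\<open>form I\<close> is the quadratic form of the operator that keeps block \<open>i\<close> with probability
  \<open>rr i\<close> and resamples it otherwise: blocks of rate 1 are fixed, blocks of rate 0 averaged out.\<close>

locale noisy_blocks =
  fixes V :: "'v set" and S :: "'s set" and Bl :: "'i \<Rightarrow> 'v set" and rr :: "'i \<Rightarrow> real"
  assumes finV: "finite V" and finS: "finite S" and neS: "S \<noteq> {}"
    and rr: "\<And>i. 0 \<le> rr i" "\<And>i. rr i \<le> 1"
    and BlV: "\<And>i. Bl i \<subseteq> V" and disj: "\<And>i j. i \<noteq> j \<Longrightarrow> Bl i \<inter> Bl j = {}"
begin

abbreviation "Y \<equiv> V \<rightarrow>\<^sub>E S"
abbreviation "bsz i \<equiv> card S ^ card (Bl i)"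

text \<open>Density of block \<open>i\<close> of \<open>y'\<close> given \<open>y\<close>, relative
  to the uniform law: \<open>bsz i\<close> is the inverse of the probability that two independent
  blocks agree.\<close>

definition factor where
  "factor i y y' = rr i * real (bsz i) * (if \<forall>v\<in>Bl i. y v = y' v then 1 else 0) + (1 - rr i)"

definition form :: "'i set \<Rightarrow> (('v \<Rightarrow> 's) \<Rightarrow> real) \<Rightarrow> (('v \<Rightarrow> 's) \<Rightarrow> real) \<Rightarrow> real" where
  "form I f g = avg Y (\<lambda>y. avg Y (\<lambda>y'. (\<Prod>i\<in>I. factor i y y') * f y * g y'))"

lemma finY: "finite Y" "Y \<noteq> {}"
  using finV finS neS by (auto intro: finite_PiE simp: PiE_eq_empty_iff)

lemma finB: "finite (Bl i)" using BlV finV finite_subset by blast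

lemma finBS: "finite (Bl i \<rightarrow>\<^sub>E S)" "Bl i \<rightarrow>\<^sub>E S \<noteq> {}" "card (Bl i \<rightarrow>\<^sub>E S) = bsz i"
  using finB finS neS by (auto intro: finite_PiE simp: PiE_eq_empty_iff card_PiE)

lemma form_commute: "form I f g = form I g f"
proof -
  have fc: "factor i y y' = factor i y' y" for i y y' unfolding factor_def by (auto simp: eq_commute)
  have "form I f g = avg Y (\<lambda>y. avg Y (\<lambda>y'. (\<Prod>i\<in>I. factor i y' y) * f y * g y'))"
    unfolding form_def by (subst fc) (rule refl)
  also have "\<dots> = avg Y (\<lambda>y'. avg Y (\<lambda>y. (\<Prod>i\<in>I. factor i y' y) * f y * g y'))"
    by (rule avg_swap)
  also have "\<dots> = form I g f" unfolding form_def by (simp add: mult_ac)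
  finally show ?thesis .
qed

lemma form_add_left: "form I (\<lambda>y. f y + c * g y) e = form I f e + c * form I g e"
proof -
  have "form I (\<lambda>y. f y + c * g y) e
     = avg Y (\<lambda>y. avg Y (\<lambda>y'. (\<Prod>i\<in>I. factor i y y') * f y * e y'
           + c * ((\<Prod>i\<in>I. factor i y y') * g y * e y')))"
    unfolding form_def by (simp add: algebra_simps)
  then show ?thesis unfolding avg_add avg_cmult form_def by simp
qed

lemma form_add_right: "form I e (\<lambda>y. f y + c * g y) = form I e f + c * form I e g"
  using form_add_left form_commute by metis

text \<open>Resampling block \<open>i\<close> in both arguments exposes its values \<open>a\<close>
  and \<open>b\<close>. As the blocks are disjoint, the other factors do not see them, which makes
  induction over the blocks possible.\<close>

lemma form_insert:
  assumes "finite I" "i \<notin> I"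
  shows "form (insert i I) f g = avg (Bl i \<rightarrow>\<^sub>E S) (\<lambda>a. avg (Bl i \<rightarrow>\<^sub>E S) (\<lambda>b.
     (rr i * real (bsz i) * (if a = b then 1 else 0) + (1 - rr i)) *
     form I (\<lambda>y. f (override_on y a (Bl i))) (\<lambda>y. g (override_on y b (Bl i)))))"
proof -
  let ?A = "Bl i \<rightarrow>\<^sub>E S" and ?o = "\<lambda>y a. override_on y a (Bl i)"
  let ?c = "\<lambda>a b. rr i * real (bsz i) * (if a = b then 1 else 0) + (1 - rr i)"
  have pr: "(\<Prod>j\<in>insert i I. factor j (?o y a) (?o y' b)) = ?c a b * (\<Prod>j\<in>I. factor j y y')"
    if "a \<in> ?A" "b \<in> ?A" for a b y y'
  proof -
    have "(\<forall>v\<in>Bl i. a v = b v) \<longleftrightarrow> a = b"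
      using that by (auto simp: PiE_iff intro: extensionalityI)
    then have "factor i (?o y a) (?o y' b) = ?c a b"
      unfolding factor_def by (auto simp: override_on_def)
    moreover have "factor j (?o y a) (?o y' b) = factor j y y'" if "j \<in> I" for j
    proof -
      have "j \<noteq> i" using that assms by blast
      then have "v \<notin> Bl i" if "v \<in> Bl j" for v using disj[of j i] that by blast
      then show ?thesis unfolding factor_def by (auto simp: override_on_def)
    qed
    ultimately show ?thesis using assms by simp
  qed
  have "form (insert i I) f g = avg Y (\<lambda>y. avg ?A (\<lambda>a. avg Y (\<lambda>y'. avg ?A (\<lambda>b.
      (\<Prod>j\<in>insert i I. factor j (?o y a) (?o y' b)) * f (?o y a) * g (?o y' b)))))"
    unfolding form_def
    by (subst avg_override_on[OF BlV finV finS neS, of _ i],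
        subst (2) avg_override_on[OF BlV finV finS neS, of _ i]) simp
  also have "\<dots> = avg Y (\<lambda>y. avg ?A (\<lambda>a. avg Y (\<lambda>y'. avg ?A (\<lambda>b.
      ?c a b * ((\<Prod>j\<in>I. factor j y y') * f (?o y a) * g (?o y' b))))))"
    by (intro avg_cong) (simp only: pr mult_ac)
  also have "\<dots> = avg Y (\<lambda>y. avg ?A (\<lambda>a. avg ?A (\<lambda>b. avg Y (\<lambda>y'.
      ?c a b * ((\<Prod>j\<in>I. factor j y y') * f (?o y a) * g (?o y' b))))))"
    by (subst avg_swap[of Y ?A]) simp
  also have "\<dots> = avg ?A (\<lambda>a. avg Y (\<lambda>y. avg ?A (\<lambda>b. avg Y (\<lambda>y'.
      ?c a b * ((\<Prod>j\<in>I. factor j y y') * f (?o y a) * g (?o y' b))))))"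
    by (rule avg_swap)
  also have "\<dots> = avg ?A (\<lambda>a. avg ?A (\<lambda>b. avg Y (\<lambda>y. avg Y (\<lambda>y'.
      ?c a b * ((\<Prod>j\<in>I. factor j y y') * f (?o y a) * g (?o y' b))))))"
    by (subst (2) avg_swap) simp
  finally show ?thesis unfolding form_def avg_cmult .
qed

lemma avg_avg_diag:
  assumes "finite A" "A \<noteq> {}"
  shows "avg A (\<lambda>a. avg A (\<lambda>b. (c * real (card A) * (if a = b then 1 else 0) + d) * K a b))
    = c * avg A (\<lambda>a. K a a) + d * avg A (\<lambda>a. avg A (\<lambda>b. K a b))"
proof -
  have "avg A (\<lambda>b. (c * real (card A) * (if a = b then 1 else 0) + d) * K a b)
      = c * K a a + d * avg A (K a)" if "a \<in> A" for a
  proof -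
    have "(\<Sum>b\<in>A. c * real (card A) * (if a = b then 1 else 0) * K a b)
        = (\<Sum>b\<in>A. if a = b then c * real (card A) * K a b else 0)"
      by (intro sum.cong) auto
    also have "\<dots> = c * real (card A) * K a a" using assms that by simp
    finally have "avg A (\<lambda>b. c * real (card A) * (if a = b then 1 else 0) * K a b) = c * K a a"
      using assms by (simp add: avg_def)
    then show ?thesis by (simp only: distrib_right avg_add avg_cmult)
  qed
  then have "avg A (\<lambda>a. avg A (\<lambda>b. (c * real (card A) * (if a = b then 1 else 0) + d) * K a b))
      = avg A (\<lambda>a. c * K a a + d * avg A (K a))"
    by (intro avg_cong) simp
  then show ?thesis by (simp only: avg_add avg_cmult)
qed

lemma form_avg:
  "avg A (\<lambda>a. avg A (\<lambda>b. form I (f a) (f b))) = form I (\<lambda>y. avg A (\<lambda>a. f a y)) (\<lambda>y. avg A (\<lambda>b. f b y))"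
proof -
  let ?K = "\<lambda>y y'. (\<Prod>i\<in>I. factor i y y')"
  have "avg A (\<lambda>a. avg A (\<lambda>b. form I (f a) (f b)))
    = avg A (\<lambda>a. avg A (\<lambda>b. avg Y (\<lambda>y. avg Y (\<lambda>y'. ?K y y' * f a y * f b y'))))"
    unfolding form_def ..
  also have "\<dots> = avg A (\<lambda>a. avg Y (\<lambda>y. avg A (\<lambda>b. avg Y (\<lambda>y'. ?K y y' * f a y * f b y'))))"
    by (subst (2) avg_swap) simp
  also have "\<dots> = avg Y (\<lambda>y. avg A (\<lambda>a. avg A (\<lambda>b. avg Y (\<lambda>y'. ?K y y' * f a y * f b y'))))"
    by (rule avg_swap)
  also have "\<dots> = avg Y (\<lambda>y. avg A (\<lambda>a. avg Y (\<lambda>y'. avg A (\<lambda>b. ?K y y' * f a y * f b y'))))"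
    by (subst (3) avg_swap) simp
  also have "\<dots> = avg Y (\<lambda>y. avg Y (\<lambda>y'. avg A (\<lambda>a. avg A (\<lambda>b. ?K y y' * f a y * f b y'))))"
    by (subst (2) avg_swap) simp
  also have "\<dots> = form I (\<lambda>y. avg A (\<lambda>a. f a y)) (\<lambda>y. avg A (\<lambda>b. f b y))"
    unfolding form_def by (simp add: avg_cmult avg_multc mult.assoc)
  finally show ?thesis .
qed

lemma form_nonneg:
  assumes "finite I" shows "0 \<le> form I f f"
  using assms
proof (induction I arbitrary: f rule: finite_induct)
  case empty
  have "form {} f f = (avg Y f)\<^sup>2"
    unfolding form_def by (simp add: avg_cmult avg_multc power2_eq_square)
  then show ?case by simp
next
  case (insert i I)
  have "form (insert i I) f f =
    rr i * avg (Bl i \<rightarrow>\<^sub>E S) (\<lambda>a. form I (\<lambda>y. f (override_on y a (Bl i))) (\<lambda>y. f (override_on y a (Bl i))))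
   + (1 - rr i) * avg (Bl i \<rightarrow>\<^sub>E S) (\<lambda>a. avg (Bl i \<rightarrow>\<^sub>E S) (\<lambda>b.
      form I (\<lambda>y. f (override_on y a (Bl i))) (\<lambda>y. f (override_on y b (Bl i)))))"
    unfolding form_insert[OF insert.hyps] finBS(3)[symmetric]
    by (rule avg_avg_diag[OF finBS(1,2)])
  then show ?case
    unfolding form_avg using insert.IH rr[of i]
    by (simp add: avg_nonneg)
qed

lemma form_Cauchy_Schwarz:
  assumes "finite I" shows "(form I f g)\<^sup>2 \<le> form I f f * form I g g"
proof -
  have q: "0 \<le> form I f f + 2 * c * form I f g + c\<^sup>2 * form I g g" for c
  proof -
    have "0 \<le> form I (\<lambda>y. f y + c * g y) (\<lambda>y. f y + c * g y)" by (rule form_nonneg[OF assms])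
    also have "\<dots> = form I f f + 2 * c * form I f g + c\<^sup>2 * form I g g"
      unfolding form_add_left form_add_right using form_commute[of I g f]
      by (simp add: algebra_simps power2_eq_square)
    finally show ?thesis .
  qed
  show ?thesis
  proof (cases "form I g g = 0")
    case True
    have "form I f g = 0"
    proof (rule ccontr)
      assume "form I f g \<noteq> 0"
      then show False
        \<comment> \<open>Without its square term the quadratic is affine in \<open>c\<close>; this
          \<open>c\<close> gives it the value -1.\<close>
        using q[of "- (form I f f + 1) / (2 * form I f g)"] True by (simp add: field_simps)
    qed
    then show ?thesis using True by simp
  next
    case False
    then have g: "form I g g > 0" using form_nonneg[OF assms, of g] by simp
    have "0 \<le> form I f f - (form I f g)\<^sup>2 / form I g g"
      using q[of "- form I f g / form I g g"] g by (simp add: field_simps power2_eq_square)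
    then show ?thesis using g by (simp add: field_simps)
  qed
qed

text \<open>Tensorisation. The form between the slices \<open>a\<close> and \<open>b\<close> of
  block \<open>i\<close> is bounded by Cauchy-Schwarz through the diagonal forms, hence by a
  multiple of \<open>u a * u b\<close>, where \<open>u\<close> is the p-th root of the slice mean.
  What remains is the one-block inequality for \<open>u\<close>, whose p-th moment is the mean of
  \<open>f\<close>. Blocks kept too often for that inequality pay their size through
  \<open>C i\<close>. The bound \<open>f y \<le> 1\<close> is used when no block is left.\<close>

lemma form_hypercontractive:
  assumes "finite I" and p: "1 \<le> p" "p \<le> 2"
    and C: "\<And>i. i \<in> I \<Longrightarrow> 1 \<le> C i"
    and rC: "\<And>i. i \<in> I \<Longrightarrow> 4 * rr i * real (bsz i) \<le> p - 1 \<or> real (bsz i) \<le> C i"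
    and f: "\<And>y. y \<in> Y \<Longrightarrow> 0 \<le> f y" "\<And>y. y \<in> Y \<Longrightarrow> f y \<le> 1"
  shows "form I f f \<le> (\<Prod>i\<in>I. C i) * (avg Y f) powr (2/p)"
  using assms(1) C rC f
proof (induction I arbitrary: f rule: finite_induct)
  case empty
  have \<mu>: "0 \<le> avg Y f" "avg Y f \<le> 1"
    using empty finY by (auto intro: avg_nonneg avg_le_const)
  have "form {} f f = (avg Y f)\<^sup>2"
    unfolding form_def by (simp add: avg_cmult avg_multc power2_eq_square)
  also have "\<dots> \<le> (avg Y f) powr (2/p)"
  proof (cases "avg Y f = 0")
    case False
    then have "(avg Y f)\<^sup>2 = (avg Y f) powr 2" using \<mu> by (simp add: powr_numeral)
    also have "\<dots> \<le> (avg Y f) powr (2/p)"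
      using \<mu> False p by (intro powr_mono') (auto simp: field_simps)
    finally show ?thesis .
  qed simp
  finally show ?case by simp
next
  case (insert i I)
  let ?A = "Bl i \<rightarrow>\<^sub>E S" and ?K = "\<Prod>i\<in>I. C i"
  define fa where "fa a = (\<lambda>y. f (override_on y a (Bl i)))" for a
  define u where "u a = (avg Y (fa a)) powr (1/p)" for a
  have K0: "0 \<le> ?K" using insert.prems by (intro prod_nonneg) force
  have fa: "0 \<le> fa a y" "fa a y \<le> 1" if "a \<in> ?A" "y \<in> Y" for a y
    using insert.prems(3,4) override_on_PiE[OF that(2,1) BlV] by (auto simp: fa_def)
  have IH: "form I (fa a) (fa a) \<le> ?K * (u a)\<^sup>2" if "a \<in> ?A" for a
  proof -
    have "form I (fa a) (fa a) \<le> ?K * (avg Y (fa a)) powr (2/p)"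
      using insert.prems fa that by (intro insert.IH) auto
    also have "(avg Y (fa a)) powr (2/p) = (u a)\<^sup>2"
      unfolding u_def by (simp add: power2_eq_square powr_add[symmetric])
    finally show ?thesis .
  qed
  have u0: "0 \<le> u a" for a by (simp add: u_def)
  have cross: "form I (fa a) (fa b) \<le> ?K * (u a * u b)" if "a \<in> ?A" "b \<in> ?A" for a b
  proof (rule power2_le_imp_le)
    have "(form I (fa a) (fa b))\<^sup>2 \<le> form I (fa a) (fa a) * form I (fa b) (fa b)"
      by (rule form_Cauchy_Schwarz[OF insert.hyps(1)])
    also have "\<dots> \<le> (?K * (u a)\<^sup>2) * (?K * (u b)\<^sup>2)"
      using IH that K0 form_nonneg[OF insert.hyps(1)] by (intro mult_mono) auto
    finally show "(form I (fa a) (fa b))\<^sup>2 \<le> (?K * (u a * u b))\<^sup>2"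
      by (simp add: power2_eq_square mult_ac)
  qed (use K0 u0 in simp)
  have "form (insert i I) f f =
    rr i * avg ?A (\<lambda>a. form I (fa a) (fa a))
   + (1 - rr i) * avg ?A (\<lambda>a. avg ?A (\<lambda>b. form I (fa a) (fa b)))"
    unfolding form_insert[OF insert.hyps] finBS(3)[symmetric] fa_def
    by (rule avg_avg_diag[OF finBS(1,2)])
  also have "\<dots> \<le> rr i * avg ?A (\<lambda>a. ?K * (u a)\<^sup>2)
      + (1 - rr i) * avg ?A (\<lambda>a. avg ?A (\<lambda>b. ?K * (u a * u b)))"
    using rr[of i] IH cross by (intro add_mono mult_left_mono avg_mono) auto
  also have "\<dots> = ?K * (rr i * avg ?A (\<lambda>a. (u a)\<^sup>2) + (1 - rr i) * (avg ?A u)\<^sup>2)"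
    unfolding avg_cmult avg_multc power2_eq_square by (simp add: algebra_simps)
  also have "\<dots> \<le> ?K * (C i * (avg ?A (\<lambda>a. u a powr p)) powr (2/p))"
  proof (rule mult_left_mono[OF _ K0])
    let ?R = "(avg ?A (\<lambda>a. u a powr p)) powr (2/p)"
    have Ci: "1 \<le> C i" using insert.prems by simp
    have "4 * rr i * real (bsz i) \<le> p - 1 \<or> real (bsz i) \<le> C i" using insert.prems by simp
    then show "rr i * avg ?A (\<lambda>a. (u a)\<^sup>2) + (1 - rr i) * (avg ?A u)\<^sup>2 \<le> C i * ?R"
    proof
      assume "4 * rr i * real (bsz i) \<le> p - 1"
      then have "rr i * avg ?A (\<lambda>a. (u a)\<^sup>2) + (1 - rr i) * (avg ?A u)\<^sup>2 \<le> 1 * ?R"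
        unfolding mult_1_left using avg_two_norm_le[OF finBS(1,2), where u=u and \<rho>="rr i" and p=p] u0 rr p
        by (simp add: finBS)
      also have "\<dots> \<le> C i * ?R" using Ci by (intro mult_right_mono) auto
      finally show ?thesis .
    next
      assume b: "real (bsz i) \<le> C i"
      have J: "(avg ?A u)\<^sup>2 \<le> ?R"
        using avg_two_norm_le[OF finBS(1,2), where u=u and \<rho>=0 and p=p] u0 p by simp
      \<comment> \<open>For nonnegative terms the sum of squares is at most the square of the sum;
        after normalisation this costs one factor of the block size.\<close>
      have "(\<Sum>a\<in>?A. (u a)\<^sup>2) \<le> (\<Sum>a\<in>?A. u a)\<^sup>2"
        unfolding power2_eq_square sum_product
        using u0 finBS by (intro sum_mono member_le_sum) auto
      then have "(\<Sum>a\<in>?A. (u a)\<^sup>2) / bsz i \<le> (\<Sum>a\<in>?A. u a)\<^sup>2 / bsz i"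
        by (intro divide_right_mono) auto
      then have "avg ?A (\<lambda>a. (u a)\<^sup>2) \<le> real (bsz i) * (avg ?A u)\<^sup>2"
        using finS neS unfolding avg_def finBS(3) of_real_of_nat_eq
        by (simp add: power2_eq_square)
      also have "\<dots> \<le> C i * ?R" using b J Ci by (intro mult_mono) auto
      finally have 1: "avg ?A (\<lambda>a. (u a)\<^sup>2) \<le> C i * ?R" .
      have 2: "(avg ?A u)\<^sup>2 \<le> C i * ?R"
        using mult_mono[OF Ci J] Ci by simp
      have "rr i * avg ?A (\<lambda>a. (u a)\<^sup>2) + (1 - rr i) * (avg ?A u)\<^sup>2
          \<le> rr i * (C i * ?R) + (1 - rr i) * (C i * ?R)"
        using 1 2 rr[of i] by (intro add_mono mult_left_mono) auto
      then show ?thesis by (simp add: algebra_simps)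
    qed
  qed
  also have "avg ?A (\<lambda>a. u a powr p) = avg Y f"
  proof -
    have "avg ?A (\<lambda>a. u a powr p) = avg ?A (\<lambda>a. avg Y (fa a))"
    proof (rule avg_cong)
      fix a assume "a \<in> ?A"
      then have "0 \<le> avg Y (fa a)" using fa by (intro avg_nonneg) auto
      then show "u a powr p = avg Y (fa a)" using p by (simp add: u_def powr_powr)
    qed
    also have "\<dots> = avg Y f"
      unfolding fa_def by (subst avg_swap) (rule avg_override_on[OF BlV finV finS neS, symmetric])
    finally show ?thesis .
  qed
  finally show ?case using insert.hyps by (simp add: mult_ac)
qed

end

section \<open>Fourier analysis on the cube\<close>


definition vadd :: "nat \<Rightarrow> nat \<Rightarrow> (nat \<Rightarrow> nat) \<Rightarrow> (nat \<Rightarrow> nat) \<Rightarrow> (nat \<Rightarrow> nat)" where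
  "vadd n q d y = (\<lambda>v\<in>{..<n}. (y v + d v) mod q)"

locale cube =
  fixes n q :: nat
  assumes q2: "2 \<le> q"
begin

abbreviation "X \<equiv> {..<n} \<rightarrow>\<^sub>E {..<q}"

definition "\<zeta> = exp (2 * of_real pi * \<i> * of_nat 1 / of_nat q)"

definition ch :: "(nat \<Rightarrow> nat) \<Rightarrow> (nat \<Rightarrow> nat) \<Rightarrow> complex" where
  "ch W y = (\<Prod>v<n. \<zeta> ^ (W v * y v))"

text \<open>Matrix entry of multiplication by \<open>f\<close> in the basis of characters, that is,
  the Fourier coefficient of \<open>f\<close> at the difference of \<open>U\<close> and
  \<open>W\<close>. Two indices avoid subtraction modulo \<open>q\<close>; with \<open>zer\<close>
  as first index it is the usual coefficient at \<open>U\<close>.\<close>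

definition Z :: "((nat \<Rightarrow> nat) \<Rightarrow> real) \<Rightarrow> (nat \<Rightarrow> nat) \<Rightarrow> (nat \<Rightarrow> nat) \<Rightarrow> complex" where
  "Z f W U = avg X (\<lambda>y. of_real (f y) * (ch W y * cnj (ch U y)))"

definition "zer = (\<lambda>v\<in>{..<n}. 0::nat)"
definition "supp U = {v\<in>{..<n}. U v \<noteq> (0::nat)}"
definition "dif W U = {v\<in>{..<n}. W v \<noteq> (U v::nat)}"

lemma finX: "finite X" "X \<noteq> {}" and cardX: "card X = q ^ n"
  using q2 by (auto intro!: finite_PiE simp: PiE_eq_empty_iff card_PiE lessThan_empty_iff)

lemma zer_X: "zer \<in> X" using q2 by (auto simp: zer_def)

lemma zeta_pow_eq_1: "\<zeta> ^ j = 1 \<longleftrightarrow> q dvd j"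
proof -
  have "\<zeta> ^ j = exp (of_nat j * (2 * of_real pi * \<i> * of_nat 1 / of_nat q))"
    unfolding \<zeta>_def by (rule exp_of_nat_mult[symmetric])
  also have "\<dots> = exp (2 * of_real pi * \<i> * of_nat j / of_nat q)" by (simp add: field_simps)
  finally show ?thesis using complex_root_unity_eq_1[of q j] q2 by simp
qed

lemma norm_zeta: "norm \<zeta> = 1"
proof -
  have "\<zeta> = exp (\<i> * of_real (2 * pi / q))" unfolding \<zeta>_def by (simp add: field_simps)
  then show ?thesis by (simp only: norm_exp_i_times)
qed

lemma zeta_cnj: "\<zeta> ^ a * cnj (\<zeta> ^ a) = 1" "cnj (\<zeta> ^ a) * \<zeta> ^ a = 1"
  using complex_norm_square[of "\<zeta> ^ a"] norm_zeta by (simp_all add: norm_power mult.commute)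

lemma zeta_nz: "\<zeta> \<noteq> 0" using norm_zeta by auto

lemma zeta_mod: "\<zeta> ^ (a * (b mod q)) = \<zeta> ^ (a * b)"
proof -
  have "\<zeta> ^ (a * b) = \<zeta> ^ (a * (q * (b div q)) + a * (b mod q))"
    by (simp add: distrib_left[symmetric])
  also have "\<dots> = \<zeta> ^ (a * (b mod q))"
    unfolding power_add using zeta_pow_eq_1[of "a * (q * (b div q))"] by simp
  finally show ?thesis by simp
qed

lemma zeta_neq: "a < q \<Longrightarrow> b < q \<Longrightarrow> a \<noteq> b \<Longrightarrow> \<zeta> ^ a * cnj (\<zeta> ^ b) \<noteq> 1"
proof
  assume ab: "a < q" "b < q" "a \<noteq> b" and e: "\<zeta> ^ a * cnj (\<zeta> ^ b) = 1"
  have "\<zeta> ^ a = \<zeta> ^ a * (cnj (\<zeta> ^ b) * \<zeta> ^ b)" by (simp add: zeta_cnj del: complex_cnj_power)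
  also have "\<dots> = \<zeta> ^ b" using e by (simp add: mult.assoc[symmetric])
  finally have eq: "\<zeta> ^ a = \<zeta> ^ b" .
  have "False" if "a < q" "b < q" "a < b" "\<zeta> ^ a = \<zeta> ^ b" for a b
  proof -
    have "\<zeta> ^ a * \<zeta> ^ (b - a) = \<zeta> ^ (a + (b - a))" by (rule power_add[symmetric])
    also have "\<dots> = \<zeta> ^ a * 1" using that by simp
    finally have "\<zeta> ^ a * \<zeta> ^ (b - a) = \<zeta> ^ a * 1" .
    then have "\<zeta> ^ (b - a) = 1" using zeta_nz by simp
    then show False using that zeta_pow_eq_1[of "b - a"] nat_dvd_not_less[of "b - a" q] by auto
  qed
  then show False using ab eq by (metis nat_neq_iff)
qed

lemma zeta_orth:
  assumes "a < q" "b < q"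
  shows "(\<Sum>c<q. \<zeta> ^ (a * c) * cnj (\<zeta> ^ (b * c))) = (if a = b then of_nat q else 0)"
proof -
  let ?w = "\<zeta> ^ a * cnj (\<zeta> ^ b)"
  have w: "\<zeta> ^ (a * c) * cnj (\<zeta> ^ (b * c)) = ?w ^ c" for c
    by (simp add: power_mult power_mult_distrib)
  show ?thesis
  proof (cases "a = b")
    case True
    then show ?thesis unfolding w using zeta_cnj[of b] by simp
  next
    case False
    then have w1: "?w \<noteq> 1" using assms zeta_neq by blast
    have "?w ^ q = \<zeta> ^ (a * q) * cnj (\<zeta> ^ (b * q))" using w[of q] by simp
    also have "\<dots> = 1" using zeta_pow_eq_1[of "a*q"] zeta_pow_eq_1[of "b*q"] by simp
    finally have "(\<Sum>c<q. ?w ^ c) = 0" using geometric_sum[OF w1, of q] by simp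
    then show ?thesis unfolding w using False by simp
  qed
qed

lemma ch_commute: "ch W y = ch y W" unfolding ch_def by (simp add: mult.commute)

lemma ch_zer: "ch zer y = 1" unfolding ch_def zer_def by (intro prod.neutral) auto

lemma norm_ch: "norm (ch W y) = 1"
  unfolding ch_def by (simp add: prod_norm[symmetric] norm_power norm_zeta)

lemma avg_prod: "avg X (\<lambda>y. \<Prod>v<n. g v (y v)) = (\<Prod>v<n. (\<Sum>c<q. g v c) / of_nat q)"
  unfolding avg_def cardX
  by (subst prod_sum_PiE[symmetric]) (auto simp: prod_dividef)

lemma ch_orth:
  assumes "W \<in> X" "U \<in> X"
  shows "avg X (\<lambda>y. ch W y * cnj (ch U y)) = (if W = U then 1 else 0)"
proof -
  have "avg X (\<lambda>y. ch W y * cnj (ch U y))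
      = avg X (\<lambda>y. \<Prod>v<n. \<zeta> ^ (W v * y v) * cnj (\<zeta> ^ (U v * y v)))"
    unfolding ch_def cnj_prod prod.distrib ..
  also have "\<dots> = (\<Prod>v<n. (\<Sum>c<q. \<zeta> ^ (W v * c) * cnj (\<zeta> ^ (U v * c))) / of_nat q)"
    by (rule avg_prod[of "\<lambda>v c. \<zeta> ^ (W v * c) * cnj (\<zeta> ^ (U v * c))"])
  also have "\<dots> = (\<Prod>v<n. if W v = U v then 1 else 0)"
    using assms q2 by (intro prod.cong) (auto simp: zeta_orth PiE_iff simp del: complex_cnj_power)
  also have "\<dots> = (if W = U then 1 else 0)"
  proof (cases "W = U")
    case False
    then obtain v where "v < n" "W v \<noteq> U v"
      using assms by (metis PiE_ext lessThan_iff)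
    then show ?thesis using False by (auto intro!: prod_zero)
  qed simp
  finally show ?thesis .
qed

lemma ch_complete:
  assumes "x \<in> X" "y \<in> X"
  shows "(\<Sum>U\<in>X. ch U x * cnj (ch U y)) = (if x = y then of_nat (q ^ n) else 0)"
proof -
  have "avg X (\<lambda>U. ch x U * cnj (ch y U)) = (if x = y then 1 else 0)" using assms by (rule ch_orth)
  then have "(\<Sum>U\<in>X. ch x U * cnj (ch y U)) = (if x = y then of_nat (q ^ n) else 0)"
    unfolding avg_def cardX using q2 by (simp split: if_splits)
  then show ?thesis by (simp add: ch_commute)
qed

lemma Fourier_inversion:
  assumes "x \<in> X"
  shows "of_real (f x) = (\<Sum>U\<in>X. Z f zer U * ch U x)"
proof -
  have "(\<Sum>U\<in>X. Z f zer U * ch U x) = avg X (\<lambda>y. of_real (f y) * (\<Sum>U\<in>X. ch U x * cnj (ch U y)))"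
    unfolding Z_def ch_zer avg_multc[symmetric] sum_distrib_left avg_sum by (simp add: mult_ac)
  also have "\<dots> = avg X (\<lambda>y. if x = y then of_real (f y) * of_nat (q ^ n) else 0)"
    using assms by (intro avg_cong) (auto simp: ch_complete)
  also have "\<dots> = of_real (f x)"
    unfolding avg_def cardX using assms finX q2 by simp
  finally show ?thesis ..
qed

text \<open>The convolution theorem: expanding \<open>F\<close> into characters turns each term into
  a matrix entry of \<open>g\<close>.\<close>

lemma Z_mult: "Z (\<lambda>x. F x * g x) zer U = (\<Sum>W\<in>X. Z F zer W * Z g W U)"
proof -
  have "Z (\<lambda>x. F x * g x) zer U = avg X (\<lambda>x. of_real (F x) * (of_real (g x) * cnj (ch U x)))"
    unfolding Z_def ch_zer by (simp add: mult_ac)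
  also have "\<dots> = avg X (\<lambda>x. \<Sum>W\<in>X. Z F zer W * (of_real (g x) * (ch W x * cnj (ch U x))))"
  proof (rule avg_cong)
    fix x assume "x \<in> X"
    show "of_real (F x) * (of_real (g x) * cnj (ch U x))
        = (\<Sum>W\<in>X. Z F zer W * (of_real (g x) * (ch W x * cnj (ch U x))))"
      unfolding Fourier_inversion[OF \<open>x \<in> X\<close>, of F] sum_distrib_right by (simp add: mult_ac)
  qed
  also have "\<dots> = (\<Sum>W\<in>X. Z F zer W * Z g W U)"
    unfolding avg_sum avg_cmult Z_def ..
  finally show ?thesis .
qed

lemma ch_mult_norm_square:
  assumes "finite S" "S \<subseteq> X"
  shows "avg X (\<lambda>x. (norm (\<Sum>W\<in>S. c W * ch W x))\<^sup>2) = (\<Sum>W\<in>S. (norm (c W))\<^sup>2)"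
proof -
  have "complex_of_real (avg X (\<lambda>x. (norm (\<Sum>W\<in>S. c W * ch W x))\<^sup>2))
      = avg X (\<lambda>x. of_real ((norm (\<Sum>W\<in>S. c W * ch W x))\<^sup>2))"
    unfolding avg_def by simp
  also have "\<dots> = avg X (\<lambda>x. \<Sum>W\<in>S. \<Sum>U\<in>S. c W * cnj (c U) * (ch W x * cnj (ch U x)))"
    unfolding complex_norm_square cnj_sum sum_product by (simp add: mult_ac)
  also have "\<dots> = (\<Sum>W\<in>S. \<Sum>U\<in>S. c W * cnj (c U) * avg X (\<lambda>x. ch W x * cnj (ch U x)))"
    unfolding avg_sum avg_cmult ..
  also have "\<dots> = (\<Sum>W\<in>S. \<Sum>U\<in>S. if W = U then c W * cnj (c U) else 0)"
    using assms by (intro sum.cong) (auto simp: ch_orth subset_eq)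
  also have "\<dots> = (\<Sum>W\<in>S. c W * cnj (c W))" using assms by simp
  also have "\<dots> = of_real (\<Sum>W\<in>S. (norm (c W))\<^sup>2)"
    by (simp add: complex_norm_square[symmetric])
  finally show ?thesis using of_real_eq_iff by blast
qed

lemma Parseval: "(\<Sum>U\<in>X. (norm (Z f zer U))\<^sup>2) = avg X (\<lambda>x. (f x)\<^sup>2)"
proof -
  have "(\<Sum>U\<in>X. (norm (Z f zer U))\<^sup>2) = avg X (\<lambda>x. (norm (\<Sum>W\<in>X. Z f zer W * ch W x))\<^sup>2)"
    using finX by (intro ch_mult_norm_square[symmetric]) auto
  also have "\<dots> = avg X (\<lambda>x. (norm (complex_of_real (f x)))\<^sup>2)"
    by (intro avg_cong) (simp only: Fourier_inversion)
  finally show ?thesis by simp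
qed

lemma norm_Z_le: "(\<And>x. x \<in> X \<Longrightarrow> 0 \<le> f x) \<Longrightarrow> norm (Z f W U) \<le> avg X f"
  unfolding Z_def by (rule order_trans[OF norm_avg_le])
    (auto intro!: avg_mono simp: norm_mult norm_ch)

lemma Z_zer_zer: "Z f zer zer = of_real (avg X f)"
  unfolding Z_def ch_zer avg_def by simp

lemma dif_subset_PiE:
  assumes W: "W \<in> X"
  shows "{U\<in>X. dif W U \<subseteq> A} = PiE {..<n} (\<lambda>v. if v \<in> A then {..<q} else {W v})"
proof (intro set_eqI iffI)
  fix U assume "U \<in> {U\<in>X. dif W U \<subseteq> A}"
  then show "U \<in> PiE {..<n} (\<lambda>v. if v \<in> A then {..<q} else {W v})"
    unfolding PiE_iff dif_def by fastforce
next
  fix U assume U: "U \<in> PiE {..<n} (\<lambda>v. if v \<in> A then {..<q} else {W v})"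
  have "U v \<in> {..<q}" if "v < n" for v
    using PiE_mem[OF U, of v] PiE_mem[OF W, of v] that by (cases "v \<in> A") auto
  moreover have "W v = U v" if "v < n" "v \<notin> A" for v
    using PiE_mem[OF U, of v] that by auto
  ultimately show "U \<in> {U\<in>X. dif W U \<subseteq> A}" using U unfolding PiE_iff dif_def by auto
qed

text \<open>Parseval on a subcube of frequencies. The sum over \<open>U\<close> factors over the
  coordinates: off \<open>A\<close>, where \<open>U\<close> agrees with \<open>W\<close>, the
  factors are 1, and on \<open>A\<close> completeness of the characters forces \<open>y\<close> and
  \<open>y'\<close> to agree. So the right side keeps \<open>A\<close> and averages out the
  rest.\<close>

lemma Z_kernel:
  assumes A: "A \<subseteq> {..<n}" and W: "W \<in> X"
  shows "(\<Sum>U\<in>{U\<in>X. dif W U \<subseteq> A}. (norm (Z f W U))\<^sup>2)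
    = avg X (\<lambda>y. avg X (\<lambda>y'. real (q ^ card A) * (if \<forall>v\<in>A. y v = y' v then 1 else 0) * f y * f y'))"
proof -
  let ?G = "{U\<in>X. dif W U \<subseteq> A}"
  let ?e = "\<lambda>y y' v c. \<zeta> ^ (W v * y v) * cnj (\<zeta> ^ (c * y v)) * cnj (\<zeta> ^ (W v * y' v)) * \<zeta> ^ (c * y' v)"
  have G: "?G = PiE {..<n} (\<lambda>v. if v \<in> A then {..<q} else {W v})"
    by (rule dif_subset_PiE[OF W])
  have sumG: "(\<Sum>U\<in>?G. (ch W y * cnj (ch U y)) * cnj (ch W y' * cnj (ch U y')))
      = of_nat (q ^ card A) * (if \<forall>v\<in>A. y v = y' v then 1 else 0)" if y: "y \<in> X" "y' \<in> X" for y y'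
  proof -
    have "(\<Sum>U\<in>?G. (ch W y * cnj (ch U y)) * cnj (ch W y' * cnj (ch U y')))
       = (\<Sum>U\<in>?G. \<Prod>v<n. ?e y y' v (U v))"
      unfolding ch_def complex_cnj_mult complex_cnj_cnj cnj_prod prod.distrib by (simp add: mult_ac)
    also have "\<dots> = (\<Prod>v<n. \<Sum>c\<in>(if v \<in> A then {..<q} else {W v}). ?e y y' v c)"
      unfolding G by (rule prod_sum_PiE[symmetric]) auto
    also have "\<dots> = (\<Prod>v<n. if v \<in> A then (if y v = y' v then of_nat q else 0) else 1)"
    proof (rule prod.cong[OF refl])
      fix v assume v: "v \<in> {..<n}"
      show "(\<Sum>c\<in>(if v \<in> A then {..<q} else {W v}). ?e y y' v c)
          = (if v \<in> A then (if y v = y' v then of_nat q else 0) else 1)"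
      proof (cases "v \<in> A")
        case True
        have "(\<Sum>c<q. ?e y y' v c) = \<zeta> ^ (W v * y v) * cnj (\<zeta> ^ (W v * y' v)) *
            (\<Sum>c<q. \<zeta> ^ (y' v * c) * cnj (\<zeta> ^ (y v * c)))"
          unfolding sum_distrib_left by (simp add: mult_ac)
        also have "\<dots> = \<zeta> ^ (W v * y v) * cnj (\<zeta> ^ (W v * y' v)) * (if y' v = y v then of_nat q else 0)"
          using y v by (subst zeta_orth) (auto simp: PiE_iff)
        also have "\<dots> = (if y v = y' v then of_nat q else 0)"
          using zeta_cnj by (auto simp del: complex_cnj_power)
        finally show ?thesis using True by simp
      next
        case False
        have "?e y y' v (W v) = (\<zeta> ^ (W v * y v) * cnj (\<zeta> ^ (W v * y v))) * (cnj (\<zeta> ^ (W v * y' v)) * \<zeta> ^ (W v * y' v))"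
          by (simp only: mult.assoc)
        then show ?thesis using False zeta_cnj by simp
      qed
    qed
    also have "\<dots> = (\<Prod>v\<in>A. if y v = y' v then of_nat q else 0)"
      using A by (simp add: prod.inter_restrict[symmetric] Int_absorb1)
    also have "\<dots> = of_nat (q ^ card A) * (if \<forall>v\<in>A. y v = y' v then 1 else 0)"
      using A finite_subset[OF A] by (auto intro!: prod_zero)
    finally show ?thesis .
  qed
  have "complex_of_real (\<Sum>U\<in>?G. (norm (Z f W U))\<^sup>2) = (\<Sum>U\<in>?G. Z f W U * cnj (Z f W U))"
    by (simp add: complex_norm_square[symmetric])
  also have "\<dots> = (\<Sum>U\<in>?G. avg X (\<lambda>y. avg X (\<lambda>y'. of_real (f y * f y') *
      ((ch W y * cnj (ch U y)) * cnj (ch W y' * cnj (ch U y'))))))"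
  proof (rule sum.cong[OF refl])
    fix U
    have "cnj (Z f W U) = avg X (\<lambda>y'. of_real (f y') * cnj (ch W y' * cnj (ch U y')))"
      unfolding Z_def avg_def by (simp add: cnj_sum)
    then have "Z f W U * cnj (Z f W U) = avg X (\<lambda>y. of_real (f y) * (ch W y * cnj (ch U y)) *
        avg X (\<lambda>y'. of_real (f y') * cnj (ch W y' * cnj (ch U y'))))"
      unfolding avg_multc by (simp only: Z_def)
    then show "Z f W U * cnj (Z f W U) = avg X (\<lambda>y. avg X (\<lambda>y'. of_real (f y * f y') *
      ((ch W y * cnj (ch U y)) * cnj (ch W y' * cnj (ch U y')))))"
      by (simp only: avg_cmult[symmetric] of_real_mult mult_ac)
  qed
  also have "\<dots> = avg X (\<lambda>y. avg X (\<lambda>y'. of_real (f y * f y') *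
      (\<Sum>U\<in>?G. ((ch W y * cnj (ch U y)) * cnj (ch W y' * cnj (ch U y'))))))"
    unfolding avg_sum[symmetric] sum_distrib_left ..
  also have "\<dots> = avg X (\<lambda>y. avg X (\<lambda>y'. of_real (f y * f y') *
      (of_nat (q ^ card A) * (if \<forall>v\<in>A. y v = y' v then 1 else 0))))"
    by (intro avg_cong) (simp only: sumG)
  also have "\<dots> = of_real (avg X (\<lambda>y. avg X (\<lambda>y'. real (q ^ card A) * (if \<forall>v\<in>A. y v = y' v then 1 else 0) * f y * f y')))"
  proof -
    have "complex_of_real (f y * f y') * (of_nat (q ^ card A) * (if \<forall>v\<in>A. y v = y' v then 1 else 0))
        = of_real (real (q ^ card A) * (if \<forall>v\<in>A. y v = y' v then 1 else 0) * f y * f y')" for y y'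
      by simp
    then show ?thesis unfolding avg_def by (simp only: of_real_sum of_real_divide of_real_of_nat_eq)
  qed
  finally show ?thesis using of_real_eq_iff by blast
qed

lemma vadd_X: "vadd n q d y \<in> X"
  using q2 by (auto simp: vadd_def)

lemma ch_vadd: "ch W (vadd n q d y) = ch W y * (\<Prod>v<n. \<zeta> ^ (W v * d v))"
  unfolding ch_def prod.distrib[symmetric]
  by (intro prod.cong) (auto simp: vadd_def zeta_mod distrib_left power_add)

lemma bij_vadd: "bij_betw (vadd n q d) X X"
proof -
  have "inj_on (vadd n q d) X"
  proof (rule inj_onI)
    fix y y' assume y: "y \<in> X" "y' \<in> X" and e: "vadd n q d y = vadd n q d y'"
    show "y = y'"
    proof (rule PiE_ext[OF y])
      fix v assume v: "v \<in> {..<n}"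
      then have "(y v + d v) mod q = (y' v + d v) mod q"
        using fun_cong[OF e, of v] by (simp add: vadd_def)
      then obtain a b where "y v + d v + q * a = y' v + d v + q * b"
        unfolding nat_mod_eq_iff by blast
      then have "y v + q * a = y' v + q * b" by simp
      then have "y v mod q = y' v mod q" unfolding nat_mod_eq_iff by blast
      then show "y v = y' v" using y v by (auto simp: PiE_iff)
    qed
  qed
  moreover have "vadd n q d ` X \<subseteq> X" using vadd_X by auto
  ultimately show ?thesis using finX(1) endo_inj_surj by (metis bij_betw_def)
qed

text \<open>Shifting \<open>y\<close> by the indicator of \<open>B\<close> multiplies the integrand
  by the root of unity \<open>?c\<close>, to which only the coordinate \<open>w\<close> contributes.
  It differs from 1, so the average vanishes.\<close>

lemma Z_eq_0:
  assumes inv: "\<And>y. y \<in> X \<Longrightarrow> f (vadd n q (\<lambda>v. if v \<in> B then 1 else 0) y) = f y"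
    and WU: "W \<in> X" "U \<in> X" and B: "dif W U \<inter> B = {w}"
  shows "Z f W U = 0"
proof -
  let ?d = "\<lambda>v. if v \<in> B then 1 else 0::nat"
  let ?c = "(\<Prod>v<n. \<zeta> ^ (W v * ?d v)) * cnj (\<Prod>v<n. \<zeta> ^ (U v * ?d v))"
  have w: "w < n" "W w \<noteq> U w" "w \<in> B" using B by (auto simp: dif_def)
  have "?c = (\<Prod>v<n. \<zeta> ^ (W v * ?d v) * cnj (\<zeta> ^ (U v * ?d v)))"
    unfolding cnj_prod prod.distrib ..
  also have "\<dots> = (\<Prod>v<n. if v = w then \<zeta> ^ W w * cnj (\<zeta> ^ U w) else 1)"
  proof (rule prod.cong[OF refl])
    fix v assume "v \<in> {..<n}"
    show "\<zeta> ^ (W v * ?d v) * cnj (\<zeta> ^ (U v * ?d v)) = (if v = w then \<zeta> ^ W w * cnj (\<zeta> ^ U w) else 1)"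
    proof (cases "v = w")
      case False
      then have "v \<in> B \<longrightarrow> W v = U v" using B \<open>v \<in> {..<n}\<close> by (auto simp: dif_def)
      then show ?thesis using False zeta_cnj(1)[of "U v"] by auto
    qed (use w in simp)
  qed
  also have "\<dots> = \<zeta> ^ W w * cnj (\<zeta> ^ U w)" using w by simp
  finally have c: "?c \<noteq> 1" using zeta_neq[of "W w" "U w"] WU w by (auto simp: PiE_iff simp del: complex_cnj_power)
  have "Z f W U = avg X (\<lambda>y. of_real (f (vadd n q ?d y)) * (ch W (vadd n q ?d y) * cnj (ch U (vadd n q ?d y))))"
    unfolding Z_def by (rule avg_bij[OF bij_vadd, symmetric])
  also have "\<dots> = avg X (\<lambda>y. ?c * (of_real (f y) * (ch W y * cnj (ch U y))))"
    by (intro avg_cong) (simp only: inv ch_vadd complex_cnj_mult mult_ac)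
  also have "\<dots> = ?c * Z f W U" unfolding Z_def avg_cmult ..
  finally have "(1 - ?c) * Z f W U = 0" by (simp add: algebra_simps)
  then show ?thesis using c by simp
qed

text \<open>The weights \<open>g s x\<close> add up to 1 over the states, so the sum of absolute
  values over all states is at most the mean of \<open>norm (\<Phi> x)\<close>: the number of states
  does not enter. The predicate \<open>P\<close> may exclude frequencies whose entries vanish for
  every state.\<close>

lemma sum_norm_Z_le:
  assumes S: "S \<subseteq> X" and fin: "finite \<Sigma>"
    and g: "\<And>s x. s \<in> \<Sigma> \<Longrightarrow> x \<in> X \<Longrightarrow> 0 \<le> g s x" "\<And>x. x \<in> X \<Longrightarrow> (\<Sum>s\<in>\<Sigma>. g s x) = 1"
    and P: "\<And>s W. s \<in> \<Sigma> \<Longrightarrow> W \<in> S \<Longrightarrow> \<not> P W \<Longrightarrow> Z (g s) W U = 0"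
  shows "(\<Sum>s\<in>\<Sigma>. norm (\<Sum>W\<in>S. c W * Z (g s) W U)) \<le> sqrt (\<Sum>W\<in>{W\<in>S. P W}. (norm (c W))\<^sup>2)"
proof -
  let ?S = "{W\<in>S. P W}"
  have finS: "finite S" using S finX finite_subset by blast
  define \<Phi> where "\<Phi> x = (\<Sum>W\<in>?S. c W * ch W x)" for x
  have 1: "norm (\<Sum>W\<in>S. c W * Z (g s) W U) \<le> avg X (\<lambda>x. g s x * norm (\<Phi> x))" if s: "s \<in> \<Sigma>" for s
  proof -
    have "(\<Sum>W\<in>S. c W * Z (g s) W U) = (\<Sum>W\<in>?S. c W * Z (g s) W U)"
      using P s finS by (intro sum.mono_neutral_right) auto
    also have "\<dots> = avg X (\<lambda>x. of_real (g s x) * \<Phi> x * cnj (ch U x))"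
      unfolding Z_def \<Phi>_def avg_cmult[symmetric] avg_sum[symmetric] sum_distrib_left sum_distrib_right
      by (simp add: mult_ac)
    finally have "norm (\<Sum>W\<in>S. c W * Z (g s) W U) = norm (avg X (\<lambda>x. of_real (g s x) * \<Phi> x * cnj (ch U x)))"
      by simp
    also have "\<dots> \<le> avg X (\<lambda>x. norm (of_real (g s x) * \<Phi> x * cnj (ch U x)))" by (rule norm_avg_le)
    also have "\<dots> = avg X (\<lambda>x. g s x * norm (\<Phi> x))"
      using g s by (intro avg_cong) (simp add: norm_mult norm_ch)
    finally show ?thesis .
  qed
  have "(\<Sum>s\<in>\<Sigma>. norm (\<Sum>W\<in>S. c W * Z (g s) W U)) \<le> (\<Sum>s\<in>\<Sigma>. avg X (\<lambda>x. g s x * norm (\<Phi> x)))"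
    by (rule sum_mono[OF 1])
  also have "\<dots> = avg X (\<lambda>x. (\<Sum>s\<in>\<Sigma>. g s x) * norm (\<Phi> x))"
    unfolding avg_sum[symmetric] sum_distrib_right ..
  also have "\<dots> = avg X (\<lambda>x. sqrt ((norm (\<Phi> x))\<^sup>2))"
    using g by (intro avg_cong) simp
  also have "\<dots> \<le> sqrt (avg X (\<lambda>x. (norm (\<Phi> x))\<^sup>2))" by (rule avg_sqrt_le) simp
  also have "avg X (\<lambda>x. (norm (\<Phi> x))\<^sup>2) = (\<Sum>W\<in>?S. (norm (c W))\<^sup>2)"
    unfolding \<Phi>_def using finS S by (intro ch_mult_norm_square) auto
  finally show ?thesis .
qed

end

section \<open>Random slots\<close>


definition singles :: "(nat \<Rightarrow> nat) \<Rightarrow> nat set \<Rightarrow> nat set" where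
  "singles h S = {i\<in>h ` S. card {v\<in>S. h v = i} = 1}"

text \<open>An occupied slot that is not single holds at least two elements.\<close>

lemma card_image_singles:
  assumes "finite S"
  shows "2 * card (h ` S) \<le> card (singles h S) + card S"
proof -
  have "card S = (\<Sum>i\<in>h ` S. card {v\<in>S. h v = i})"
  proof -
    have "card S = (\<Sum>i\<in>h ` S. \<Sum>v\<in>{v\<in>S. h v = i}. 1)"
      using assms by (subst sum.group) auto
    then show ?thesis by simp
  qed
  moreover have "(\<Sum>i\<in>h ` S. 2) \<le> (\<Sum>i\<in>h ` S. card {v\<in>S. h v = i} + (if i \<in> singles h S then 1 else 0))"
  proof (rule sum_mono)
    fix i assume i: "i \<in> h ` S"
    then have "card {v\<in>S. h v = i} \<noteq> 0" using assms by auto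
    then show "2 \<le> card {v\<in>S. h v = i} + (if i \<in> singles h S then 1 else 0)"
      using i by (auto simp: singles_def)
  qed
  moreover have "(\<Sum>i\<in>h ` S. if i \<in> singles h S then 1 else 0::nat) = card (singles h S)"
  proof -
    have "h ` S \<inter> {i. i \<in> singles h S} = singles h S" by (auto simp: singles_def)
    then show ?thesis using assms by (simp add: sum.If_cases)
  qed
  ultimately show ?thesis by (simp add: sum.distrib)
qed

text \<open>The elements are thrown one at a time: a new one hits one of at most \<open>w\<close>
  occupied slots with probability at most \<open>w / m\<close>, and otherwise contributes a factor
  \<open>x\<close>.\<close>

lemma avg_power_card_image:
  fixes x :: real and n m w :: nat
  assumes "finite S" "S \<subseteq> {..<n}" "card S \<le> w" "0 \<le> x" "0 < m"
  shows "avg ({..<n} \<rightarrow>\<^sub>E {..<m}) (\<lambda>h. x ^ card (h ` S)) \<le> (x + w / m) ^ card S"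
  using assms
proof (induction S rule: finite_induct)
  case empty
  have "finite ({..<n} \<rightarrow>\<^sub>E {..<m})" "({..<n} \<rightarrow>\<^sub>E {..<m}) \<noteq> {}"
    using \<open>0 < m\<close> by (auto intro!: finite_PiE simp: PiE_eq_empty_iff lessThan_empty_iff)
  then show ?case by (simp add: avg_const)
next
  case (insert v S)
  let ?H = "{..<n} \<rightarrow>\<^sub>E {..<m}"
  have w: "card S \<le> w" and v: "v \<in> {..<n}" using insert by auto
  have "avg ?H (\<lambda>h. x ^ card (h ` insert v S)) = avg ?H (\<lambda>h. avg {..<m} (\<lambda>c. x ^ card ((h(v := c)) ` insert v S)))"
    using v \<open>0 < m\<close> by (intro avg_fun_upd) (auto simp: lessThan_empty_iff)
  also have "\<dots> \<le> avg ?H (\<lambda>h. x ^ card (h ` S) * (x + w / m))"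
  proof (rule avg_mono)
    fix h assume "h \<in> ?H"
    let ?T = "h ` S"
    have T: "?T \<subseteq> {..<m}" "finite ?T" using \<open>h \<in> ?H\<close> insert.prems insert.hyps by auto
    have im: "(h(v := c)) ` insert v S = insert c ?T" for c
      using insert.hyps by (auto simp: image_iff)
    have "(\<Sum>c<m. x ^ card (insert c ?T)) \<le> (\<Sum>c<m. x ^ card ?T * ((if c \<in> ?T then 1 else 0) + x))"
      using T \<open>0 \<le> x\<close> by (intro sum_mono) (auto simp: insert_absorb card_insert_if algebra_simps)
    also have "\<dots> = x ^ card ?T * (card ?T + m * x)"
    proof -
      have "(\<Sum>c<m. if c \<in> ?T then 1 else 0::real) = card ?T"
        using T by (simp add: sum.If_cases Int_absorb1)
      then show ?thesis by (simp add: sum_distrib_left[symmetric] sum.distrib)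
    qed
    also have "\<dots> \<le> x ^ card ?T * (w + m * x)"
      using card_image_le[OF insert.hyps(1), of h] w \<open>0 \<le> x\<close> by (intro mult_left_mono) auto
    finally have "(\<Sum>c<m. x ^ card (insert c ?T)) / m \<le> x ^ card ?T * (w + m * x) / m"
      by (intro divide_right_mono) auto
    then show "avg {..<m} (\<lambda>c. x ^ card ((h(v := c)) ` insert v S)) \<le> x ^ card ?T * (x + w / m)"
      unfolding im avg_def using \<open>0 < m\<close> by (simp add: field_simps)
  qed
  also have "\<dots> = avg ?H (\<lambda>h. x ^ card (h ` S)) * (x + w / m)" by (rule avg_multc)
  also have "\<dots> \<le> (x + w / m) ^ card S * (x + w / m)"
    using insert w \<open>0 \<le> x\<close> by (intro mult_right_mono) auto
  finally show ?case using insert.hyps by (simp add: mult.commute)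
qed

text \<open>By \<open>card_image_singles\<close>, few single slots force few occupied slots. As
  \<open>r \<le> 1\<close>, the power can be transferred to the size of the image, where throwing
  one element at a time works.\<close>

lemma avg_power_singles:
  fixes r :: real and n m :: nat
  assumes "S \<subseteq> {..<n}" "0 < r" "r \<le> 1" "0 < m"
  shows "avg ({..<n} \<rightarrow>\<^sub>E {..<m}) (\<lambda>h. r ^ card (singles h S)) \<le> (r + card S / (m * r)) ^ card S"
proof -
  let ?H = "{..<n} \<rightarrow>\<^sub>E {..<m}"
  have fS: "finite S" using assms finite_subset by blast
  have "avg ?H (\<lambda>h. r ^ card (singles h S)) \<le> avg ?H (\<lambda>h. (r\<^sup>2) ^ card (h ` S) * inverse (r ^ card S))"
  proof (rule avg_mono)
    fix h
    have "r ^ (card (singles h S) + card S) \<le> r ^ (2 * card (h ` S))"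
      using card_image_singles[OF fS] assms by (intro power_decreasing) auto
    then show "r ^ card (singles h S) \<le> (r\<^sup>2) ^ card (h ` S) * inverse (r ^ card S)"
      using assms by (simp add: power_add power_mult[symmetric] field_simps)
  qed
  also have "\<dots> = avg ?H (\<lambda>h. (r\<^sup>2) ^ card (h ` S)) * inverse (r ^ card S)" by (rule avg_multc)
  also have "\<dots> \<le> (r\<^sup>2 + card S / m) ^ card S * inverse (r ^ card S)"
    using assms fS by (intro mult_right_mono avg_power_card_image) auto
  also have "\<dots> = ((r\<^sup>2 + card S / m) / r) ^ card S" unfolding power_divide by (rule divide_inverse[symmetric])
  also have "(r\<^sup>2 + card S / m) / r = r + card S / (m * r)"
    using assms by (simp add: field_simps power2_eq_square)
  finally show ?thesis .
qed

lemma avg_power_singles_sqrt: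
  fixes r :: real and n m :: nat
  assumes "S \<subseteq> {..<n}" "card S \<le> m" "0 < m" "0 < r" "r \<le> 1" "sqrt (card S / m) \<le> r"
  shows "avg ({..<n} \<rightarrow>\<^sub>E {..<m}) (\<lambda>h. r ^ card (singles h S)) \<le> (2 * r) ^ card S"
proof -
  have "card S / m \<le> r\<^sup>2"
    using assms(6) by (rule sqrt_le_D)
  then have "card S / (m * r) \<le> r" using assms by (simp add: field_simps power2_eq_square)
  then have "(r + card S / (m * r)) ^ card S \<le> (2 * r) ^ card S"
    using assms by (intro power_mono) auto
  then show ?thesis using avg_power_singles[of S n r m] assms by linarith
qed

text \<open>The previous bound needs \<open>r\<close> to reach \<open>sqrt (card S / m)\<close>, the
  value that balances its two terms; a smaller \<open>r\<close> is first raised to it.\<close>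

lemma avg_power_singles_le:
  fixes r :: real and n m :: nat
  assumes "S \<subseteq> {..<n}" "card S \<le> m" "0 < m" "0 < r" "r \<le> 1"
  shows "avg ({..<n} \<rightarrow>\<^sub>E {..<m}) (\<lambda>h. r ^ card (singles h S))
    \<le> (2 * r) ^ card S + (2 * sqrt (card S / m)) ^ card S"
proof (cases "sqrt (card S / m) \<le> r")
  case True
  then have "avg ({..<n} \<rightarrow>\<^sub>E {..<m}) (\<lambda>h. r ^ card (singles h S)) \<le> (2 * r) ^ card S"
    using assms by (intro avg_power_singles_sqrt) auto
  also have "\<dots> \<le> (2 * r) ^ card S + (2 * sqrt (card S / m)) ^ card S" by simp
  finally show ?thesis .
next
  case False
  let ?r = "sqrt (card S / m)"
  have r0: "0 < ?r" "?r \<le> 1" using False assms by linarith (use assms in simp)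
  have "avg ({..<n} \<rightarrow>\<^sub>E {..<m}) (\<lambda>h. r ^ card (singles h S))
     \<le> avg ({..<n} \<rightarrow>\<^sub>E {..<m}) (\<lambda>h. ?r ^ card (singles h S))"
    using False assms by (intro avg_mono power_mono) auto
  also have "\<dots> \<le> (2 * ?r) ^ card S"
    using r0 assms by (intro avg_power_singles_sqrt) auto
  also have "\<dots> \<le> (2 * r) ^ card S + (2 * ?r) ^ card S" using assms by simp
  finally show ?thesis .
qed

text \<open>Markov's inequality: on this event \<open>r ^ card (singles h S)\<close> equals 1, and
  \<open>r\<close> is put at the balancing value.\<close>

lemma avg_no_singles_le:
  fixes n m :: nat
  assumes "S \<subseteq> {..<n}" "card S \<le> m" "0 < m"
  shows "avg ({..<n} \<rightarrow>\<^sub>E {..<m}) (\<lambda>h. if singles h S = {} then 1 else 0) \<le> (2 * sqrt (card S / m)) ^ card S"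
proof (cases "card S = 0")
  case True
  have "finite ({..<n} \<rightarrow>\<^sub>E {..<m})" "({..<n} \<rightarrow>\<^sub>E {..<m}) \<noteq> {}"
    using \<open>0 < m\<close> by (auto intro!: finite_PiE simp: PiE_eq_empty_iff lessThan_empty_iff)
  then show ?thesis unfolding True power_0 by (rule avg_le_const) simp
next
  case False
  let ?r = "sqrt (card S / m)"
  have r: "0 < ?r" "?r \<le> 1" using False assms by simp_all
  have "avg ({..<n} \<rightarrow>\<^sub>E {..<m}) (\<lambda>h. if singles h S = {} then 1 else 0)
     \<le> avg ({..<n} \<rightarrow>\<^sub>E {..<m}) (\<lambda>h. ?r ^ card (singles h S))"
    using r by (intro avg_mono) auto
  also have "\<dots> \<le> (2 * ?r) ^ card S" using r assms by (intro avg_power_singles_sqrt) auto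
  finally show ?thesis .
qed


definition slot :: "nat \<Rightarrow> (nat \<Rightarrow> nat) \<Rightarrow> nat \<Rightarrow> nat set" where
  "slot n h i = {v\<in>{..<n}. h v = i}"

lemma (in cube) card_dif_subset:
  assumes A: "A \<subseteq> {..<n}" and W: "W \<in> X"
  shows "card {U\<in>X. dif W U \<subseteq> A} = q ^ card A"
proof -
  have "{U\<in>X. dif W U \<subseteq> A} = PiE {..<n} (\<lambda>v. if v \<in> A then {..<q} else {W v})"
    by (rule dif_subset_PiE[OF W])
  then have "card {U\<in>X. dif W U \<subseteq> A} = (\<Prod>v<n. card (if v \<in> A then {..<q} else {W v}))"
    by (simp add: card_PiE)
  also have "\<dots> = (\<Prod>v<n. if v \<in> A then q else 1)" by (intro prod.cong) auto
  also have "\<dots> = (\<Prod>v\<in>A. q)"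
    using A by (simp add: prod.inter_restrict[symmetric] Int_absorb1)
  finally show ?thesis by simp
qed

text \<open>If each \<open>i\<close> joins \<open>J\<close> independently with probability
  \<open>rr i\<close>, both sides are the probability that \<open>J\<close> contains
  \<open>K\<close>.\<close>

lemma sum_Pow_superset_weight:
  fixes rr :: "'a \<Rightarrow> real"
  assumes "finite I" "K \<subseteq> I"
  shows "(\<Sum>J\<in>{J\<in>Pow I. K \<subseteq> J}. (\<Prod>i\<in>J. rr i) * (\<Prod>i\<in>I - J. 1 - rr i)) = (\<Prod>i\<in>K. rr i)"
proof -
  have fK: "finite K" using assms finite_subset by blast
  have "(\<Sum>J\<in>{J\<in>Pow I. K \<subseteq> J}. (\<Prod>i\<in>J. rr i) * (\<Prod>i\<in>I - J. 1 - rr i))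
     = (\<Sum>B\<in>Pow (I - K). (\<Prod>i\<in>K \<union> B. rr i) * (\<Prod>i\<in>I - (K \<union> B). 1 - rr i))"
    by (rule sum.reindex_bij_witness[where i="\<lambda>B. K \<union> B" and j="\<lambda>J. J - K"])
       (use assms in \<open>auto simp: Un_absorb1\<close>)
  also have "\<dots> = (\<Sum>B\<in>Pow (I - K). (\<Prod>i\<in>K. rr i) * ((\<Prod>i\<in>B. rr i) * (\<Prod>i\<in>(I - K) - B. 1 - rr i)))"
  proof (rule sum.cong[OF refl])
    fix B assume "B \<in> Pow (I - K)"
    have eqD: "I - (K \<union> B) = I - K - B" by blast
    from \<open>B \<in> Pow (I - K)\<close> have "finite B" "K \<inter> B = {}" using assms finite_subset[of B I] by auto
    then show "(\<Prod>i\<in>K \<union> B. rr i) * (\<Prod>i\<in>I - (K \<union> B). 1 - rr i)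
       = (\<Prod>i\<in>K. rr i) * ((\<Prod>i\<in>B. rr i) * (\<Prod>i\<in>(I - K) - B. 1 - rr i))"
      using fK by (simp add: prod.union_disjoint eqD mult.assoc)
  qed
  also have "\<dots> = (\<Prod>i\<in>K. rr i) * (\<Prod>i\<in>I - K. rr i + (1 - rr i))"
    using assms unfolding sum_distrib_left[symmetric] by (subst prod_add) auto
  finally show ?thesis by simp
qed

text \<open>One round with the slot map frozen, entered at frequency \<open>W\<close>;
  \<open>f\<close> stands for the probability of one memory transition as a function of the hidden
  assignment.\<close>

locale slotted = cube +
  fixes h :: "nat \<Rightarrow> nat" and k :: nat and W :: "nat \<Rightarrow> nat" and f :: "(nat \<Rightarrow> nat) \<Rightarrow> real"
  assumes W: "W \<in> X"
    and f0: "\<And>y. y \<in> X \<Longrightarrow> 0 \<le> f y" and f1: "\<And>y. y \<in> X \<Longrightarrow> f y \<le> 1"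
    and inv_slot: "\<And>i y. y \<in> X \<Longrightarrow> f (vadd n q (\<lambda>v. if v \<in> slot n h i then 1 else 0) y) = f y"
    and inv_bad: "\<And>w y. w < n \<Longrightarrow> card (slot n h (h w)) \<noteq> k \<Longrightarrow> y \<in> X \<Longrightarrow>
        f (vadd n q (\<lambda>v. if v \<in> {w} then 1 else 0) y) = f y"
begin

abbreviation "T \<equiv> h ` supp W"
definition "\<U> = {U\<in>X. singles h (dif W U) = {} \<and> (\<forall>v\<in>dif W U. card (slot n h (h v)) = k)}"
definition "outer U = {v\<in>supp U. h v \<notin> T}"

lemma fins [simp]: "finite (supp U)" "finite (dif W U)" "finite (outer U)" "finite (slot n h i)"
  by (auto simp: supp_def dif_def outer_def slot_def)

text \<open>A slot with exactly one difference makes the entry vanish through the shift of that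
  slot; a difference in a slot of the wrong size does so through the shift of that variable
  alone.\<close>

lemma Z_outside: "U \<in> X \<Longrightarrow> U \<notin> \<U> \<Longrightarrow> Z f W U = 0"
proof -
  assume U: "U \<in> X" "U \<notin> \<U>"
  then consider i where "i \<in> singles h (dif W U)" | v where "v \<in> dif W U" "card (slot n h (h v)) \<noteq> k"
    unfolding \<U>_def by blast
  then show ?thesis
  proof cases
    case 1
    then have "card {v\<in>dif W U. h v = i} = 1" by (simp add: singles_def)
    then obtain w where "{v\<in>dif W U. h v = i} = {w}" by (auto simp: card_1_singleton_iff)
    then have "dif W U \<inter> slot n h i = {w}" by (auto simp: slot_def dif_def)
    then show ?thesis using Z_eq_0[of f "slot n h i" W U w] inv_slot W U by blast
  next
    case 2
    then have "v < n" "dif W U \<inter> {v} = {v}" by (auto simp: dif_def)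
    then show ?thesis using Z_eq_0[of f "{v}" W U v] inv_bad[OF \<open>v < n\<close> 2(2)] W U by blast
  qed
qed

lemma outer_dif: "outer U = {v\<in>dif W U. h v \<notin> T}"
  unfolding outer_def supp_def dif_def by (force simp: image_iff)

lemma not_single: "U \<in> \<U> \<Longrightarrow> card {v\<in>dif W U. h v = i} \<noteq> 1"
proof
  assume "U \<in> \<U>" and c: "card {v\<in>dif W U. h v = i} = 1"
  then have "singles h (dif W U) = {}" by (simp add: \<U>_def)
  moreover have "i \<in> h ` dif W U" using c by (auto simp: card_1_singleton_iff)
  ultimately show False using c by (auto simp: singles_def)
qed

text \<open>If a slot holds a single element of \<open>supp W\<close> and \<open>U\<close> vanished
  on it, that element would be the only difference there. So every such slot keeps an element of
  \<open>supp U\<close>, and \<open>outer U\<close> lies in other slots.\<close>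

lemma supp_ge:
  assumes "U \<in> \<U>" shows "card (singles h (supp W)) + card (outer U) \<le> card (supp U)"
proof -
  let ?I = "{v\<in>supp U. h v \<in> T}"
  have "singles h (supp W) \<subseteq> h ` ?I"
  proof
    fix i assume i: "i \<in> singles h (supp W)"
    then have "i \<in> T" and "card {v\<in>supp W. h v = i} = 1" by (auto simp: singles_def)
    then obtain w where w: "{v\<in>supp W. h v = i} = {w}" by (auto simp: card_1_singleton_iff)
    have "\<exists>v\<in>supp U. h v = i"
    proof (rule ccontr)
      assume "\<not> ?thesis"
      then have "v < n \<Longrightarrow> h v = i \<Longrightarrow> U v = 0" for v by (auto simp: supp_def)
      then have "{v\<in>dif W U. h v = i} = {v\<in>supp W. h v = i}" by (auto simp: supp_def dif_def)
      then show False using not_single[OF assms, of i] w by simp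
    qed
    then obtain v where "v \<in> supp U" "h v = i" by blast
    then have "v \<in> ?I" "h v = i" using \<open>i \<in> T\<close> by auto
    then show "i \<in> h ` ?I" by (metis imageI)
  qed
  then have "card (singles h (supp W)) \<le> card (h ` ?I)" by (intro card_mono) auto
  also have "\<dots> \<le> card ?I" by (rule card_image_le) simp
  finally have "card (singles h (supp W)) \<le> card ?I" .
  moreover have "card (supp U) = card ?I + card (outer U)"
  proof -
    have "supp U = ?I \<union> outer U" "?I \<inter> outer U = {}" by (auto simp: outer_def)
    then show ?thesis using card_Un_disjoint[of ?I "outer U"] by simp
  qed
  ultimately show ?thesis by simp
qed

text \<open>Off the slots of \<open>W\<close> the support of \<open>U\<close> consists of
  differences, which come at least two to a slot.\<close>

lemma outer_ge:
  assumes "U \<in> \<U>" shows "2 * card (h ` outer U) \<le> card (outer U)"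
proof -
  have "singles h (outer U) = {}"
  proof (rule ccontr)
    assume "singles h (outer U) \<noteq> {}"
    then obtain i where i: "i \<in> h ` outer U" "card {v\<in>outer U. h v = i} = 1" by (auto simp: singles_def)
    then have "i \<notin> T" by (auto simp: outer_def)
    then have "{v\<in>outer U. h v = i} = {v\<in>dif W U. h v = i}" unfolding outer_dif by auto
    then show False using i not_single[OF assms, of i] by simp
  qed
  then show ?thesis using card_image_singles[of "outer U" h] by simp
qed

lemma card_T: "card T \<le> card (supp W)" by (rule card_image_le) simp

text \<open>Once the set \<open>J\<close> of slots met by \<open>outer U\<close> is given,
  \<open>U\<close> is free only on the slots in \<open>J\<close> and \<open>T\<close> that have
  \<open>k\<close> variables. Summing over \<open>J\<close> yields a binomial product over the at
  most \<open>n\<close> slots of that size.\<close>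

lemma sum_outer_weight:
  fixes x :: real
  assumes "0 \<le> x"
  shows "(\<Sum>U\<in>\<U>. x ^ card (h ` outer U)) \<le> (q ^ k) ^ card (supp W) * (1 + q ^ k * x) ^ n"
proof -
  define GS where "GS = {i\<in>h ` {..<n}. card (slot n h i) = k}"
  have fGS: "finite GS" by (simp add: GS_def)
  have cGS: "card GS \<le> n"
    using card_mono[of "h ` {..<n}" GS] card_image_le[of "{..<n}" h] by (auto simp: GS_def)
  have sub: "h ` outer U \<in> Pow GS" if "U \<in> \<U>" for U
    using that unfolding outer_dif GS_def \<U>_def by (auto simp: dif_def)
  have fU: "finite \<U>" using finX by (simp add: \<U>_def)
  have cnt: "card {U\<in>\<U>. h ` outer U = J} \<le> q ^ (k * (card J + card (supp W)))" if J: "J \<in> Pow GS" for J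
  proof -
    let ?B = "{i\<in>J \<union> T. card (slot n h i) = k}"
    let ?A = "\<Union>i\<in>?B. slot n h i"
    have fJ: "finite J" using J fGS finite_subset by auto
    have "{U\<in>\<U>. h ` outer U = J} \<subseteq> {U\<in>X. dif W U \<subseteq> ?A}"
    proof
      fix U assume "U \<in> {U\<in>\<U>. h ` outer U = J}"
      then have U: "U \<in> \<U>" "h ` outer U = J" by auto
      have "v \<in> ?A" if v: "v \<in> dif W U" for v
      proof -
        have "card (slot n h (h v)) = k" using U v by (simp add: \<U>_def)
        moreover have "h v \<in> J \<union> T" using U v unfolding outer_dif by auto
        moreover have "v \<in> slot n h (h v)" using v by (auto simp: slot_def dif_def)
        ultimately show ?thesis by blast
      qed
      then show "U \<in> {U\<in>X. dif W U \<subseteq> ?A}" using U by (auto simp: \<U>_def)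
    qed
    then have "card {U\<in>\<U>. h ` outer U = J} \<le> card {U\<in>X. dif W U \<subseteq> ?A}"
      using finX by (intro card_mono) auto
    also have "\<dots> = q ^ card ?A" using W by (intro card_dif_subset) (auto simp: slot_def)
    also have "\<dots> \<le> q ^ (k * (card J + card (supp W)))"
    proof (rule power_increasing)
      have "card ?A \<le> (\<Sum>i\<in>?B. card (slot n h i))" using fJ by (intro card_UN_le) auto
      also have "\<dots> = k * card ?B" by simp
      also have "card ?B \<le> card (J \<union> T)" using fJ by (intro card_mono) auto
      also have "card (J \<union> T) \<le> card J + card (supp W)" using card_Un_le[of J T] card_T by linarith
      finally show "card ?A \<le> k * (card J + card (supp W))" by simp
    qed (use q2 in simp)
    finally show ?thesis .
  qed
  have "(\<Sum>U\<in>\<U>. x ^ card (h ` outer U)) = (\<Sum>J\<in>Pow GS. \<Sum>U\<in>{U\<in>\<U>. h ` outer U = J}. x ^ card (h ` outer U))"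
    using fU fGS sub by (intro sum.group[symmetric]) auto
  also have "\<dots> = (\<Sum>J\<in>Pow GS. real (card {U\<in>\<U>. h ` outer U = J}) * x ^ card J)"
    by (intro sum.cong) auto
  also have "\<dots> \<le> (\<Sum>J\<in>Pow GS. real (q ^ (k * (card J + card (supp W)))) * x ^ card J)"
    using cnt assms by (intro sum_mono mult_right_mono) (auto simp del: of_nat_power)
  also have "\<dots> = real (q ^ k) ^ card (supp W) * (\<Sum>J\<in>Pow GS. (q ^ k * x) ^ card J)"
    unfolding sum_distrib_left
    by (intro sum.cong) (simp_all add: power_mult power_add power_mult_distrib distrib_left)
  also have "(\<Sum>J\<in>Pow GS. (q ^ k * x) ^ card J) = (\<Sum>J\<in>Pow GS. (\<Prod>i\<in>J. q ^ k * x) * (\<Prod>i\<in>GS - J. 1))"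
    by simp
  also have "\<dots> = (\<Prod>i\<in>GS. q ^ k * x + 1)" by (rule prod_add[OF fGS, symmetric])
  also have "\<dots> = (1 + q ^ k * x) ^ card GS" by (simp add: add.commute)
  also have "real (q ^ k) ^ card (supp W) * (1 + q ^ k * x) ^ card GS
      \<le> real (q ^ k) ^ card (supp W) * (1 + q ^ k * x) ^ n"
    using cGS assms by (intro mult_left_mono power_increasing) auto
  finally show ?thesis by simp
qed

text \<open>Expanding the product of the block factors selects a random set \<open>J\<close> of kept
  slots. \<open>Z_kernel\<close> evaluates the term of each \<open>J\<close>, and \<open>U\<close>
  is counted exactly when \<open>J\<close> contains every slot with a difference.\<close>

lemma sum_weight_Z:
  assumes rr: "\<And>i. 0 \<le> rr i" "\<And>i. rr i \<le> 1"
  shows "(\<Sum>U\<in>X. (\<Prod>i\<in>h ` dif W U. rr i) * (norm (Z f W U))\<^sup>2)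
    = noisy_blocks.form {..<n} {..<q} (slot n h) rr (h ` {..<n}) f f"
proof -
  interpret nb: noisy_blocks "{..<n}" "{..<q}" "slot n h" rr
    using q2 rr by unfold_locales (auto simp: slot_def lessThan_empty_iff)
  let ?I = "h ` {..<n}"
  define P where "P J = (\<Prod>i\<in>J. rr i) * (\<Prod>i\<in>?I - J. 1 - rr i)" for J
  define A where "A J = (\<Union>i\<in>J. slot n h i)" for J
  have cardA: "card (A J) = (\<Sum>i\<in>J. card (slot n h i))" if "J \<in> Pow ?I" for J
    unfolding A_def using that finite_subset[of J ?I] by (intro card_UN_disjoint) (auto simp: slot_def)
  have pr: "(\<Prod>i\<in>?I. nb.factor i y y')
     = (\<Sum>J\<in>Pow ?I. P J * (real (q ^ card (A J)) * (if \<forall>v\<in>A J. y v = y' v then 1 else 0)))" for y y'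
  proof -
    have "(\<Prod>i\<in>?I. nb.factor i y y') = (\<Sum>J\<in>Pow ?I.
        (\<Prod>i\<in>J. rr i * real (card {..<q} ^ card (slot n h i)) * (if \<forall>v\<in>slot n h i. y v = y' v then 1 else 0)) *
        (\<Prod>i\<in>?I - J. 1 - rr i))"
      unfolding nb.factor_def by (rule prod_add) simp
    also have "\<dots> = (\<Sum>J\<in>Pow ?I. P J * (real (q ^ card (A J)) * (if \<forall>v\<in>A J. y v = y' v then 1 else 0)))"
    proof (rule sum.cong[OF refl])
      fix J assume J: "J \<in> Pow ?I"
      then have fJ: "finite J" using finite_subset by auto
      have "(\<Prod>i\<in>J. if \<forall>v\<in>slot n h i. y v = y' v then 1 else 0::real) = (if \<forall>v\<in>A J. y v = y' v then 1 else 0)"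
        using fJ by (auto simp: A_def intro!: prod_zero)
      moreover have "(\<Prod>i\<in>J. real (card {..<q} ^ card (slot n h i))) = real (q ^ card (A J))"
        unfolding cardA[OF J] by (simp add: power_sum)
      ultimately show "(\<Prod>i\<in>J. rr i * real (card {..<q} ^ card (slot n h i)) * (if \<forall>v\<in>slot n h i. y v = y' v then 1 else 0)) *
        (\<Prod>i\<in>?I - J. 1 - rr i) = P J * (real (q ^ card (A J)) * (if \<forall>v\<in>A J. y v = y' v then 1 else 0))"
        unfolding prod.distrib P_def by (simp only: mult_ac)
    qed
    finally show ?thesis .
  qed
  have "nb.form ?I f f = avg X (\<lambda>y. avg X (\<lambda>y'. \<Sum>J\<in>Pow ?I. P J *
      (real (q ^ card (A J)) * (if \<forall>v\<in>A J. y v = y' v then 1 else 0) * f y * f y')))"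
    unfolding nb.form_def pr sum_distrib_right by (simp only: mult.assoc)
  also have "\<dots> = (\<Sum>J\<in>Pow ?I. P J * (\<Sum>U\<in>{U\<in>X. dif W U \<subseteq> A J}. (norm (Z f W U))\<^sup>2))"
    unfolding avg_sum avg_cmult
    using W by (intro sum.cong refl arg_cong2[where f="(*)"] Z_kernel[symmetric]) (auto simp: A_def slot_def)
  also have "\<dots> = (\<Sum>J\<in>Pow ?I. \<Sum>U\<in>X. if dif W U \<subseteq> A J then P J * (norm (Z f W U))\<^sup>2 else 0)"
    unfolding sum_distrib_left using finX by (intro sum.cong refl sum.inter_filter)
  also have "\<dots> = (\<Sum>U\<in>X. \<Sum>J\<in>Pow ?I. if dif W U \<subseteq> A J then P J * (norm (Z f W U))\<^sup>2 else 0)"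
    by (rule sum.swap)
  also have "\<dots> = (\<Sum>U\<in>X. (\<Prod>i\<in>h ` dif W U. rr i) * (norm (Z f W U))\<^sup>2)"
  proof (rule sum.cong[OF refl])
    fix U
    have eq: "dif W U \<subseteq> A J \<longleftrightarrow> h ` dif W U \<subseteq> J" for J
      by (auto simp: A_def slot_def dif_def subset_eq)
    have "(\<Sum>J\<in>Pow ?I. if dif W U \<subseteq> A J then P J * (norm (Z f W U))\<^sup>2 else 0)
       = (\<Sum>J\<in>{J\<in>Pow ?I. h ` dif W U \<subseteq> J}. P J * (norm (Z f W U))\<^sup>2)"
      unfolding eq by (rule sum.inter_filter[symmetric]) simp
    also have "\<dots> = (\<Sum>J\<in>{J\<in>Pow ?I. h ` dif W U \<subseteq> J}. P J) * (norm (Z f W U))\<^sup>2"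
      by (simp add: sum_distrib_right)
    also have "(\<Sum>J\<in>{J\<in>Pow ?I. h ` dif W U \<subseteq> J}. P J) = (\<Prod>i\<in>h ` dif W U. rr i)"
      unfolding P_def by (rule sum_Pow_superset_weight) (auto simp: dif_def)
    finally show "(\<Sum>J\<in>Pow ?I. if dif W U \<subseteq> A J then P J * (norm (Z f W U))\<^sup>2 else 0)
       = (\<Prod>i\<in>h ` dif W U. rr i) * (norm (Z f W U))\<^sup>2" .
  qed
  finally show ?thesis ..
qed

text \<open>Cauchy-Schwarz with weight \<open>\<rho>\<close> per outer slot: one factor counts
  frequencies, the other is a hypercontractive form. By \<open>supp_ge\<close> and
  \<open>outer_ge\<close> an outer slot brings at least two powers of \<open>r\<close>, hence
  \<open>r ^ 4 / \<rho>\<close> under the first root. The exponent \<open>p\<close> is the least one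
  that \<open>form_hypercontractive\<close> admits for rate \<open>\<rho>\<close> on blocks of
  \<open>k\<close> variables.\<close>

lemma sum_power_norm_Z_le:
  fixes r \<rho> p :: real
  assumes r: "0 < r" "r \<le> 1" and \<rho>: "0 < \<rho>" and p: "p = 1 + 4 * q ^ k * \<rho>" "p \<le> 2"
  shows "(\<Sum>U\<in>X. r ^ card (supp U) * norm (Z f W U))
    \<le> r ^ card (singles h (supp W)) * (sqrt ((q ^ k) ^ card (supp W) * (1 + q ^ k * (r ^ 4 / \<rho>)) ^ n)
        * sqrt ((q ^ k) ^ card (supp W) * avg X f powr (2 / p)))"
proof -
  have q0: "real q ^ k \<ge> 1" using q2 by simp
  have \<rho>1: "\<rho> \<le> 1"
  proof -
    have "1 * \<rho> \<le> real q ^ k * \<rho>" using q0 \<rho> by (intro mult_right_mono) auto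
    moreover have "4 * (real q ^ k * \<rho>) \<le> 1" using p by (simp add: mult.assoc)
    ultimately show ?thesis by linarith
  qed
  have p1: "1 \<le> p" using p \<rho> by simp
  \<comment> \<open>The slots of \<open>W\<close> must not be damped, so they pay by their size.
    Slots of the wrong size carry no difference for \<open>U\<close> in \<open>\<U>\<close>; rate 0
    is free there and makes large blocks harmless.\<close>
  define rr where "rr i = (if card (slot n h i) = k then if i \<in> T then 1 else \<rho> else 0)" for i
  define j where "j U = card (h ` outer U)" for U
  have rr: "0 \<le> rr i" "rr i \<le> 1" for i using \<rho> \<rho>1 by (auto simp: rr_def)
  have fU: "finite \<U>" "\<U> \<subseteq> X" using finX by (auto simp: \<U>_def)
  interpret nb: noisy_blocks "{..<n}" "{..<q}" "slot n h" rr
    using q2 rr by unfold_locales (auto simp: slot_def lessThan_empty_iff)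
  have "(\<Sum>U\<in>X. r ^ card (supp U) * norm (Z f W U)) = (\<Sum>U\<in>\<U>. r ^ card (supp U) * norm (Z f W U))"
    using fU finX Z_outside by (intro sum.mono_neutral_right) auto
  also have "\<dots> \<le> (\<Sum>U\<in>\<U>. r ^ card (singles h (supp W)) * (sqrt ((r ^ 4 / \<rho>) ^ j U) * sqrt (\<rho> ^ j U * (norm (Z f W U))\<^sup>2)))"
  proof (rule sum_mono)
    fix U assume U: "U \<in> \<U>"
    have "r ^ card (supp U) \<le> r ^ (card (singles h (supp W)) + card (outer U))"
      using supp_ge[OF U] r by (intro power_decreasing) auto
    also have "\<dots> \<le> r ^ card (singles h (supp W)) * r ^ (2 * j U)"
      unfolding power_add using outer_ge[OF U] r by (intro mult_left_mono power_decreasing) (auto simp: j_def)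
    finally have "r ^ card (supp U) * norm (Z f W U) \<le> r ^ card (singles h (supp W)) * (r ^ (2 * j U) * norm (Z f W U))"
      unfolding mult.assoc[symmetric] by (intro mult_right_mono) auto
    also have "r ^ (2 * j U) * norm (Z f W U) = sqrt ((r ^ 4 / \<rho>) ^ j U) * sqrt (\<rho> ^ j U * (norm (Z f W U))\<^sup>2)"
    proof -
      have "(r ^ 4 / \<rho>) ^ j U * (\<rho> ^ j U * (norm (Z f W U))\<^sup>2) = (r ^ (2 * j U) * norm (Z f W U))\<^sup>2"
        using \<rho> by (simp add: power_divide power_mult_distrib power_mult[symmetric] mult.commute)
      then show ?thesis using r by (simp add: real_sqrt_mult[symmetric] del: real_sqrt_mult)
    qed
    finally show "r ^ card (supp U) * norm (Z f W U) \<le> r ^ card (singles h (supp W)) * (sqrt ((r ^ 4 / \<rho>) ^ j U) * sqrt (\<rho> ^ j U * (norm (Z f W U))\<^sup>2))"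
      .
  qed
  also have "\<dots> \<le> r ^ card (singles h (supp W)) * (sqrt (\<Sum>U\<in>\<U>. (r ^ 4 / \<rho>) ^ j U) * sqrt (\<Sum>U\<in>\<U>. \<rho> ^ j U * (norm (Z f W U))\<^sup>2))"
    unfolding sum_distrib_left[symmetric]
    using r \<rho> by (intro mult_left_mono sum_sqrt_mult_le) auto
  also have "\<dots> \<le> r ^ card (singles h (supp W)) * (sqrt ((q ^ k) ^ card (supp W) * (1 + q ^ k * (r ^ 4 / \<rho>)) ^ n)
        * sqrt ((q ^ k) ^ card (supp W) * avg X f powr (2 / p)))"
  proof (intro mult_left_mono mult_mono real_sqrt_le_mono)
    show "(\<Sum>U\<in>\<U>. (r ^ 4 / \<rho>) ^ j U) \<le> (q ^ k) ^ card (supp W) * (1 + q ^ k * (r ^ 4 / \<rho>)) ^ n"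
      unfolding j_def using \<rho> sum_outer_weight[of "r ^ 4 / \<rho>"] by simp
    have "(\<Sum>U\<in>\<U>. \<rho> ^ j U * (norm (Z f W U))\<^sup>2) = (\<Sum>U\<in>\<U>. (\<Prod>i\<in>h ` dif W U. rr i) * (norm (Z f W U))\<^sup>2)"
    proof (rule sum.cong[OF refl])
      fix U assume U: "U \<in> \<U>"
      have "(\<Prod>i\<in>h ` dif W U. rr i) = (\<Prod>i\<in>h ` dif W U. if i \<in> h ` outer U then \<rho> else 1)"
      proof (rule prod.cong[OF refl])
        fix i assume "i \<in> h ` dif W U"
        then show "rr i = (if i \<in> h ` outer U then \<rho> else 1)"
          using U unfolding rr_def \<U>_def outer_dif by auto
      qed
      also have "\<dots> = (\<Prod>i\<in>h ` outer U. \<rho>)"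
      proof -
        have "h ` outer U \<subseteq> h ` dif W U" unfolding outer_dif by auto
        then show ?thesis by (simp add: prod.inter_restrict[symmetric] Int_absorb1)
      qed
      finally show "\<rho> ^ j U * (norm (Z f W U))\<^sup>2 = (\<Prod>i\<in>h ` dif W U. rr i) * (norm (Z f W U))\<^sup>2"
        by (simp add: j_def)
    qed
    also have "\<dots> \<le> (\<Sum>U\<in>X. (\<Prod>i\<in>h ` dif W U. rr i) * (norm (Z f W U))\<^sup>2)"
      using fU finX rr by (intro sum_mono2 mult_nonneg_nonneg prod_nonneg) auto
    also have "\<dots> = nb.form (h ` {..<n}) f f" by (rule sum_weight_Z[OF rr])
    also have "\<dots> \<le> (\<Prod>i\<in>h ` {..<n}. if i \<in> T then real q ^ k else 1) * avg X f powr (2 / p)"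
    proof (rule nb.form_hypercontractive)
      fix i
      show "4 * rr i * real (card {..<q} ^ card (slot n h i)) \<le> p - 1
        \<or> real (card {..<q} ^ card (slot n h i)) \<le> (if i \<in> T then real q ^ k else 1)"
        using p p1 \<rho> by (auto simp: rr_def)
    qed (use p1 p f0 f1 q0 in auto)
    also have "\<dots> \<le> (q ^ k) ^ card (supp W) * avg X f powr (2 / p)"
    proof (rule mult_right_mono)
      have "(\<Prod>i\<in>h ` {..<n}. if i \<in> T then real q ^ k else 1) = (\<Prod>i\<in>T. real q ^ k)"
      proof -
        have "T \<subseteq> h ` {..<n}" by (auto simp: supp_def)
        then show ?thesis by (simp add: prod.inter_restrict[symmetric] Int_absorb1)
      qed
      also have "\<dots> = (real q ^ k) ^ card T" by simp
      also have "\<dots> \<le> (real q ^ k) ^ card (supp W)" using q0 card_T by (intro power_increasing) auto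
      finally show "(\<Prod>i\<in>h ` {..<n}. if i \<in> T then real q ^ k else 1) \<le> real ((q ^ k) ^ card (supp W))" by simp
    qed simp
    finally show "(\<Sum>U\<in>\<U>. \<rho> ^ j U * (norm (Z f W U))\<^sup>2) \<le> (q ^ k) ^ card (supp W) * avg X f powr (2 / p)" .
  qed (use r \<rho> in \<open>auto intro!: sum_nonneg\<close>)
  finally show ?thesis .
qed

end

section \<open>Evolution of Fourier mass over the rounds\<close>


context cube
begin

lemma Z_sum: "Z (\<lambda>x. \<Sum>s\<in>S. f s x) W U = (\<Sum>s\<in>S. Z (f s) W U)"
  unfolding Z_def of_real_sum sum_distrib_right avg_sum ..

lemma Z_avg: "Z (\<lambda>x. avg S (\<lambda>h. f h x)) W U = avg S (\<lambda>h. Z (f h) W U)"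
proof -
  have "Z (\<lambda>x. avg S (\<lambda>h. f h x)) W U = avg X (\<lambda>x. avg S (\<lambda>h. of_real (f h x) * (ch W x * cnj (ch U x))))"
    unfolding Z_def avg_multc by (simp add: avg_def)
  then show ?thesis unfolding Z_def by (simp add: avg_swap[of X S])
qed

lemma supp_dif: "card (supp W) \<le> card (dif W U) + card (supp U)"
proof -
  have "supp W \<subseteq> dif W U \<union> supp U" by (auto simp: supp_def dif_def)
  then have "card (supp W) \<le> card (dif W U \<union> supp U)" by (intro card_mono) (auto simp: supp_def dif_def)
  then show ?thesis using card_Un_le[of "dif W U" "supp U"] by linarith
qed

lemma card_supp_le: "card (supp W) \<le> n" "card (dif W U) \<le> n"
  using card_mono[of "{..<n}" "supp W"] card_mono[of "{..<n}" "dif W U"]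
  by (auto simp: supp_def dif_def subset_eq)

lemma supp_zer_iff: "W \<in> X \<Longrightarrow> card (supp W) = 0 \<longleftrightarrow> W = zer"
proof -
  assume W: "W \<in> X"
  have "card (supp W) = 0 \<longleftrightarrow> supp W = {}" by (simp add: supp_def)
  also have "\<dots> \<longleftrightarrow> W = zer"
  proof
    assume "supp W = {}"
    then show "W = zer" using W zer_X by (intro PiE_ext[OF W zer_X]) (auto simp: supp_def zer_def)
  qed (auto simp: supp_def zer_def)
  finally show ?thesis .
qed

lemma dif_zer: "dif W zer = supp W" by (auto simp: dif_def zer_def supp_def)

end

text \<open>\<open>Yk h s s' x\<close> is the probability of passing from memory state \<open>s\<close> to \<open>s'\<close> in a YES round
  with slots \<open>h\<close>, averaged over the shifts of the slots. The two invariances say that only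
  differences within a slot are visible, and that only slots of exactly \<open>k\<close> variables emit
  constraints. In \<open>F\<close> the memory evolves with \<open>x\<close> fixed (YES), in \<open>p\<close> with a fresh \<open>x\<close> every round (NO).\<close>

locale hidden = cube +
  fixes m k :: nat and \<Sigma> :: "'s set" and Yk :: "(nat \<Rightarrow> nat) \<Rightarrow> 's \<Rightarrow> 's \<Rightarrow> (nat \<Rightarrow> nat) \<Rightarrow> real"
    and ini :: "'s \<Rightarrow> real"
  assumes nm: "n \<le> m" "0 < m" and fin: "finite \<Sigma>" "\<Sigma> \<noteq> {}"
    and Y0: "\<And>h s s' x. s \<in> \<Sigma> \<Longrightarrow> s' \<in> \<Sigma> \<Longrightarrow> x \<in> X \<Longrightarrow> 0 \<le> Yk h s s' x"
    and Y1: "\<And>h s x. s \<in> \<Sigma> \<Longrightarrow> x \<in> X \<Longrightarrow> (\<Sum>s'\<in>\<Sigma>. Yk h s s' x) = 1"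
    and Y_slot: "\<And>h s s' i x. s \<in> \<Sigma> \<Longrightarrow> s' \<in> \<Sigma> \<Longrightarrow> x \<in> X \<Longrightarrow> h \<in> {..<n} \<rightarrow>\<^sub>E {..<m} \<Longrightarrow>
        Yk h s s' (vadd n q (\<lambda>v. if v \<in> slot n h i then 1 else 0) x) = Yk h s s' x"
    and Y_bad: "\<And>h s s' w x. s \<in> \<Sigma> \<Longrightarrow> s' \<in> \<Sigma> \<Longrightarrow> x \<in> X \<Longrightarrow> h \<in> {..<n} \<rightarrow>\<^sub>E {..<m} \<Longrightarrow> w < n \<Longrightarrow>
        card (slot n h (h w)) \<noteq> k \<Longrightarrow>
        Yk h s s' (vadd n q (\<lambda>v. if v \<in> {w} then 1 else 0) x) = Yk h s s' x"
    and ini: "\<And>s. s \<in> \<Sigma> \<Longrightarrow> 0 \<le> ini s" "(\<Sum>s\<in>\<Sigma>. ini s) = 1"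
begin

abbreviation "H \<equiv> {..<n} \<rightarrow>\<^sub>E {..<m}"

primrec F :: "nat \<Rightarrow> 's \<Rightarrow> (nat \<Rightarrow> nat) \<Rightarrow> real" where
  "F 0 = (\<lambda>s x. ini s)"
| "F (Suc t) = (\<lambda>s' x. \<Sum>s\<in>\<Sigma>. F t s x * avg H (\<lambda>h. Yk h s s' x))"

primrec p :: "nat \<Rightarrow> 's \<Rightarrow> real" where
  "p 0 = ini"
| "p (Suc t) = (\<lambda>s'. \<Sum>s\<in>\<Sigma>. p t s * avg H (\<lambda>h. avg X (Yk h s s')))"

definition "\<mu> t s = avg X (F t s)"
definition "Fh t s U = Z (F t s) zer U"
definition "Lv w = {U\<in>X. card (supp U) = w}"
definition "Alev t w = (\<Sum>s\<in>\<Sigma>. \<Sum>U\<in>Lv w. norm (Fh t s U))"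
text \<open>The bound of \<open>avg_no_singles_le\<close> for the probability that \<open>d\<close>
  given variables leave no slot with exactly one of them.\<close>

definition "\<pi> d = (2 * sqrt (real d / real m)) ^ d"

lemma finH: "finite H" "H \<noteq> {}"
  using nm by (auto intro!: finite_PiE simp: PiE_eq_empty_iff lessThan_empty_iff)

lemma F_nonneg: "s \<in> \<Sigma> \<Longrightarrow> x \<in> X \<Longrightarrow> 0 \<le> F t s x"
  by (induction t arbitrary: s) (auto intro!: sum_nonneg mult_nonneg_nonneg avg_nonneg simp: ini Y0)

lemma sum_F: "x \<in> X \<Longrightarrow> (\<Sum>s\<in>\<Sigma>. F t s x) = 1"
proof (induction t)
  case (Suc t)
  have "(\<Sum>s'\<in>\<Sigma>. F (Suc t) s' x) = (\<Sum>s\<in>\<Sigma>. F t s x * avg H (\<lambda>h. \<Sum>s'\<in>\<Sigma>. Yk h s s' x))"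
    unfolding F.simps avg_sum sum_distrib_left by (rule sum.swap)
  also have "\<dots> = (\<Sum>s\<in>\<Sigma>. F t s x)"
    using Suc.prems finH by (intro sum.cong) (auto simp: Y1 avg_const)
  finally show ?case using Suc by simp
qed (simp add: ini)

lemma F_le_1: "s \<in> \<Sigma> \<Longrightarrow> x \<in> X \<Longrightarrow> F t s x \<le> 1"
  using member_le_sum[of s \<Sigma> "\<lambda>s. F t s x"] F_nonneg fin by (simp add: sum_F)

lemma \<mu>_nonneg: "s \<in> \<Sigma> \<Longrightarrow> 0 \<le> \<mu> t s" unfolding \<mu>_def by (intro avg_nonneg F_nonneg)

lemma sum_\<mu>: "(\<Sum>s\<in>\<Sigma>. \<mu> t s) = 1"
proof -
  have "(\<Sum>s\<in>\<Sigma>. \<mu> t s) = avg X (\<lambda>x. \<Sum>s\<in>\<Sigma>. F t s x)" unfolding \<mu>_def avg_sum ..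
  also have "\<dots> = avg X (\<lambda>x. 1)" by (intro avg_cong sum_F)
  finally show ?thesis using finX by (simp add: avg_const)
qed

lemma sum_sqrt_\<mu>: "(\<Sum>s\<in>\<Sigma>. sqrt (\<mu> t s)) \<le> sqrt (card \<Sigma>)"
  using sum_sqrt_le[of \<Sigma> "\<mu> t"] \<mu>_nonneg sum_\<mu> by simp

text \<open>Parseval, together with \<open>F t s x \<le> 1\<close>.\<close>

lemma sum_Fh_square: "s \<in> \<Sigma> \<Longrightarrow> (\<Sum>U\<in>X. (norm (Fh t s U))\<^sup>2) \<le> \<mu> t s"
proof -
  assume s: "s \<in> \<Sigma>"
  have "(F t s x)\<^sup>2 \<le> F t s x" if "x \<in> X" for x
    using mult_left_le[of "F t s x" "F t s x"] F_nonneg F_le_1 s that by (simp add: power2_eq_square)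
  then show ?thesis unfolding Fh_def Parseval \<mu>_def by (intro avg_mono)
qed

lemma norm_Fh_le: "s \<in> \<Sigma> \<Longrightarrow> norm (Fh t s U) \<le> \<mu> t s"
  unfolding Fh_def \<mu>_def by (intro norm_Z_le F_nonneg)

lemma Alev_nonneg: "0 \<le> Alev t w" unfolding Alev_def by (intro sum_nonneg) simp

lemma Lv_0: "Lv 0 = {zer}"
proof (intro set_eqI iffI)
  fix U assume "U \<in> Lv 0"
  then show "U \<in> {zer}" using supp_zer_iff[of U] by (simp add: Lv_def)
next
  fix U assume "U \<in> {zer}"
  then show "U \<in> Lv 0" using supp_zer_iff[of zer] zer_X by (simp add: Lv_def)
qed

lemma Alev_0: "Alev t 0 = 1"
proof -
  have "Alev t 0 = (\<Sum>s\<in>\<Sigma>. \<bar>\<mu> t s\<bar>)" unfolding Alev_def Lv_0 Fh_def \<mu>_def by (simp add: Z_zer_zer)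
  also have "\<dots> = (\<Sum>s\<in>\<Sigma>. \<mu> t s)" by (intro sum.cong) (auto simp: \<mu>_nonneg)
  finally show ?thesis by (simp add: sum_\<mu>)
qed

lemma Alev_start: "0 < w \<Longrightarrow> Alev 0 w = 0"
proof -
  assume w: "0 < w"
  have "Fh 0 s U = 0" if "U \<in> Lv w" for s U
  proof -
    have U: "U \<in> X" "zer \<noteq> U" using that w supp_zer_iff[of U] by (auto simp: Lv_def)
    have "Fh 0 s U = of_real (ini s) * avg X (\<lambda>y. ch zer y * cnj (ch U y))"
      unfolding Fh_def Z_def F.simps avg_cmult ..
    then show ?thesis using ch_orth[OF zer_X U(1)] U(2) by simp
  qed
  then show ?thesis by (simp add: Alev_def)
qed

lemma \<pi>_bound: "avg H (\<lambda>h. if singles h (dif W U) = {} then 1 else 0) \<le> \<pi> (card (dif W U))"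
proof -
  have "dif W U \<subseteq> {..<n}" by (auto simp: dif_def)
  moreover have "card (dif W U) \<le> m" using nm card_supp_le(2)[of W U] by linarith
  ultimately show ?thesis unfolding \<pi>_def using nm(2) by (rule avg_no_singles_le)
qed

lemma \<pi>_nonneg: "0 \<le> \<pi> d" by (simp add: \<pi>_def)

lemma Z_Yk_single:
  assumes "s \<in> \<Sigma>" "s' \<in> \<Sigma>" "h \<in> H" "W \<in> X" "U \<in> X" "singles h (dif W U) \<noteq> {}"
  shows "Z (Yk h s s') W U = 0"
proof -
  obtain i where "card {v\<in>dif W U. h v = i} = 1" using assms(6) by (auto simp: singles_def)
  then obtain w where "{v\<in>dif W U. h v = i} = {w}" by (auto simp: card_1_singleton_iff)
  then have "dif W U \<inter> slot n h i = {w}" by (auto simp: slot_def dif_def)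
  then show ?thesis using Z_eq_0[of "Yk h s s'" "slot n h i" W U w] Y_slot assms by blast
qed

text \<open>For a fixed \<open>h\<close> only those \<open>W\<close> survive whose difference from
  \<open>U\<close> has no single slot. The bound by \<open>sum_norm_Z_le\<close> does not see the
  number of states, and concavity of the root moves the average over \<open>h\<close> onto this
  event.\<close>

lemma high_frequency_bound:
  assumes s: "s \<in> \<Sigma>" and U: "U \<in> X" and S: "S \<subseteq> X"
  shows "avg H (\<lambda>h. \<Sum>s'\<in>\<Sigma>. norm (\<Sum>W\<in>S. Fh t s W * Z (Yk h s s') W U))
    \<le> sqrt (\<Sum>W\<in>S. (norm (Fh t s W))\<^sup>2 * \<pi> (card (dif W U)))"
proof -
  let ?P = "\<lambda>h W. singles h (dif W U) = {}"
  have finS: "finite S" using S finX finite_subset by blast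
  have "avg H (\<lambda>h. \<Sum>s'\<in>\<Sigma>. norm (\<Sum>W\<in>S. Fh t s W * Z (Yk h s s') W U))
     \<le> avg H (\<lambda>h. sqrt (\<Sum>W\<in>{W\<in>S. ?P h W}. (norm (Fh t s W))\<^sup>2))"
  proof (rule avg_mono)
    fix h assume h: "h \<in> H"
    show "(\<Sum>s'\<in>\<Sigma>. norm (\<Sum>W\<in>S. Fh t s W * Z (Yk h s s') W U)) \<le> sqrt (\<Sum>W\<in>{W\<in>S. ?P h W}. (norm (Fh t s W))\<^sup>2)"
      using S s fin h U by (intro sum_norm_Z_le) (auto simp: Y0 Y1 intro!: Z_Yk_single)
  qed
  also have "\<dots> \<le> sqrt (avg H (\<lambda>h. \<Sum>W\<in>{W\<in>S. ?P h W}. (norm (Fh t s W))\<^sup>2))"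
    by (intro avg_sqrt_le sum_nonneg) auto
  also have "avg H (\<lambda>h. \<Sum>W\<in>{W\<in>S. ?P h W}. (norm (Fh t s W))\<^sup>2)
      = avg H (\<lambda>h. \<Sum>W\<in>S. (norm (Fh t s W))\<^sup>2 * (if ?P h W then 1 else 0))"
    using finS by (intro avg_cong) (simp add: sum.inter_filter if_distrib cong: if_cong)
  also have "\<dots> = (\<Sum>W\<in>S. (norm (Fh t s W))\<^sup>2 * avg H (\<lambda>h. if ?P h W then 1 else 0))"
    unfolding avg_sum avg_cmult ..
  also have "sqrt \<dots> \<le> sqrt (\<Sum>W\<in>S. (norm (Fh t s W))\<^sup>2 * \<pi> (card (dif W U)))"
    by (intro real_sqrt_le_mono sum_mono mult_left_mono \<pi>_bound) auto
  finally show ?thesis .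
qed

text \<open>Restricting to level \<open>l\<close> costs the inverse of \<open>r ^ l\<close> against
  the weight \<open>r ^ card (supp U)\<close>. The states \<open>s'\<close> are summed by
  \<open>sum_powr_inverse_le\<close>, and the average over \<open>h\<close> meets only
  \<open>r ^ card (singles h (supp W))\<close>.\<close>

lemma low_frequency_bound:
  fixes r \<rho> pp :: real
  assumes s: "s \<in> \<Sigma>" and W: "W \<in> X"
    and r: "0 < r" "r \<le> 1" and \<rho>: "0 < \<rho>" and pp: "pp = 1 + 4 * q ^ k * \<rho>" "pp \<le> 2"
  shows "avg H (\<lambda>h. \<Sum>s'\<in>\<Sigma>. \<Sum>U\<in>Lv l. norm (Z (Yk h s s') W U))
    \<le> inverse (r ^ l) * (sqrt ((1 + q ^ k * (r ^ 4 / \<rho>)) ^ n) * card \<Sigma> powr (1 - 1 / pp)) *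
       ((q ^ k) ^ card (supp W) * ((2 * r) ^ card (supp W) + \<pi> (card (supp W))))"
proof -
  let ?w = "card (supp W)"
  let ?E = "(1 + q ^ k * (r ^ 4 / \<rho>)) ^ n"
  let ?C = "sqrt ?E * card \<Sigma> powr (1 - 1 / pp)"
  let ?q = "real q ^ k"
  have p1: "1 \<le> pp" using pp \<rho> by simp
  have E0: "0 \<le> ?E" using \<rho> r by simp
  have "avg H (\<lambda>h. \<Sum>s'\<in>\<Sigma>. \<Sum>U\<in>Lv l. norm (Z (Yk h s s') W U))
    \<le> avg H (\<lambda>h. inverse (r ^ l) * (?C * (?q ^ ?w * r ^ card (singles h (supp W)))))"
  proof (rule avg_mono)
    fix h assume h: "h \<in> H"
    have one: "(\<Sum>U\<in>Lv l. norm (Z (Yk h s s') W U))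
       \<le> inverse (r ^ l) * (r ^ card (singles h (supp W)) * (?q ^ ?w * sqrt ?E * avg X (Yk h s s') powr (1 / pp)))"
      if s': "s' \<in> \<Sigma>" for s'
    proof -
      interpret sl: slotted n q h k W "Yk h s s'"
      proof unfold_locales
        fix y assume "y \<in> X"
        then show "Yk h s s' y \<le> 1"
          using member_le_sum[of s' \<Sigma> "\<lambda>s'. Yk h s s' y"] Y1[of s y h] Y0 s s' fin by auto
      qed (use W Y0 Y_slot Y_bad s s' h in auto)
      have "(\<Sum>U\<in>Lv l. norm (Z (Yk h s s') W U)) = inverse (r ^ l) * (\<Sum>U\<in>Lv l. r ^ card (supp U) * norm (Z (Yk h s s') W U))"
        unfolding sum_distrib_left using r by (intro sum.cong) (auto simp: Lv_def)
      also have "\<dots> \<le> inverse (r ^ l) * (\<Sum>U\<in>X. r ^ card (supp U) * norm (Z (Yk h s s') W U))"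
        using finX r by (intro mult_left_mono sum_mono2) (auto simp: Lv_def)
      also have "\<dots> \<le> inverse (r ^ l) * (r ^ card (singles h (supp W)) *
          (sqrt ((q ^ k) ^ ?w * ?E) * sqrt ((q ^ k) ^ ?w * avg X (Yk h s s') powr (2 / pp))))"
        using r by (intro mult_left_mono sl.sum_power_norm_Z_le[OF r \<rho> pp]) auto
      also have "sqrt ((q ^ k) ^ ?w * ?E) * sqrt ((q ^ k) ^ ?w * avg X (Yk h s s') powr (2 / pp))
          = ?q ^ ?w * sqrt ?E * avg X (Yk h s s') powr (1 / pp)"
      proof -
        have "avg X (Yk h s s') powr (2 / pp) = (avg X (Yk h s s') powr (1 / pp))\<^sup>2"
          by (simp add: power2_eq_square powr_add[symmetric])
        then have "sqrt (avg X (Yk h s s') powr (2 / pp)) = avg X (Yk h s s') powr (1 / pp)" by simp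
        moreover have "sqrt (?q ^ ?w) * sqrt (?q ^ ?w) = ?q ^ ?w" by simp
        ultimately show ?thesis by (simp add: real_sqrt_mult mult_ac)
      qed
      finally show ?thesis .
    qed
    have "(\<Sum>s'\<in>\<Sigma>. \<Sum>U\<in>Lv l. norm (Z (Yk h s s') W U))
       \<le> (\<Sum>s'\<in>\<Sigma>. inverse (r ^ l) * (r ^ card (singles h (supp W)) * (?q ^ ?w * sqrt ?E * avg X (Yk h s s') powr (1 / pp))))"
      by (rule sum_mono[OF one])
    also have "\<dots> = inverse (r ^ l) * (r ^ card (singles h (supp W)) * (?q ^ ?w * sqrt ?E * (\<Sum>s'\<in>\<Sigma>. avg X (Yk h s s') powr (1 / pp))))"
      unfolding sum_distrib_left ..
    also have "\<dots> \<le> inverse (r ^ l) * (r ^ card (singles h (supp W)) * (?q ^ ?w * sqrt ?E * card \<Sigma> powr (1 - 1 / pp)))"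
    proof (intro mult_left_mono sum_powr_inverse_le)
      have "(\<Sum>s'\<in>\<Sigma>. avg X (Yk h s s')) = avg X (\<lambda>x. \<Sum>s'\<in>\<Sigma>. Yk h s s' x)" unfolding avg_sum ..
      also have "\<dots> = avg X (\<lambda>x. 1)" using s by (intro avg_cong Y1)
      finally show "(\<Sum>s'\<in>\<Sigma>. avg X (Yk h s s')) = 1" using finX by (simp add: avg_const)
    qed (use fin p1 pp r E0 s Y0 in \<open>auto intro!: avg_nonneg\<close>)
    finally show "(\<Sum>s'\<in>\<Sigma>. \<Sum>U\<in>Lv l. norm (Z (Yk h s s') W U)) \<le> inverse (r ^ l) * (?C * (?q ^ ?w * r ^ card (singles h (supp W))))"
      by (simp only: mult_ac)
  qed
  also have "\<dots> = inverse (r ^ l) * ?C * (?q ^ ?w * avg H (\<lambda>h. r ^ card (singles h (supp W))))"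
    unfolding avg_cmult by (simp only: mult_ac)
  also have "\<dots> \<le> inverse (r ^ l) * ?C * (?q ^ ?w * ((2 * r) ^ ?w + \<pi> ?w))"
  proof (intro mult_left_mono)
    have "supp W \<subseteq> {..<n}" by (auto simp: supp_def)
    moreover have "?w \<le> m" using nm card_supp_le(1)[of W] by linarith
    ultimately show "avg H (\<lambda>h. r ^ card (singles h (supp W))) \<le> (2 * r) ^ ?w + \<pi> ?w"
      unfolding \<pi>_def using nm(2) r by (rule avg_power_singles_le)
  qed (use r E0 in auto)
  finally show ?thesis by simp
qed

lemma Fh_Suc: "Fh (Suc t) s' U = (\<Sum>s\<in>\<Sigma>. avg H (\<lambda>h. \<Sum>W\<in>X. Fh t s W * Z (Yk h s s') W U))"
proof -
  have "Fh (Suc t) s' U = (\<Sum>s\<in>\<Sigma>. Z (\<lambda>x. F t s x * avg H (\<lambda>h. Yk h s s' x)) zer U)"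
    unfolding Fh_def F.simps Z_sum ..
  also have "\<dots> = (\<Sum>s\<in>\<Sigma>. \<Sum>W\<in>X. Fh t s W * avg H (\<lambda>h. Z (Yk h s s') W U))"
    unfolding Z_mult Z_avg Fh_def ..
  finally show ?thesis unfolding avg_sum avg_cmult .
qed

text \<open>Frequencies \<open>W\<close> of level at most \<open>L\<close> are estimated in the 1-norm. A frequency of level above
  \<open>L\<close> reaches level \<open>l\<close> only if \<open>dif W U\<close>, of more than \<open>L - l\<close> elements, meets no slot in a single
  element; this is rare enough for a 2-norm estimate.\<close>

lemma Alev_Suc:
  fixes r \<rho> pp L B :: real
  assumes r: "0 < r" "r \<le> 1" and \<rho>: "0 < \<rho>" and pp: "pp = 1 + 4 * q ^ k * \<rho>" "pp \<le> 2"
    and B0: "0 \<le> B" and B: "\<And>d. L - l < real d \<Longrightarrow> d \<le> n \<Longrightarrow> \<pi> d \<le> B"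
  shows "Alev (Suc t) l \<le> inverse (r ^ l) * (sqrt ((1 + q ^ k * (r ^ 4 / \<rho>)) ^ n) * card \<Sigma> powr (1 - 1 / pp)) *
       (\<Sum>w\<in>{w\<in>{..n}. real w \<le> L}. Alev t w * ((q ^ k) ^ w * ((2 * r) ^ w + \<pi> w)))
     + card (Lv l) * (sqrt B * sqrt (card \<Sigma>))"
proof -
  define lo where "lo = {W\<in>X. real (card (supp W)) \<le> L}"
  define hi where "hi = {W\<in>X. \<not> real (card (supp W)) \<le> L}"
  define C where "C = inverse (r ^ l) * (sqrt ((1 + q ^ k * (r ^ 4 / \<rho>)) ^ n) * card \<Sigma> powr (1 - 1 / pp))"
  define c where "c w = (real q ^ k) ^ w * ((2 * r) ^ w + \<pi> w)" for w
  have C0: "0 \<le> C" using r \<rho> by (simp add: C_def)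
  have f: "finite lo" "finite hi" "lo \<inter> hi = {}" "lo \<union> hi = X" "finite (Lv l)" "Lv l \<subseteq> X"
    using finX by (auto simp: lo_def hi_def Lv_def)
  have split: "(\<Sum>W\<in>X. g W) = (\<Sum>W\<in>lo. g W) + (\<Sum>W\<in>hi. g W)" for g :: "_ \<Rightarrow> complex"
    using sum.union_disjoint[OF f(1,2,3)] f(4) by metis
  let ?t = "\<lambda>h s s' U W. Fh t s W * Z (Yk h s s') W U"
  have "Alev (Suc t) l \<le> (\<Sum>s'\<in>\<Sigma>. \<Sum>U\<in>Lv l. \<Sum>s\<in>\<Sigma>. avg H (\<lambda>h. norm (\<Sum>W\<in>lo. ?t h s s' U W) + norm (\<Sum>W\<in>hi. ?t h s s' U W)))"
    unfolding Alev_def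
  proof (intro sum_mono)
    fix s' U
    have "norm (Fh (Suc t) s' U) \<le> (\<Sum>s\<in>\<Sigma>. norm (avg H (\<lambda>h. \<Sum>W\<in>X. ?t h s s' U W)))"
      unfolding Fh_Suc by (rule norm_sum)
    also have "\<dots> \<le> (\<Sum>s\<in>\<Sigma>. avg H (\<lambda>h. norm (\<Sum>W\<in>X. ?t h s s' U W)))"
      by (intro sum_mono norm_avg_le)
    also have "\<dots> \<le> (\<Sum>s\<in>\<Sigma>. avg H (\<lambda>h. norm (\<Sum>W\<in>lo. ?t h s s' U W) + norm (\<Sum>W\<in>hi. ?t h s s' U W)))"
      unfolding split by (intro sum_mono avg_mono norm_triangle_ineq)
    finally show "norm (Fh (Suc t) s' U) \<le> (\<Sum>s\<in>\<Sigma>. avg H (\<lambda>h. norm (\<Sum>W\<in>lo. ?t h s s' U W) + norm (\<Sum>W\<in>hi. ?t h s s' U W)))" .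
  qed
  also have "\<dots> = (\<Sum>s\<in>\<Sigma>. \<Sum>U\<in>Lv l. avg H (\<lambda>h. \<Sum>s'\<in>\<Sigma>. norm (\<Sum>W\<in>lo. ?t h s s' U W)))
      + (\<Sum>s\<in>\<Sigma>. \<Sum>U\<in>Lv l. avg H (\<lambda>h. \<Sum>s'\<in>\<Sigma>. norm (\<Sum>W\<in>hi. ?t h s s' U W)))"
  proof -
    have sw: "(\<Sum>s'\<in>\<Sigma>. \<Sum>U\<in>Lv l. \<Sum>s\<in>\<Sigma>. g s' U s) = (\<Sum>s\<in>\<Sigma>. \<Sum>U\<in>Lv l. \<Sum>s'\<in>\<Sigma>. g s' U s)"
      for g :: "'s \<Rightarrow> (nat \<Rightarrow> nat) \<Rightarrow> 's \<Rightarrow> real"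
    proof -
      have "(\<Sum>s'\<in>\<Sigma>. \<Sum>U\<in>Lv l. \<Sum>s\<in>\<Sigma>. g s' U s) = (\<Sum>U\<in>Lv l. \<Sum>s'\<in>\<Sigma>. \<Sum>s\<in>\<Sigma>. g s' U s)" by (rule sum.swap)
      also have "\<dots> = (\<Sum>U\<in>Lv l. \<Sum>s\<in>\<Sigma>. \<Sum>s'\<in>\<Sigma>. g s' U s)" by (intro sum.cong refl sum.swap)
      also have "\<dots> = (\<Sum>s\<in>\<Sigma>. \<Sum>U\<in>Lv l. \<Sum>s'\<in>\<Sigma>. g s' U s)" by (rule sum.swap)
      finally show ?thesis .
    qed
    show ?thesis by (rule trans[OF sw]) (simp only: avg_add sum.distrib avg_sum)
  qed
  also have "\<dots> \<le> C * (\<Sum>w\<in>{w\<in>{..n}. real w \<le> L}. Alev t w * c w) + card (Lv l) * (sqrt B * sqrt (card \<Sigma>))"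
  proof (rule add_mono)
    have "(\<Sum>s\<in>\<Sigma>. \<Sum>U\<in>Lv l. avg H (\<lambda>h. \<Sum>s'\<in>\<Sigma>. norm (\<Sum>W\<in>lo. ?t h s s' U W)))
      \<le> (\<Sum>s\<in>\<Sigma>. \<Sum>U\<in>Lv l. avg H (\<lambda>h. \<Sum>s'\<in>\<Sigma>. \<Sum>W\<in>lo. norm (Fh t s W) * norm (Z (Yk h s s') W U)))"
      unfolding norm_mult[symmetric] by (intro sum_mono avg_mono norm_sum)
    also have "\<dots> = (\<Sum>s\<in>\<Sigma>. \<Sum>W\<in>lo. norm (Fh t s W) * avg H (\<lambda>h. \<Sum>s'\<in>\<Sigma>. \<Sum>U\<in>Lv l. norm (Z (Yk h s s') W U)))"
    proof (rule sum.cong[OF refl])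
      fix s
      let ?g = "\<lambda>h s' U W. norm (Fh t s W) * norm (Z (Yk h s s') W U)"
      have "(\<Sum>U\<in>Lv l. avg H (\<lambda>h. \<Sum>s'\<in>\<Sigma>. \<Sum>W\<in>lo. ?g h s' U W))
         = avg H (\<lambda>h. \<Sum>U\<in>Lv l. \<Sum>s'\<in>\<Sigma>. \<Sum>W\<in>lo. ?g h s' U W)" by (rule avg_sum[symmetric])
      also have "\<dots> = avg H (\<lambda>h. \<Sum>W\<in>lo. \<Sum>s'\<in>\<Sigma>. \<Sum>U\<in>Lv l. ?g h s' U W)"
      proof (rule avg_cong)
        fix h
        have "(\<Sum>U\<in>Lv l. \<Sum>s'\<in>\<Sigma>. \<Sum>W\<in>lo. ?g h s' U W) = (\<Sum>s'\<in>\<Sigma>. \<Sum>U\<in>Lv l. \<Sum>W\<in>lo. ?g h s' U W)" by (rule sum.swap)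
        also have "\<dots> = (\<Sum>s'\<in>\<Sigma>. \<Sum>W\<in>lo. \<Sum>U\<in>Lv l. ?g h s' U W)" by (intro sum.cong refl sum.swap)
        also have "\<dots> = (\<Sum>W\<in>lo. \<Sum>s'\<in>\<Sigma>. \<Sum>U\<in>Lv l. ?g h s' U W)" by (rule sum.swap)
        finally show "(\<Sum>U\<in>Lv l. \<Sum>s'\<in>\<Sigma>. \<Sum>W\<in>lo. ?g h s' U W) = (\<Sum>W\<in>lo. \<Sum>s'\<in>\<Sigma>. \<Sum>U\<in>Lv l. ?g h s' U W)" .
      qed
      also have "\<dots> = (\<Sum>W\<in>lo. norm (Fh t s W) * avg H (\<lambda>h. \<Sum>s'\<in>\<Sigma>. \<Sum>U\<in>Lv l. norm (Z (Yk h s s') W U)))"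
        unfolding sum_distrib_left[symmetric] avg_sum avg_cmult ..
      finally show "(\<Sum>U\<in>Lv l. avg H (\<lambda>h. \<Sum>s'\<in>\<Sigma>. \<Sum>W\<in>lo. ?g h s' U W))
         = (\<Sum>W\<in>lo. norm (Fh t s W) * avg H (\<lambda>h. \<Sum>s'\<in>\<Sigma>. \<Sum>U\<in>Lv l. norm (Z (Yk h s s') W U)))" .
    qed
    also have "\<dots> \<le> (\<Sum>s\<in>\<Sigma>. \<Sum>W\<in>lo. norm (Fh t s W) * (C * c (card (supp W))))"
    proof (intro sum_mono mult_left_mono)
      fix s W assume "s \<in> \<Sigma>" "W \<in> lo"
      then show "avg H (\<lambda>h. \<Sum>s'\<in>\<Sigma>. \<Sum>U\<in>Lv l. norm (Z (Yk h s s') W U)) \<le> C * c (card (supp W))"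
        using low_frequency_bound[of s W r \<rho> pp l] r \<rho> pp by (simp add: lo_def C_def c_def)
    qed simp
    also have "\<dots> = C * (\<Sum>s\<in>\<Sigma>. \<Sum>W\<in>lo. norm (Fh t s W) * c (card (supp W)))"
      unfolding sum_distrib_left by (simp only: mult_ac)
    also have "(\<Sum>s\<in>\<Sigma>. \<Sum>W\<in>lo. norm (Fh t s W) * c (card (supp W))) = (\<Sum>w\<in>{w\<in>{..n}. real w \<le> L}. Alev t w * c w)"
    proof -
      let ?R = "{w\<in>{..n}. real w \<le> L}"
      have "(\<Sum>W\<in>lo. norm (Fh t s W) * c (card (supp W))) = (\<Sum>w\<in>?R. \<Sum>W\<in>Lv w. norm (Fh t s W) * c w)" for s
      proof -
        have "(\<Sum>W\<in>lo. norm (Fh t s W) * c (card (supp W)))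
           = (\<Sum>w\<in>?R. \<Sum>W\<in>{W\<in>lo. card (supp W) = w}. norm (Fh t s W) * c (card (supp W)))"
          using f card_supp_le(1) by (intro sum.group[symmetric]) (auto simp: lo_def)
        also have "\<dots> = (\<Sum>w\<in>?R. \<Sum>W\<in>Lv w. norm (Fh t s W) * c w)"
          by (intro sum.cong) (auto simp: lo_def Lv_def)
        finally show ?thesis .
      qed
      then have "(\<Sum>s\<in>\<Sigma>. \<Sum>W\<in>lo. norm (Fh t s W) * c (card (supp W))) = (\<Sum>s\<in>\<Sigma>. \<Sum>w\<in>?R. \<Sum>W\<in>Lv w. norm (Fh t s W) * c w)"
        by simp
      also have "\<dots> = (\<Sum>w\<in>?R. \<Sum>s\<in>\<Sigma>. \<Sum>W\<in>Lv w. norm (Fh t s W) * c w)" by (rule sum.swap)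
      finally show ?thesis unfolding Alev_def sum_distrib_right .
    qed
    finally show "(\<Sum>s\<in>\<Sigma>. \<Sum>U\<in>Lv l. avg H (\<lambda>h. \<Sum>s'\<in>\<Sigma>. norm (\<Sum>W\<in>lo. ?t h s s' U W)))
      \<le> C * (\<Sum>w\<in>{w\<in>{..n}. real w \<le> L}. Alev t w * c w)" .
  next
    have "(\<Sum>s\<in>\<Sigma>. \<Sum>U\<in>Lv l. avg H (\<lambda>h. \<Sum>s'\<in>\<Sigma>. norm (\<Sum>W\<in>hi. ?t h s s' U W)))
       \<le> (\<Sum>s\<in>\<Sigma>. \<Sum>U\<in>Lv l. sqrt B * sqrt (\<mu> t s))"
    proof (intro sum_mono)
      fix s U assume s: "s \<in> \<Sigma>" and U: "U \<in> Lv l"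
      have "avg H (\<lambda>h. \<Sum>s'\<in>\<Sigma>. norm (\<Sum>W\<in>hi. ?t h s s' U W))
         \<le> sqrt (\<Sum>W\<in>hi. (norm (Fh t s W))\<^sup>2 * \<pi> (card (dif W U)))"
        using s U f by (intro high_frequency_bound) auto
      also have "\<dots> \<le> sqrt (B * \<mu> t s)"
      proof (rule real_sqrt_le_mono)
        have "(\<Sum>W\<in>hi. (norm (Fh t s W))\<^sup>2 * \<pi> (card (dif W U))) \<le> (\<Sum>W\<in>hi. (norm (Fh t s W))\<^sup>2 * B)"
        proof (intro sum_mono mult_left_mono B)
          fix W assume "W \<in> hi"
          then have "L < card (supp W)" by (simp add: hi_def)
          moreover have "real (card (supp W)) \<le> card (dif W U) + l"
            using supp_dif[of W U] U by (auto simp: Lv_def)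
          ultimately show "L - l < real (card (dif W U))" by linarith
        qed (simp_all add: card_supp_le)
        also have "\<dots> = B * (\<Sum>W\<in>hi. (norm (Fh t s W))\<^sup>2)" by (simp add: sum_distrib_left mult.commute)
        also have "\<dots> \<le> B * (\<Sum>W\<in>X. (norm (Fh t s W))\<^sup>2)"
          using f finX B0 by (intro mult_left_mono sum_mono2) auto
        also have "\<dots> \<le> B * \<mu> t s" using B0 s by (intro mult_left_mono sum_Fh_square)
        finally show "(\<Sum>W\<in>hi. (norm (Fh t s W))\<^sup>2 * \<pi> (card (dif W U))) \<le> B * \<mu> t s" .
      qed
      finally show "avg H (\<lambda>h. \<Sum>s'\<in>\<Sigma>. norm (\<Sum>W\<in>hi. ?t h s s' U W)) \<le> sqrt B * sqrt (\<mu> t s)"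
        by (simp add: real_sqrt_mult)
    qed
    also have "\<dots> = card (Lv l) * (sqrt B * (\<Sum>s\<in>\<Sigma>. sqrt (\<mu> t s)))"
      by (simp add: sum_distrib_left)
    also have "\<dots> \<le> card (Lv l) * (sqrt B * sqrt (card \<Sigma>))"
      using B0 by (intro mult_left_mono sum_sqrt_\<mu>) auto
    finally show "(\<Sum>s\<in>\<Sigma>. \<Sum>U\<in>Lv l. avg H (\<lambda>h. \<Sum>s'\<in>\<Sigma>. norm (\<Sum>W\<in>hi. ?t h s s' U W)))
       \<le> card (Lv l) * (sqrt B * sqrt (card \<Sigma>))" .
  qed
  finally show ?thesis unfolding C_def c_def by simp
qed

end


section \<open>Elementary estimates and the solution of the level recursion\<close>

lemma mult_ln_antimono:
  fixes a b :: real
  assumes "0 < a" "a \<le> b" "b \<le> exp (-1)"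
  shows "b * ln b \<le> a * ln a"
proof -
  \<comment> \<open>In terms of the ratio \<open>c\<close> the claim becomes
    \<open>(c - 1) * ln b + ln c \<le> 0\<close>, where \<open>ln b\<close> is at most -1 and
    \<open>ln c\<close> at most \<open>c - 1\<close>.\<close>
  define c where "c = b / a"
  have c: "1 \<le> c" "b = a * c" using assms by (auto simp: c_def)
  have "ln b \<le> -1" using assms ln_le_cancel_iff[of b "exp (-1)"] by simp
  moreover have lnb: "ln b = ln a + ln c" using c assms by (simp add: ln_mult)
  ultimately have "(c - 1) * ln b \<le> - (c - 1)" using c mult_left_mono[of "ln b" "-1" "c - 1"] by simp
  moreover have "ln c \<le> c - 1" using c by (intro ln_le_minus_one) auto
  ultimately have "(c - 1) * ln b + ln c \<le> 0" by linarith
  then have "c * ln b \<le> ln a" using lnb by (simp add: algebra_simps)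
  then have "a * (c * ln b) \<le> a * ln a" using assms by (intro mult_left_mono) auto
  then show ?thesis using c by (simp add: mult.assoc)
qed

lemma sum_power_le:
  fixes z :: real
  assumes "0 \<le> z" "z \<le> 1/2" "R \<subseteq> {1..n}"
  shows "(\<Sum>w\<in>R. z ^ w) \<le> 2 * z"
proof -
  have "(\<Sum>w\<in>R. z ^ w) \<le> (\<Sum>w\<in>{1..n}. z ^ w)" using assms by (intro sum_mono2) auto
  also have "\<dots> = z * (\<Sum>w<n. z ^ w)"
  proof -
    have "(\<Sum>w\<in>{1..n}. z ^ w) = (\<Sum>w\<in>{0..<n}. z ^ Suc w)"
      by (rule sum.reindex_bij_witness[where i=Suc and j="\<lambda>w. w - 1"]) auto
    then show ?thesis by (simp add: sum_distrib_left lessThan_atLeast0)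
  qed
  also have "\<dots> \<le> z * 2"
  proof (rule mult_left_mono)
    have "(\<Sum>w<n. z ^ w) = (1 - z ^ n) / (1 - z)" using assms by (simp add: sum_gp_strict)
    also have "\<dots> \<le> 1 / (1 - z)" using assms by (intro divide_right_mono) auto
    also have "\<dots> \<le> 1 / (1/2)" using assms by (intro divide_left_mono) auto
    finally show "(\<Sum>w<n. z ^ w) \<le> 2" by simp
  qed (use assms in simp)
  finally show ?thesis by simp
qed

text \<open>A single term of the exponential series, with \<open>fact w \<le> w ^ w\<close>.\<close>

lemma power_div_le_exp:
  fixes B :: real assumes "0 \<le> B" shows "(B / w) ^ w \<le> exp B"
proof (cases "w = 0")
  case False
  have "fact w \<le> real w ^ w" using fact_le_power[of w, where 'a=real] by simp
  then have "B ^ w / real w ^ w \<le> B ^ w / fact w"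
    using assms False by (intro divide_left_mono) auto
  also have "\<dots> \<le> exp B"
  proof -
    have "(\<lambda>n. B ^ n / fact n) sums exp B" using exp_converges[of B] by (simp add: field_simps)
    then show ?thesis using assms sum_le_suminf[of "\<lambda>n. B ^ n / fact n" "{w}"]
      by (auto simp: sums_iff)
  qed
  finally show ?thesis by (simp add: power_divide)
qed (use assms in simp)

lemma sqrt_exp: "sqrt (exp x) = exp (x / 2)" for x :: real
  by (rule real_sqrt_unique) (simp_all add: power2_eq_square exp_add[symmetric])

text \<open>Enlarging \<open>B\<close> by the factor 4 splits off 1/2 per power, a convergent
  geometric series; what remains of each term is at most \<open>exp (2 * B)\<close>.\<close>

lemma sum_sqrt_power_le:
  fixes B :: real
  assumes "0 \<le> B" "R \<subseteq> {1..n}"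
  shows "(\<Sum>w\<in>R. sqrt (B / w) ^ w) \<le> exp (2 * B)"
proof -
  have "sqrt (B / w) ^ w \<le> (1/2) ^ w * exp (2 * B)" if "w \<in> R" for w
  proof -
    have "sqrt (B / w) = 1/2 * sqrt (4 * B / w)" by (simp add: real_sqrt_mult real_sqrt_divide)
    then have "sqrt (B / w) ^ w = (1/2) ^ w * sqrt ((4 * B / w) ^ w)"
      by (simp only: power_mult_distrib real_sqrt_power)
    also have "sqrt ((4 * B / w) ^ w) \<le> sqrt (exp (4 * B))"
      using assms by (intro real_sqrt_le_mono power_div_le_exp) auto
    also have "sqrt (exp (4 * B)) = exp (2 * B)" by (simp add: sqrt_exp)
    finally show ?thesis by simp
  qed
  then have "(\<Sum>w\<in>R. sqrt (B / w) ^ w) \<le> (\<Sum>w\<in>R. (1/2) ^ w) * exp (2 * B)"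
    unfolding sum_distrib_right by (rule sum_mono)
  also have "\<dots> \<le> 1 * exp (2 * B)"
    using sum_power_le[of "1/2" R n] assms by (intro mult_right_mono) auto
  finally show ?thesis by simp
qed

context hidden
begin

text \<open>The l1 distance between the memory laws of the two cases after \<open>t\<close> rounds,
  with \<open>x\<close> averaged out in the YES case.\<close>

definition "Dv t = (\<Sum>s\<in>\<Sigma>. \<bar>\<mu> t s - p t s\<bar>)"

lemma Dv_0: "Dv 0 = 0" unfolding Dv_def \<mu>_def using finX by (simp add: avg_const)

text \<open>Every coefficient is at most \<open>\<mu> t s\<close>, so mass in the 1-norm controls
  mass in the 2-norm; this is how \<open>Alev\<close> comes to bound the error of a round.\<close>

lemma sum_Lv_square: "s \<in> \<Sigma> \<Longrightarrow> (\<Sum>U\<in>Lv w. (norm (Fh t s U))\<^sup>2) \<le> \<mu> t s * (\<Sum>U\<in>Lv w. norm (Fh t s U))"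
  unfolding sum_distrib_left power2_eq_square by (intro sum_mono mult_right_mono norm_Fh_le) auto

lemma avg_avg_Yk: "s \<in> \<Sigma> \<Longrightarrow> (\<Sum>s'\<in>\<Sigma>. avg H (\<lambda>h. avg X (Yk h s s'))) = 1"
proof -
  assume s: "s \<in> \<Sigma>"
  have "(\<Sum>s'\<in>\<Sigma>. avg H (\<lambda>h. avg X (Yk h s s'))) = avg H (\<lambda>h. avg X (\<lambda>x. \<Sum>s'\<in>\<Sigma>. Yk h s s' x))"
    unfolding avg_sum ..
  also have "\<dots> = avg H (\<lambda>h. avg X (\<lambda>x. 1))" using s by (intro avg_cong Y1)
  finally show ?thesis using finX finH by (simp add: avg_const)
qed

text \<open>For the target \<open>zer\<close> the difference set is \<open>supp W\<close>, so the
  weights of \<open>high_frequency_bound\<close> depend on the level alone. Levels up to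
  \<open>L\<close> are then treated by \<open>sum_Lv_square\<close>, the others by Parseval.\<close>

lemma round_error:
  assumes s: "s \<in> \<Sigma>" and B0: "0 \<le> B" and B: "\<And>d. L < real d \<Longrightarrow> d \<le> n \<Longrightarrow> \<pi> d \<le> B"
  shows "avg H (\<lambda>h. \<Sum>s'\<in>\<Sigma>. norm (\<Sum>W\<in>X - {zer}. Fh t s W * Z (Yk h s s') W zer))
    \<le> (\<Sum>w\<in>{w\<in>{1..n}. real w \<le> L}. sqrt (\<pi> w) * (sqrt (\<mu> t s) * sqrt (\<Sum>U\<in>Lv w. norm (Fh t s U))))
      + sqrt B * sqrt (\<mu> t s)"
proof -
  let ?R = "{w\<in>{1..n}. real w \<le> L}"
  let ?a = "\<lambda>W. (norm (Fh t s W))\<^sup>2 * \<pi> (card (supp W))"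
  let ?lo = "{W\<in>X - {zer}. real (card (supp W)) \<le> L}" and ?hi = "{W\<in>X - {zer}. \<not> real (card (supp W)) \<le> L}"
  have sqrt_sum: "sqrt (\<Sum>w\<in>R. g w) \<le> (\<Sum>w\<in>R. sqrt (g w))" if "finite R" "\<And>w. 0 \<le> g w" for R :: "nat set" and g :: "nat \<Rightarrow> real"
    using that(1)
  proof (induction R rule: finite_induct)
    case (insert a R)
    have "sqrt (g a + (\<Sum>w\<in>R. g w)) \<le> sqrt (g a) + sqrt (\<Sum>w\<in>R. g w)"
      using that(2) by (intro sqrt_add_le_add_sqrt sum_nonneg)
    then show ?case using insert by simp
  qed simp
  have "avg H (\<lambda>h. \<Sum>s'\<in>\<Sigma>. norm (\<Sum>W\<in>X - {zer}. Fh t s W * Z (Yk h s s') W zer)) \<le> sqrt (\<Sum>W\<in>X - {zer}. ?a W)"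
    using high_frequency_bound[OF s zer_X, of "X - {zer}" t] by (simp add: dif_zer)
  also have "(\<Sum>W\<in>X - {zer}. ?a W) = (\<Sum>W\<in>?lo. ?a W) + (\<Sum>W\<in>?hi. ?a W)"
  proof -
    have "X - {zer} = ?lo \<union> ?hi" by blast
    then have "(\<Sum>W\<in>X - {zer}. ?a W) = (\<Sum>W\<in>?lo \<union> ?hi. ?a W)" by (rule arg_cong)
    also have "\<dots> = (\<Sum>W\<in>?lo. ?a W) + (\<Sum>W\<in>?hi. ?a W)"
      by (rule sum.union_disjoint) (use finX in auto)
    finally show ?thesis .
  qed
  also have "sqrt \<dots> \<le> sqrt (\<Sum>W\<in>?lo. ?a W) + sqrt (\<Sum>W\<in>?hi. ?a W)"
    by (intro sqrt_add_le_add_sqrt sum_nonneg mult_nonneg_nonneg \<pi>_nonneg) auto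
  also have "\<dots> \<le> (\<Sum>w\<in>?R. sqrt (\<pi> w) * (sqrt (\<mu> t s) * sqrt (\<Sum>U\<in>Lv w. norm (Fh t s U)))) + sqrt (B * \<mu> t s)"
  proof (rule add_mono)
    have lo: "W \<in> ?lo \<Longrightarrow> card (supp W) \<in> ?R" for W
    proof -
      assume "W \<in> ?lo"
      then have "W \<in> X" "W \<noteq> zer" "real (card (supp W)) \<le> L" by auto
      then show ?thesis using card_supp_le(1)[of W] supp_zer_iff[of W] by simp
    qed
    have "(\<Sum>W\<in>?lo. ?a W) = (\<Sum>w\<in>?R. \<Sum>W\<in>{W\<in>?lo. card (supp W) = w}. ?a W)"
      using finX lo by (intro sum.group[symmetric]) auto
    also have "\<dots> = (\<Sum>w\<in>?R. \<Sum>W\<in>Lv w. (norm (Fh t s W))\<^sup>2 * \<pi> w)"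
    proof (intro sum.cong refl)
      fix w assume "w \<in> ?R"
      then show "{W\<in>?lo. card (supp W) = w} = Lv w"
      proof (intro set_eqI iffI)
        fix U assume "w \<in> ?R" "U \<in> Lv w"
        then have "U \<in> X" "card (supp U) = w" "0 < w" "real w \<le> L" by (auto simp: Lv_def)
        moreover have "U \<noteq> zer" using calculation supp_zer_iff[of U] by simp
        ultimately show "U \<in> {W\<in>?lo. card (supp W) = w}" by simp
      qed (simp add: Lv_def)
    qed (simp add: Lv_def)
    also have "\<dots> = (\<Sum>w\<in>?R. \<pi> w * (\<Sum>W\<in>Lv w. (norm (Fh t s W))\<^sup>2))"
      by (simp add: sum_distrib_left mult.commute)
    also have "\<dots> \<le> (\<Sum>w\<in>?R. \<pi> w * (\<mu> t s * (\<Sum>U\<in>Lv w. norm (Fh t s U))))"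
      using s by (intro sum_mono mult_left_mono sum_Lv_square \<pi>_nonneg)
    finally have "sqrt (\<Sum>W\<in>?lo. ?a W) \<le> sqrt (\<Sum>w\<in>?R. \<pi> w * (\<mu> t s * (\<Sum>U\<in>Lv w. norm (Fh t s U))))"
      by (rule real_sqrt_le_mono)
    also have "\<dots> \<le> (\<Sum>w\<in>?R. sqrt (\<pi> w * (\<mu> t s * (\<Sum>U\<in>Lv w. norm (Fh t s U)))))"
      using s by (intro sqrt_sum mult_nonneg_nonneg \<pi>_nonneg \<mu>_nonneg sum_nonneg) auto
    finally show "sqrt (\<Sum>W\<in>?lo. ?a W) \<le> (\<Sum>w\<in>?R. sqrt (\<pi> w) * (sqrt (\<mu> t s) * sqrt (\<Sum>U\<in>Lv w. norm (Fh t s U))))"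
      by (simp only: real_sqrt_mult)
  next
    have "(\<Sum>W\<in>?hi. ?a W) \<le> (\<Sum>W\<in>?hi. (norm (Fh t s W))\<^sup>2 * B)"
      by (intro sum_mono mult_left_mono B) (auto simp: card_supp_le)
    also have "\<dots> = B * (\<Sum>W\<in>?hi. (norm (Fh t s W))\<^sup>2)" by (simp add: sum_distrib_left mult.commute)
    also have "\<dots> \<le> B * (\<Sum>W\<in>X. (norm (Fh t s W))\<^sup>2)"
      using finX B0 by (intro mult_left_mono sum_mono2) auto
    also have "\<dots> \<le> B * \<mu> t s" using B0 s by (intro mult_left_mono sum_Fh_square)
    finally show "sqrt (\<Sum>W\<in>?hi. ?a W) \<le> sqrt (B * \<mu> t s)" by (rule real_sqrt_le_mono)
  qed
  finally show ?thesis by (simp add: real_sqrt_mult)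
qed

text \<open>When the mean of \<open>F t s x * Yk h s s' x\<close> is expanded, the term of
  \<open>zer\<close> is the product of the means, that is, a NO step; the other terms are the new
  error. The old error does not grow because the averaged transition is stochastic.\<close>

lemma Dv_Suc:
  assumes B0: "0 \<le> B" and B: "\<And>d. L < real d \<Longrightarrow> d \<le> n \<Longrightarrow> \<pi> d \<le> B"
  shows "Dv (Suc t) \<le> Dv t + (\<Sum>w\<in>{w\<in>{1..n}. real w \<le> L}. sqrt (\<pi> w * Alev t w)) + sqrt B * sqrt (card \<Sigma>)"
proof -
  let ?R = "{w\<in>{1..n}. real w \<le> L}"
  let ?N = "\<lambda>h s s'. norm (\<Sum>W\<in>X - {zer}. Fh t s W * Z (Yk h s s') W zer)"
  have one: "\<bar>avg X (\<lambda>x. F t s x * Yk h s s' x) - \<mu> t s * avg X (Yk h s s')\<bar> = ?N h s s'" for h s s'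
  proof -
    have "complex_of_real (avg X (\<lambda>x. F t s x * Yk h s s' x)) = (\<Sum>W\<in>X. Fh t s W * Z (Yk h s s') W zer)"
      unfolding Z_zer_zer[symmetric] Z_mult Fh_def ..
    also have "\<dots> = Fh t s zer * Z (Yk h s s') zer zer + (\<Sum>W\<in>X - {zer}. Fh t s W * Z (Yk h s s') W zer)"
      using finX zer_X by (intro sum.remove) auto
    also have "Fh t s zer * Z (Yk h s s') zer zer = of_real (\<mu> t s * avg X (Yk h s s'))"
      unfolding Fh_def \<mu>_def Z_zer_zer by simp
    finally have "(\<Sum>W\<in>X - {zer}. Fh t s W * Z (Yk h s s') W zer)
       = of_real (avg X (\<lambda>x. F t s x * Yk h s s' x) - \<mu> t s * avg X (Yk h s s'))" by simp
    then show ?thesis by (simp only: norm_of_real)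
  qed
  have "Dv (Suc t) \<le> (\<Sum>s'\<in>\<Sigma>. (\<Sum>s\<in>\<Sigma>. avg H (\<lambda>h. ?N h s s') + \<bar>\<mu> t s - p t s\<bar> * avg H (\<lambda>h. avg X (Yk h s s'))))"
    unfolding Dv_def
  proof (rule sum_mono)
    fix s' assume s': "s' \<in> \<Sigma>"
    have "\<mu> (Suc t) s' = (\<Sum>s\<in>\<Sigma>. avg H (\<lambda>h. avg X (\<lambda>x. F t s x * Yk h s s' x)))"
      unfolding \<mu>_def F.simps avg_sum avg_cmult[symmetric] by (intro sum.cong refl avg_swap)
    then have "\<mu> (Suc t) s' - p (Suc t) s' = (\<Sum>s\<in>\<Sigma>. avg H (\<lambda>h. avg X (\<lambda>x. F t s x * Yk h s s' x)) - p t s * avg H (\<lambda>h. avg X (Yk h s s')))"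
      by (simp add: sum_subtractf)
    also have "\<dots> = (\<Sum>s\<in>\<Sigma>. avg H (\<lambda>h. avg X (\<lambda>x. F t s x * Yk h s s' x) - \<mu> t s * avg X (Yk h s s'))
        + (\<mu> t s - p t s) * avg H (\<lambda>h. avg X (Yk h s s')))"
      unfolding avg_diff avg_cmult by (simp add: algebra_simps)
    finally have eq: "\<mu> (Suc t) s' - p (Suc t) s' = \<dots>" .
    have "\<bar>\<mu> (Suc t) s' - p (Suc t) s'\<bar> \<le> (\<Sum>s\<in>\<Sigma>. \<bar>avg H (\<lambda>h. avg X (\<lambda>x. F t s x * Yk h s s' x) - \<mu> t s * avg X (Yk h s s'))
        + (\<mu> t s - p t s) * avg H (\<lambda>h. avg X (Yk h s s'))\<bar>)"
      unfolding eq by (rule sum_abs)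
    also have "\<dots> \<le> (\<Sum>s\<in>\<Sigma>. avg H (\<lambda>h. ?N h s s') + \<bar>\<mu> t s - p t s\<bar> * avg H (\<lambda>h. avg X (Yk h s s')))"
    proof (rule sum_mono)
      fix s assume s: "s \<in> \<Sigma>"
      let ?y = "avg H (\<lambda>h. avg X (Yk h s s'))"
      have y: "0 \<le> ?y" using s s' by (intro avg_nonneg Y0)
      have "norm (avg H (\<lambda>h. avg X (\<lambda>x. F t s x * Yk h s s' x) - \<mu> t s * avg X (Yk h s s')))
          \<le> avg H (\<lambda>h. norm (avg X (\<lambda>x. F t s x * Yk h s s' x) - \<mu> t s * avg X (Yk h s s')))" by (rule norm_avg_le)
      then have "\<bar>avg H (\<lambda>h. avg X (\<lambda>x. F t s x * Yk h s s' x) - \<mu> t s * avg X (Yk h s s'))\<bar> \<le> avg H (\<lambda>h. ?N h s s')"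
        unfolding real_norm_def one .
      moreover have "\<bar>(\<mu> t s - p t s) * ?y\<bar> = \<bar>\<mu> t s - p t s\<bar> * ?y" using y by (simp add: abs_mult)
      ultimately show "\<bar>avg H (\<lambda>h. avg X (\<lambda>x. F t s x * Yk h s s' x) - \<mu> t s * avg X (Yk h s s')) + (\<mu> t s - p t s) * ?y\<bar>
         \<le> avg H (\<lambda>h. ?N h s s') + \<bar>\<mu> t s - p t s\<bar> * ?y" by linarith
    qed
    finally show "\<bar>\<mu> (Suc t) s' - p (Suc t) s'\<bar> \<le> (\<Sum>s\<in>\<Sigma>. avg H (\<lambda>h. ?N h s s') + \<bar>\<mu> t s - p t s\<bar> * avg H (\<lambda>h. avg X (Yk h s s')))" .
  qed
  also have "\<dots> = (\<Sum>s\<in>\<Sigma>. avg H (\<lambda>h. \<Sum>s'\<in>\<Sigma>. ?N h s s')) + (\<Sum>s\<in>\<Sigma>. \<bar>\<mu> t s - p t s\<bar> * (\<Sum>s'\<in>\<Sigma>. avg H (\<lambda>h. avg X (Yk h s s'))))"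
    unfolding sum.distrib avg_sum sum_distrib_left by (intro arg_cong2[where f="(+)"] sum.swap)
  also have "(\<Sum>s\<in>\<Sigma>. \<bar>\<mu> t s - p t s\<bar> * (\<Sum>s'\<in>\<Sigma>. avg H (\<lambda>h. avg X (Yk h s s')))) = Dv t"
    unfolding Dv_def by (intro sum.cong) (simp_all add: avg_avg_Yk)
  also have "(\<Sum>s\<in>\<Sigma>. avg H (\<lambda>h. \<Sum>s'\<in>\<Sigma>. ?N h s s'))
     \<le> (\<Sum>s\<in>\<Sigma>. (\<Sum>w\<in>?R. sqrt (\<pi> w) * (sqrt (\<mu> t s) * sqrt (\<Sum>U\<in>Lv w. norm (Fh t s U)))) + sqrt B * sqrt (\<mu> t s))"
    using B0 B by (intro sum_mono round_error) auto
  also have "\<dots> = (\<Sum>w\<in>?R. sqrt (\<pi> w) * (\<Sum>s\<in>\<Sigma>. sqrt (\<mu> t s) * sqrt (\<Sum>U\<in>Lv w. norm (Fh t s U))))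
      + sqrt B * (\<Sum>s\<in>\<Sigma>. sqrt (\<mu> t s))"
    unfolding sum.distrib sum_distrib_left by (intro arg_cong2[where f="(+)"] sum.swap refl)
  also have "\<dots> \<le> (\<Sum>w\<in>?R. sqrt (\<pi> w) * sqrt (Alev t w)) + sqrt B * sqrt (card \<Sigma>)"
  proof (intro add_mono sum_mono mult_left_mono sum_sqrt_\<mu>)
    fix w
    have "(\<Sum>s\<in>\<Sigma>. sqrt (\<mu> t s) * sqrt (\<Sum>U\<in>Lv w. norm (Fh t s U))) \<le> sqrt (\<Sum>s\<in>\<Sigma>. \<mu> t s) * sqrt (Alev t w)"
      unfolding Alev_def by (intro sum_sqrt_mult_le) (auto simp: \<mu>_nonneg intro: sum_nonneg)
    then show "(\<Sum>s\<in>\<Sigma>. sqrt (\<mu> t s) * sqrt (\<Sum>U\<in>Lv w. norm (Fh t s U))) \<le> sqrt (Alev t w)"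
      by (simp add: sum_\<mu>)
  qed (use B0 \<pi>_nonneg in auto)
  finally show ?thesis by (simp add: real_sqrt_mult)
qed

end


text \<open>The invariant is \<open>Alev t w \<le> (Dc Q t * \<eta> * n / w)\<close> to the power \<open>w/2\<close>, for levels
  \<open>w \<le> \<theta> * n / 16 ^ t\<close>. Lowering the range by 16 in each round makes the contribution of the high
  levels at most 1.\<close>

primrec Dc :: "real \<Rightarrow> nat \<Rightarrow> real" where
  "Dc Q 0 = 1"
| "Dc Q (Suc t) = exp (2 * (2 * Q\<^sup>2 + 4 + 8 * Q\<^sup>2 * Dc Q t))"

lemma Dc_ge_1: "1 \<le> Dc Q t"
proof (induction t)
  case (Suc t)
  then have "0 \<le> 2 * (2 * Q\<^sup>2 + 4 + 8 * Q\<^sup>2 * Dc Q t)" by simp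
  then show ?case by (simp add: one_le_exp_iff)
qed simp

text \<open>With \<open>\<theta>\<close> the square of \<open>\<eta>\<close>, the parameter
  \<open>\<eta>\<close> cancels from the growth of a round, so \<open>Dc\<close> is free of it and
  \<open>\<eta>\<close> can be chosen after all the constants \<open>Dc Q t\<close>. The assumption
  \<open>\<eta>D\<close> makes the terms with \<open>\<pi>\<close> geometric of ratio 1/2;
  \<open>\<theta>q\<close> lets rarity outweigh the number of frequencies and of states.\<close>

locale hidden12 = hidden +
  fixes \<eta> \<theta> S :: real and T :: nat
  assumes m12: "m = 12 * n" and n1: "1 \<le> n"
    and \<eta>: "0 < \<eta>" "\<eta> \<le> 1" "\<theta> = \<eta>\<^sup>2"
    and S: "0 \<le> S" "real (card \<Sigma>) \<le> exp S" "S \<le> \<theta> * n / 16 ^ T"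
    and \<eta>D: "\<And>t. t \<le> T \<Longrightarrow> real (q ^ k) ^ 2 * Dc (real (q ^ k)) t * \<eta> \<le> 3 / 4"
    and \<theta>q: "\<theta> * (16 * q * exp 4) \<le> 1"
begin

abbreviation "Q \<equiv> real (q ^ k)"
abbreviation "D \<equiv> Dc Q"
definition "Lt t = \<theta> * n / 16 ^ t"

lemma Q1: "1 \<le> Q" using q2 by simp

lemma \<theta>0: "0 < \<theta>" and \<theta>1: "\<theta> \<le> 1"
  using \<eta> by (auto simp: power_le_one)

lemma n0: "0 < real n" using n1 by simp

lemma Lt_pos: "0 < Lt t" using \<theta>0 n0 by (simp add: Lt_def)

lemma Lt_Suc: "Lt (Suc t) = Lt t / 16" by (simp add: Lt_def)

lemma Lt_le: "Lt t \<le> \<theta> * n"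
proof -
  have "1 \<le> (16::real) ^ t" by simp
  then have "\<theta> * n / 16 ^ t \<le> \<theta> * n / 1" using \<theta>0 n0 by (intro divide_left_mono) auto
  then show ?thesis by (simp add: Lt_def)
qed

lemma S_le: "t \<le> T \<Longrightarrow> S \<le> Lt t"
proof -
  assume t: "t \<le> T"
  have "\<theta> * n / 16 ^ T \<le> \<theta> * n / 16 ^ t"
    using t \<theta>0 n0 by (intro divide_left_mono power_increasing) auto
  then show ?thesis using S(3) unfolding Lt_def by linarith
qed

lemma \<pi>_eq: "\<pi> d = sqrt (d / (3 * n)) ^ d"
proof -
  have "2 * sqrt (real d / real m) = sqrt (4 * (real d / real m))"
    by (simp only: real_sqrt_mult real_sqrt_four)
  also have "4 * (real d / real m) = d / (3 * n)" using n0 unfolding m12 by (simp add: field_simps)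
  finally show ?thesis by (simp add: \<pi>_def)
qed

text \<open>The logarithm of \<open>\<pi> d\<close> is a multiple of \<open>t * ln t\<close> at
  \<open>t = d / (3 * n)\<close>, which decreases up to \<open>exp (-1)\<close>; so \<open>d\<close>
  may be replaced by the smaller real \<open>d0\<close>.\<close>

lemma \<pi>_le:
  assumes "0 < d0" "d0 \<le> real d" "d \<le> n"
  shows "\<pi> d \<le> exp (d0 / 2 * ln (d0 / (3 * n)))"
proof -
  let ?b = "d / (3 * n)" and ?a = "d0 / (3 * n)"
  have d: "0 < real d" using assms by linarith
  have b0: "0 < ?b" using d n0 by simp
  have "\<pi> d = exp (d * ln (sqrt ?b))"
    unfolding \<pi>_eq using b0 by (simp add: exp_of_nat_mult)
  also have "d * ln (sqrt ?b) = (3 * n / 2) * (?b * ln ?b)"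
    using b0 n0 by (simp add: ln_sqrt)
  also have "\<dots> \<le> (3 * n / 2) * (?a * ln ?a)"
  proof (intro mult_left_mono mult_ln_antimono)
    \<comment> \<open>This fixes the number of slots: with \<open>m = 12 * n\<close> the range ends
      at 1/3, below \<open>exp (-1)\<close>.\<close>
    have "?b \<le> 1 / 3" using assms n0 by (simp add: field_simps)
    also have "1 / 3 \<le> exp (-1::real)" using exp_le by (simp add: exp_minus field_simps)
    finally show "?b \<le> exp (-1)" .
    show "?a \<le> ?b" using assms n0 by (intro divide_right_mono) auto
  qed (use assms n0 in auto)
  also have "\<dots> = d0 / 2 * ln (d0 / (3 * n))" using n0 by simp
  finally show ?thesis by simp
qed

lemma sum_power_supp:
  fixes r :: real
  shows "(\<Sum>U\<in>X. r ^ card (supp U)) = (1 + real (q - 1) * r) ^ n"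
proof -
  have "(\<Sum>U\<in>X. r ^ card (supp U)) = (\<Sum>U\<in>X. \<Prod>v<n. if U v \<noteq> 0 then r else 1)"
  proof (rule sum.cong[OF refl])
    fix U
    have "(\<Prod>v<n. if U v \<noteq> 0 then r else 1) = (\<Prod>v\<in>supp U. r)"
      unfolding supp_def by (rule prod.inter_filter[symmetric]) simp
    then show "r ^ card (supp U) = (\<Prod>v<n. if U v \<noteq> 0 then r else 1)" by simp
  qed
  also have "\<dots> = (\<Prod>v<n. \<Sum>c<q. if c \<noteq> 0 then r else 1)"
    by (rule prod_sum_PiE[symmetric]) auto
  also have "(\<Sum>c<q. if c \<noteq> 0 then r else 1) = 1 + real (q - 1) * r"
  proof -
    have "(\<Sum>c<q. if c \<noteq> 0 then r else 1) = 1 + (\<Sum>c\<in>{..<q} - {0}. if c \<noteq> 0 then r else 1)"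
      using q2 by (subst sum.remove[of _ 0]) auto
    also have "(\<Sum>c\<in>{..<q} - {0}. if c \<noteq> 0 then r else 1) = (\<Sum>c\<in>{..<q} - {0}. r)" by (rule sum.cong) auto
    also have "\<dots> = real (q - 1) * r" using q2 by simp
    finally show ?thesis .
  qed
  finally show ?thesis by simp
qed

text \<open>In the generating function \<open>sum_power_supp\<close> every element of the level
  weighs \<open>r ^ l\<close>; the free parameter \<open>r\<close> is optimised by the
  caller.\<close>

lemma card_Lv_le:
  fixes r :: real
  assumes "0 < r"
  shows "card (Lv l) \<le> inverse (r ^ l) * exp (q * n * r)"
proof -
  have "card (Lv l) * r ^ l = (\<Sum>U\<in>Lv l. r ^ card (supp U))" by (simp add: Lv_def)
  also have "\<dots> \<le> (\<Sum>U\<in>X. r ^ card (supp U))"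
    using finX assms by (intro sum_mono2) (auto simp: Lv_def)
  also have "\<dots> = (1 + real (q - 1) * r) ^ n" by (rule sum_power_supp)
  also have "\<dots> \<le> exp (q * r) ^ n"
  proof (rule power_mono)
    have "1 + real (q - 1) * r \<le> 1 + q * r" using assms by (intro add_left_mono mult_right_mono) auto
    also have "\<dots> \<le> exp (q * r)" by (rule exp_ge_add_one_self)
    finally show "1 + real (q - 1) * r \<le> exp (q * r)" .
  qed (use assms in simp)
  also have "\<dots> = exp (q * n * r)" by (simp add: exp_of_nat_mult[symmetric] mult_ac)
  finally show ?thesis using assms by (simp add: field_simps)
qed

text \<open>A frequency above \<open>Lt t\<close> differs from one of level \<open>l\<close>, at
  most a sixteenth of it, in more than \<open>d0\<close> places. With \<open>L = Lt t\<close>, the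
  number of frequencies contributes about \<open>L / 16 * ln (n / L)\<close> to the exponent, the
  root of the rarity takes away \<open>15 * L / 64 * ln (n / L)\<close>, and the states add
  \<open>L / 2\<close>. For small \<open>\<theta>\<close> the middle term wins.\<close>

lemma Hi_le:
  assumes t: "t \<le> T" and l: "real l \<le> Lt (Suc t)"
  defines "d0 \<equiv> 15 / 16 * Lt t"
  shows "card (Lv l) * (sqrt (exp (d0 / 2 * ln (d0 / (3 * n)))) * sqrt (card \<Sigma>)) \<le> 1"
proof -
  define L where "L = Lt t"
  have L: "0 < L" "real l \<le> L / 16" "L \<le> \<theta> * n" using Lt_pos l Lt_le by (auto simp: L_def Lt_Suc)
  have q1: "1 < real q" using q2 by simp
  \<comment> \<open>Chosen so that \<open>exp (q * n * r)\<close> becomes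
    \<open>exp (L / 16)\<close>.\<close>
  define r where "r = L / (16 * q * n)"
  have r: "0 < r" using L q1 n0 by (simp add: r_def)
  have "\<theta> * real n \<le> 1 * real n" using \<theta>1 n0 by (intro mult_right_mono) auto
  then have Ln: "L \<le> n" using L by linarith
  have lnr: "0 \<le> - ln r"
  proof -
    have "1 * real n \<le> 16 * real q * n" using q1 n0 by (intro mult_right_mono) auto
    then have "L \<le> 16 * real q * n" using Ln by linarith
    then have "r \<le> 1" using q1 n0 by (simp add: r_def)
    then show ?thesis using r by simp
  qed
  have "inverse (r ^ l) = exp (l * (- ln r))"
    using r by (simp add: exp_minus exp_of_nat_mult)
  also have "\<dots> \<le> exp (L / 16 * (- ln r))"
    unfolding exp_le_cancel_iff using lnr L by (intro mult_right_mono) auto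
  finally have "inverse (r ^ l) * exp (q * n * r) \<le> exp (L / 16 * (- ln r)) * exp (L / 16)"
    using n0 q1 by (simp add: r_def)
  then have 1: "card (Lv l) \<le> exp (L / 16 * (- ln r) + L / 16)"
    using card_Lv_le[OF r, of l] unfolding exp_add by linarith
  have "d0 / (3 * n) \<le> L / n" using L n0 by (simp add: d0_def L_def[symmetric] field_simps)
  then have "ln (d0 / (3 * n)) \<le> ln (L / n)"
    using L n0 by (subst ln_le_cancel_iff) (auto simp: d0_def L_def[symmetric])
  then have "d0 / 4 * ln (d0 / (3 * n)) \<le> d0 / 4 * ln (L / n)"
    using L by (intro mult_left_mono) (auto simp: d0_def L_def[symmetric])
  then have 2: "sqrt (exp (d0 / 2 * ln (d0 / (3 * n)))) \<le> exp (15 * L / 64 * ln (L / n))"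
    unfolding sqrt_exp by (simp add: d0_def L_def[symmetric])
  have "sqrt (card \<Sigma>) \<le> sqrt (exp S)" using S by (intro real_sqrt_le_mono) auto
  also have "\<dots> \<le> exp (L / 2)" unfolding sqrt_exp using S_le[OF t] by (simp add: L_def)
  finally have 3: "sqrt (card \<Sigma>) \<le> exp (L / 2)" .
  have "card (Lv l) * (sqrt (exp (d0 / 2 * ln (d0 / (3 * n)))) * sqrt (card \<Sigma>))
      \<le> exp (L / 16 * (- ln r) + L / 16) * (exp (15 * L / 64 * ln (L / n)) * exp (L / 2))"
    using 1 2 3 by (intro mult_mono) auto
  also have "\<dots> = exp (L * ((- ln r + 1) / 16 + 15 / 64 * ln (L / n) + 1 / 2))"
    unfolding exp_add[symmetric] by (rule arg_cong[where f=exp]) (simp add: field_simps)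
  also have "\<dots> \<le> 1"
  proof -
    have lr: "- ln r = ln (16 * q) - ln (L / n)"
      unfolding r_def using L n0 q1 by (simp add: ln_div ln_mult)
    have "ln (L / n) \<le> ln \<theta>" using L n0 \<theta>0 by (subst ln_le_cancel_iff) (auto simp: field_simps)
    moreover have "ln (\<theta> * (16 * q * exp 4)) \<le> 0"
      using \<theta>q \<theta>0 q1 by (subst ln_le_zero_iff) auto
    then have "ln \<theta> + ln (16 * q) + 4 \<le> 0" using \<theta>0 q1 by (simp add: ln_mult)
    ultimately have a: "ln (L / n) \<le> - ln (16 * q) - 4" by linarith
    have "0 \<le> ln (16 * real q)" using q1 by (intro ln_ge_zero) simp
    then have "(- ln r + 1) / 16 + 15 / 64 * ln (L / n) + 1 / 2 \<le> 0"
      unfolding lr using a by (simp add: field_simps)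
    then have "L * ((- ln r + 1) / 16 + 15 / 64 * ln (L / n) + 1 / 2) \<le> 0"
      using L by (simp add: mult_le_0_iff)
    then show ?thesis by simp
  qed
  finally show ?thesis .
qed

text \<open>Exponents per unit of \<open>l\<close>: counting outer slots gives 2 Q^2, the states
  give 1, the sum over the previous levels gives 8 Q^2 \<open>D t\<close> + 2, and one more unit
  absorbs the high levels. Twice the total is the exponent in \<open>Dc\<close>, as the invariant
  stands under a root. At the start there is no mass above level 0.\<close>

lemma Alev_bound:
  "t \<le> T \<Longrightarrow> 1 \<le> w \<Longrightarrow> real w \<le> Lt t \<Longrightarrow> Alev t w \<le> sqrt (D t * \<eta> * n / w) ^ w"
proof (induction t arbitrary: w)
  case 0
  then show ?case using \<eta> by (simp add: Alev_start)
next
  case (Suc t l)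
  have D1: "1 \<le> D t" by (rule Dc_ge_1)
  have t: "t \<le> T" and l1: "1 \<le> real l" using Suc.prems by auto
  have lL: "real l \<le> Lt t / 16" using Suc.prems Lt_Suc by simp
  have l\<theta>: "real l \<le> \<theta> * n" using lL Lt_le[of t] Lt_pos[of t] by linarith
  \<comment> \<open>With this choice the inverse of \<open>r ^ l\<close> already has the shape of
    the invariant.\<close>
  define r where "r = sqrt (l / (\<eta> * n))"
  \<comment> \<open>Gives \<open>pp - 1 = l / (\<theta> * n)\<close>, so that at most
    \<open>exp S\<close> states cost only \<open>exp l\<close>. Moreover
    \<open>r ^ 4 / \<rho>\<close> becomes \<open>4 * Q * l / n\<close>, free of
    \<open>\<eta>\<close>.\<close>
  define \<rho> where "\<rho> = l / (4 * Q * \<theta> * n)"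
  define pp where "pp = 1 + 4 * Q * \<rho>"
  define d0 where "d0 = 15 / 16 * Lt t"
  have r0: "0 < r" using l1 \<eta> n0 by (simp add: r_def)
  have r2: "r\<^sup>2 = l / (\<eta> * n)" using \<eta> n0 by (simp add: r_def)
  have "l / (\<eta> * n) \<le> \<theta> / \<eta>" using l\<theta> \<eta> n0 by (simp add: field_simps)
  also have "\<dots> = \<eta>" using \<eta> by (simp add: power2_eq_square)
  finally have r1: "r \<le> 1" using \<eta> by (simp add: r_def)
  have \<rho>0: "0 < \<rho>" using l1 q2 \<theta>0 n0 by (simp add: \<rho>_def)
  have pp_eq: "pp = 1 + l / (\<theta> * n)" using q2 \<theta>0 n0 by (simp add: pp_def \<rho>_def)
  have pp2: "pp \<le> 2" unfolding pp_eq using l\<theta> \<theta>0 n0 by simp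
  have pp1: "1 \<le> pp" unfolding pp_eq using \<theta>0 n0 by simp
  have E: "sqrt ((1 + Q * (r ^ 4 / \<rho>)) ^ n) \<le> exp (2 * Q\<^sup>2 * real l)"
  proof -
    have "r ^ 4 = (r\<^sup>2)\<^sup>2" by simp
    then have "Q * (r ^ 4 / \<rho>) = 4 * Q\<^sup>2 * l / n"
      unfolding r2 \<rho>_def \<eta>(3) using \<eta> n0 l1 Q1 by (simp add: field_simps power2_eq_square)
    then have "(1 + Q * (r ^ 4 / \<rho>)) ^ n \<le> exp (4 * Q\<^sup>2 * l / n) ^ n"
      using exp_ge_add_one_self[of "4 * Q\<^sup>2 * l / n"] Q1 by (intro power_mono) auto
    also have "\<dots> = exp (4 * Q\<^sup>2 * real l)" using n0 by (simp add: exp_of_nat_mult[symmetric])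
    finally have "sqrt ((1 + Q * (r ^ 4 / \<rho>)) ^ n) \<le> sqrt (exp (4 * Q\<^sup>2 * real l))" by (rule real_sqrt_le_mono)
    moreover have "4 * Q\<^sup>2 * l / 2 = 2 * Q\<^sup>2 * l" by simp
    ultimately show ?thesis unfolding sqrt_exp by (simp only:)
  qed
  have c1: "1 \<le> real (card \<Sigma>)" using fin by (simp add: Suc_leI card_gt_0_iff)
  have G: "card \<Sigma> powr (1 - 1 / pp) \<le> exp l"
  proof -
    have "1 - 1 / pp \<le> l / (\<theta> * n)"
    proof -
      have "1 - 1 / pp = (pp - 1) / pp" using pp1 by (simp add: field_simps)
      also have "\<dots> \<le> (pp - 1) / 1" using pp1 by (intro divide_left_mono) auto
      finally show ?thesis by (simp add: pp_eq)
    qed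
    then have "card \<Sigma> powr (1 - 1 / pp) \<le> card \<Sigma> powr (l / (\<theta> * n))"
      using c1 by (intro powr_mono) auto
    also have "\<dots> \<le> exp S powr (l / (\<theta> * n))" using S \<theta>0 n0 by (intro powr_mono2) auto
    also have "\<dots> = exp (S * (l / (\<theta> * n)))" by (simp add: powr_def mult.commute)
    also have "\<dots> \<le> exp l"
    proof -
      have "S \<le> \<theta> * n" using S_le[of 0] by (simp add: Lt_def)
      then have "S * (l / (\<theta> * n)) \<le> (\<theta> * n) * (l / (\<theta> * n))"
        using \<theta>0 n0 by (intro mult_right_mono) auto
      then show ?thesis using \<theta>0 n0 by simp
    qed
    finally show ?thesis .
  qed
  let ?R = "{w\<in>{..n}. real w \<le> Lt t}" and ?R1 = "{w\<in>{1..n}. real w \<le> Lt t}"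
  have sumle: "(\<Sum>w\<in>?R. Alev t w * (Q ^ w * ((2 * r) ^ w + \<pi> w))) \<le> exp (8 * Q\<^sup>2 * D t * l + 2 * real l)"
  proof -
    let ?B = "4 * Q\<^sup>2 * D t * l"
    have B1: "1 \<le> ?B"
    proof -
      have "1 \<le> Q\<^sup>2" using Q1 by (simp add: one_le_power)
      then have "1 * 1 \<le> Q\<^sup>2 * D t" using D1 by (intro mult_mono) auto
      then have "1 * 1 \<le> Q\<^sup>2 * D t * l" using l1 by (intro mult_mono) auto
      then show ?thesis by simp
    qed
    \<comment> \<open>In the part with \<open>2 * r\<close> the quantities \<open>n\<close> and
      \<open>\<eta>\<close> cancel and leave \<open>?B / w\<close>; in the part with
      \<open>\<pi> w\<close> it is \<open>n\<close> and \<open>w\<close> that cancel, leaving a base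
      of at most 1/2.\<close>
    have each: "Alev t w * (Q ^ w * ((2 * r) ^ w + \<pi> w)) \<le> sqrt (?B / w) ^ w + (1/2) ^ w" if w: "w \<in> ?R1" for w
    proof -
      have w1: "1 \<le> real w" "real w \<le> Lt t" using w by auto
      have pos: "0 \<le> sqrt (D t * \<eta> * n / w) ^ w" using D1 \<eta> by simp
      have "Alev t w * (Q ^ w * ((2 * r) ^ w + \<pi> w)) \<le> sqrt (D t * \<eta> * n / w) ^ w * (Q ^ w * ((2 * r) ^ w + \<pi> w))"
        using Suc.IH[of w] t w r0 \<pi>_nonneg[of w] by (intro mult_right_mono) auto
      also have "\<dots> = (sqrt (D t * \<eta> * n / w) * (Q * (2 * r))) ^ w + (sqrt (D t * \<eta> * n / w) * (Q * sqrt (w / (3 * n)))) ^ w"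
        unfolding \<pi>_eq by (simp add: power_mult_distrib algebra_simps)
      also have "sqrt (D t * \<eta> * n / w) * (Q * (2 * r)) = sqrt (?B / w)"
      proof (rule real_sqrt_unique[symmetric])
        have "(sqrt (D t * \<eta> * n / w) * (Q * (2 * r)))\<^sup>2 = (D t * \<eta> * n / w) * (4 * Q\<^sup>2 * r\<^sup>2)"
          using D1 \<eta> by (simp add: power_mult_distrib)
        also have "\<dots> = ?B / w" unfolding r2 using \<eta> n0 w1 by (simp add: field_simps)
        finally show "(sqrt (D t * \<eta> * n / w) * (Q * (2 * r)))\<^sup>2 = ?B / w" .
      qed (use r0 D1 \<eta> in simp)
      also have "sqrt (D t * \<eta> * n / w) * (Q * sqrt (w / (3 * n))) \<le> 1/2"
      proof (rule power2_le_imp_le)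
        have "(sqrt (D t * \<eta> * n / w) * (Q * sqrt (w / (3 * n))))\<^sup>2 = (D t * \<eta> * n / w) * (Q\<^sup>2 * (w / (3 * n)))"
          using D1 \<eta> by (simp add: power_mult_distrib)
        also have "\<dots> = Q\<^sup>2 * D t * \<eta> / 3" using n0 w1 by (simp add: field_simps)
        also have "\<dots> \<le> (1/2)\<^sup>2" using \<eta>D[OF t] by (simp add: power2_eq_square)
        finally show "(sqrt (D t * \<eta> * n / w) * (Q * sqrt (w / (3 * n))))\<^sup>2 \<le> (1/2)\<^sup>2" .
      qed simp
      then have "(sqrt (D t * \<eta> * n / w) * (Q * sqrt (w / (3 * n)))) ^ w \<le> (1/2) ^ w"
        using D1 \<eta> by (intro power_mono) auto
      finally show ?thesis by simp
    qed
    have R: "?R = insert 0 ?R1" using Lt_pos[of t] by force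
    have "finite ?R1" by (rule finite_Collect_conjI) simp
    then have "(\<Sum>w\<in>insert 0 ?R1. Alev t w * (Q ^ w * ((2 * r) ^ w + \<pi> w)))
        = Alev t 0 * (Q ^ 0 * ((2 * r) ^ 0 + \<pi> 0)) + (\<Sum>w\<in>?R1. Alev t w * (Q ^ w * ((2 * r) ^ w + \<pi> w)))"
      by (rule sum.insert) simp
    then have "(\<Sum>w\<in>?R. Alev t w * (Q ^ w * ((2 * r) ^ w + \<pi> w)))
        = 2 + (\<Sum>w\<in>?R1. Alev t w * (Q ^ w * ((2 * r) ^ w + \<pi> w)))"
      unfolding R Alev_0 \<pi>_def[of 0] by simp
    also have "\<dots> \<le> 2 + (\<Sum>w\<in>?R1. sqrt (?B / w) ^ w + (1/2) ^ w)"
      using each by (intro add_left_mono sum_mono) auto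
    also have "\<dots> \<le> 2 + (exp (2 * ?B) + 1)"
      unfolding sum.distrib
    proof (intro add_left_mono add_mono)
      have R1: "?R1 \<subseteq> {1..n}" by blast
      show "(\<Sum>w\<in>?R1. sqrt (?B / w) ^ w) \<le> exp (2 * ?B)"
        using B1 by (intro sum_sqrt_power_le[OF _ R1]) linarith
      show "(\<Sum>w\<in>?R1. (1/2) ^ w) \<le> (1::real)"
        using sum_power_le[of "1/2" ?R1 n, OF _ _ R1] by linarith
    qed
    also have "\<dots> \<le> 4 * exp (2 * ?B)" using B1 one_le_exp_iff[of "2 * ?B"] by simp
    also have "\<dots> \<le> exp (2 * real l) * exp (2 * ?B)"
    proof (rule mult_right_mono)
      have "(4::real) \<le> (1 + 1)\<^sup>2" by simp
      also have "\<dots> \<le> (exp 1)\<^sup>2" using exp_ge_add_one_self[of "1::real"] by (intro power_mono) auto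
      also have "\<dots> = exp 2" by (simp add: power2_eq_square exp_add[symmetric])
      also have "\<dots> \<le> exp (2 * real l)" using l1 by simp
      finally show "4 \<le> exp (2 * real l)" by simp
    qed simp
    also have "\<dots> = exp (8 * Q\<^sup>2 * D t * l + 2 * real l)" by (simp add: exp_add[symmetric])
    finally show ?thesis .
  qed
  have "Alev (Suc t) l \<le> inverse (r ^ l) * (sqrt ((1 + q ^ k * (r ^ 4 / \<rho>)) ^ n) * card \<Sigma> powr (1 - 1 / pp)) *
       (\<Sum>w\<in>?R. Alev t w * ((q ^ k) ^ w * ((2 * r) ^ w + \<pi> w)))
     + card (Lv l) * (sqrt (exp (d0 / 2 * ln (d0 / (3 * n)))) * sqrt (card \<Sigma>))"
  proof (rule Alev_Suc[OF r0 r1 \<rho>0])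
    show "pp = 1 + real (4 * q ^ k) * \<rho>" "pp \<le> 2" using pp2 by (auto simp: pp_def)
    fix d assume d: "Lt t - l < real d" "d \<le> n"
    show "\<pi> d \<le> exp (d0 / 2 * ln (d0 / (3 * n)))"
      using d lL Lt_pos[of t] by (intro \<pi>_le) (auto simp: d0_def)
  qed simp
  also have "\<dots> \<le> inverse (r ^ l) * (exp (2 * Q\<^sup>2 * real l) * exp l) * exp (8 * Q\<^sup>2 * D t * l + 2 * real l) + 1"
  proof (rule add_mono)
    show "inverse (r ^ l) * (sqrt ((1 + q ^ k * (r ^ 4 / \<rho>)) ^ n) * card \<Sigma> powr (1 - 1 / pp)) *
       (\<Sum>w\<in>?R. Alev t w * ((q ^ k) ^ w * ((2 * r) ^ w + \<pi> w)))
      \<le> inverse (r ^ l) * (exp (2 * Q\<^sup>2 * real l) * exp l) * exp (8 * Q\<^sup>2 * D t * l + 2 * real l)"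
      using E G sumle r0 \<rho>0 Alev_nonneg \<pi>_nonneg
      by (intro mult_mono mult_left_mono mult_nonneg_nonneg sum_nonneg) auto
    show "card (Lv l) * (sqrt (exp (d0 / 2 * ln (d0 / (3 * n)))) * sqrt (card \<Sigma>)) \<le> 1"
      unfolding d0_def using Suc.prems by (intro Hi_le) auto
  qed
  also have "\<dots> = inverse (r ^ l) * exp (l * (2 * Q\<^sup>2 + 3 + 8 * Q\<^sup>2 * D t)) + 1"
    by (simp add: exp_add[symmetric] algebra_simps)
  also have "\<dots> \<le> inverse (r ^ l) * exp (l * (2 * Q\<^sup>2 + 4 + 8 * Q\<^sup>2 * D t))"
  proof -
    let ?x = "inverse (r ^ l) * exp (l * (2 * Q\<^sup>2 + 3 + 8 * Q\<^sup>2 * D t))"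
    have "1 \<le> inverse (r ^ l)" using r0 r1 by (simp add: one_le_inverse_iff power_le_one)
    moreover have "1 \<le> exp (l * (2 * Q\<^sup>2 + 3 + 8 * Q\<^sup>2 * D t))" using D1 by (simp add: one_le_exp_iff)
    ultimately have "1 * 1 \<le> ?x" using r0 by (intro mult_mono) auto
    then have "?x + 1 \<le> ?x * 2" by simp
    also have "\<dots> \<le> ?x * exp l"
    proof (rule mult_left_mono)
      show "2 \<le> exp (real l)" using exp_ge_add_one_self[of "real l"] l1 by linarith
    qed (use r0 in simp)
    also have "\<dots> = inverse (r ^ l) * exp (l * (2 * Q\<^sup>2 + 4 + 8 * Q\<^sup>2 * D t))"
      by (simp add: mult.assoc exp_add[symmetric] algebra_simps)
    finally show ?thesis .
  qed
  also have "\<dots> = (inverse r * exp (2 * Q\<^sup>2 + 4 + 8 * Q\<^sup>2 * D t)) ^ l"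
    by (simp add: power_mult_distrib power_inverse exp_of_nat_mult)
  also have "inverse r * exp (2 * Q\<^sup>2 + 4 + 8 * Q\<^sup>2 * D t) = sqrt (D (Suc t) * \<eta> * n / l)"
  proof (rule real_sqrt_unique[symmetric])
    have "(inverse r * exp (2 * Q\<^sup>2 + 4 + 8 * Q\<^sup>2 * D t))\<^sup>2 = inverse (r\<^sup>2) * D (Suc t)"
      by (simp only: power_mult_distrib power_inverse Dc.simps exp_double)
    also have "\<dots> = D (Suc t) * \<eta> * n / l" unfolding r2 by (simp add: mult_ac divide_inverse)
    finally show "(inverse r * exp (2 * Q\<^sup>2 + 4 + 8 * Q\<^sup>2 * D t))\<^sup>2 = D (Suc t) * \<eta> * n / l" .
  qed (use r0 in simp)
  finally show ?case .
qed

text \<open>In the product of \<open>\<pi> w\<close> with the bound on \<open>Alev t w\<close> both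
  \<open>n\<close> and \<open>w\<close> cancel, which leaves the base
  \<open>sqrt (D t * \<eta> / 3)\<close>. The root in \<open>Dv_Suc\<close> halves the exponent once
  more, hence the fourth power of \<open>z\<close>.\<close>

lemma Dv_step:
  assumes t: "t < T" and z: "\<And>t. t \<le> T \<Longrightarrow> D t * \<eta> / 3 \<le> z ^ 4" "0 \<le> z" "z \<le> 1/2"
  shows "Dv (Suc t) \<le> Dv t + 2 * z + exp (- (\<theta> * n / 16 ^ T / 2))"
proof -
  let ?R = "{w\<in>{1..n}. real w \<le> Lt t}"
  let ?L = "Lt t"
  let ?B = "exp (?L / 2 * ln (?L / (3 * n)))"
  have D1: "1 \<le> D t" by (rule Dc_ge_1)
  have tT: "t \<le> T" using t by simp
  have "Dv (Suc t) \<le> Dv t + (\<Sum>w\<in>?R. sqrt (\<pi> w * Alev t w)) + sqrt ?B * sqrt (card \<Sigma>)"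
    using Lt_pos[of t] by (intro Dv_Suc \<pi>_le) auto
  also have "(\<Sum>w\<in>?R. sqrt (\<pi> w * Alev t w)) \<le> (\<Sum>w\<in>?R. z ^ w)"
  proof (rule sum_mono)
    fix w assume w: "w \<in> ?R"
    then have w1: "1 \<le> real w" by auto
    have "\<pi> w * Alev t w \<le> sqrt (w / (3 * n)) ^ w * sqrt (D t * \<eta> * n / w) ^ w"
      unfolding \<pi>_eq using w tT by (intro mult_left_mono Alev_bound) auto
    also have "\<dots> = sqrt (D t * \<eta> / 3) ^ w"
      using n0 w1 by (simp add: power_mult_distrib[symmetric] real_sqrt_mult[symmetric] field_simps)
    also have "\<dots> \<le> (z\<^sup>2) ^ w"
    proof (rule power_mono)
      show "sqrt (D t * \<eta> / 3) \<le> z\<^sup>2"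
      proof (rule real_le_lsqrt)
        show "D t * \<eta> / 3 \<le> (z\<^sup>2)\<^sup>2" using z(1)[OF tT] by simp
      qed simp
    qed (use D1 \<eta> in simp)
    also have "\<dots> = (z ^ w)\<^sup>2" by (simp add: power_mult[symmetric] mult.commute)
    finally have "sqrt (\<pi> w * Alev t w) \<le> sqrt ((z ^ w)\<^sup>2)" by (rule real_sqrt_le_mono)
    then show "sqrt (\<pi> w * Alev t w) \<le> z ^ w" using z by simp
  qed
  also have "\<dots> \<le> 2 * z" using z by (intro sum_power_le[where n=n]) auto
  also have "sqrt ?B * sqrt (card \<Sigma>) \<le> exp (- (\<theta> * n / 16 ^ T / 2))"
  proof -
    have "sqrt (card \<Sigma>) \<le> sqrt (exp S)" using S by (intro real_sqrt_le_mono) auto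
    also have "\<dots> \<le> exp (?L / 2)" unfolding sqrt_exp using S_le[OF tT] by simp
    finally have "sqrt ?B * sqrt (card \<Sigma>) \<le> exp (?L / 4 * ln (?L / (3 * n))) * exp (?L / 2)"
      unfolding sqrt_exp by (intro mult_mono) auto
    also have "\<dots> = exp (?L * (ln (?L / (3 * n)) / 4 + 1 / 2))"
      by (simp add: exp_add[symmetric] algebra_simps)
    also have "\<dots> \<le> exp (- (\<theta> * n / 16 ^ T / 2))"
    proof -
      have q1: "1 < real q" using q2 by simp
      have "?L / (3 * n) \<le> \<theta>" using Lt_le[of t] Lt_pos[of t] \<theta>0 n0 by (simp add: field_simps)
      then have "ln (?L / (3 * n)) \<le> ln \<theta>"
        using Lt_pos[of t] n0 \<theta>0 by (subst ln_le_cancel_iff) auto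
      moreover have "ln (\<theta> * (16 * q * exp 4)) \<le> 0"
        using \<theta>q \<theta>0 q1 by (subst ln_le_zero_iff) auto
      then have "ln \<theta> + ln (16 * q) + 4 \<le> 0" using \<theta>0 q1 by (simp add: ln_mult)
      moreover have "0 \<le> ln (real (16 * q))" using q1 by (intro ln_ge_zero) simp
      ultimately have "ln (?L / (3 * n)) / 4 + 1 / 2 \<le> - (1/2)" by linarith
      then have "?L * (ln (?L / (3 * n)) / 4 + 1 / 2) \<le> ?L * (- (1/2))"
        using Lt_pos[of t] by (intro mult_left_mono) auto
      moreover have "\<theta> * n / 16 ^ T \<le> ?L"
        unfolding Lt_def using tT \<theta>0 n0 by (intro divide_left_mono power_increasing) auto
      ultimately show ?thesis by simp
    qed
    finally show ?thesis .
  qed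
  finally show ?thesis by simp
qed

lemma Dv_bound:
  assumes z: "\<And>t. t \<le> T \<Longrightarrow> D t * \<eta> / 3 \<le> z ^ 4" "0 \<le> z" "z \<le> 1/2"
  shows "Dv T \<le> T * (2 * z + exp (- (\<theta> * n / 16 ^ T / 2)))"
proof -
  have "t \<le> T \<Longrightarrow> Dv t \<le> t * (2 * z + exp (- (\<theta> * n / 16 ^ T / 2)))" for t
  proof (induction t)
    case (Suc t)
    then show ?case using Dv_step[of t z] z by (simp add: algebra_simps)
  qed (simp add: Dv_0)
  then show ?thesis by simp
qed

end

section \<open>Bounded differences\<close>


lemma exp_le_quadratic:
  fixes t :: real
  assumes "\<bar>t\<bar> \<le> 1"
  shows "exp t \<le> 1 + t + t\<^sup>2"
proof (cases "0 \<le> t")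
  case True
  then show ?thesis using assms exp_bound[of t] by simp
next
  case False
  define x where "x = - t"
  have x: "0 < x" "x \<le> 1" using False assms by (auto simp: x_def)
  \<comment> \<open>For \<open>t = - x\<close> the claim bounds \<open>exp (- x)\<close> by the
    first factor; the second factor is a lower bound for \<open>exp x\<close>.\<close>
  have "1 \<le> (1 - x + x\<^sup>2) * (1 + x + x\<^sup>2 / 2)"
  proof -
    have "(1 - x + x\<^sup>2) * (1 + x + x\<^sup>2 / 2) = 1 + x\<^sup>2 / 2 + x ^ 3 / 2 + x ^ 4 / 2"
      by (simp add: field_simps power2_eq_square power3_eq_cube power4_eq_xxxx)
    then show ?thesis using x by simp
  qed
  also have "\<dots> \<le> (1 - x + x\<^sup>2) * exp x"
  proof (rule mult_left_mono)
    show "1 + x + x\<^sup>2 / 2 \<le> exp x" using x by (intro exp_lower_Taylor_quadratic) simp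
    show "0 \<le> 1 - x + x\<^sup>2" using x by simp
  qed
  finally have "1 / exp x \<le> 1 - x + x\<^sup>2" by (simp add: field_simps)
  then show ?thesis by (simp add: x_def exp_minus field_simps)
qed

lemma avg_exp_le:
  fixes u :: "'a \<Rightarrow> real"
  assumes S: "finite S" "S \<noteq> {}" and c: "0 \<le> c" "c \<le> 1"
    and u: "\<And>a b. a \<in> S \<Longrightarrow> b \<in> S \<Longrightarrow> \<bar>u a - u b\<bar> \<le> c"
  shows "avg S (\<lambda>a. exp (u a)) \<le> exp (avg S u + c\<^sup>2)"
proof -
  define t where "t a = u a - avg S u" for a
  have tc: "\<bar>t a\<bar> \<le> c" if a: "a \<in> S" for a
  proof -
    have "t a = avg S (\<lambda>b. u a - u b)" unfolding t_def using S by (simp add: avg_diff avg_const)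
    then have "\<bar>t a\<bar> \<le> avg S (\<lambda>b. \<bar>u a - u b\<bar>)" using norm_avg_le[of S "\<lambda>b. u a - u b"] by simp
    also have "\<dots> \<le> c" using S u a by (intro avg_le_const) auto
    finally show ?thesis .
  qed
  have t0: "avg S t = 0" unfolding t_def using S by (simp add: avg_diff avg_const)
  have "avg S (\<lambda>a. exp (t a)) \<le> avg S (\<lambda>a. (1 + c\<^sup>2) + t a)"
  proof (rule avg_mono)
    fix a assume a: "a \<in> S"
    have "exp (t a) \<le> 1 + t a + (t a)\<^sup>2" using tc[OF a] c by (intro exp_le_quadratic) linarith
    moreover have "(t a)\<^sup>2 \<le> c\<^sup>2" using tc[OF a] c abs_le_square_iff[of "t a" c] by simp
    ultimately show "exp (t a) \<le> (1 + c\<^sup>2) + t a" by linarith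
  qed
  also have "\<dots> = 1 + c\<^sup>2" using S t0 by (simp add: avg_add avg_const)
  also have "\<dots> \<le> exp (c\<^sup>2)" by (rule exp_ge_add_one_self)
  finally have *: "avg S (\<lambda>a. exp (t a)) \<le> exp (c\<^sup>2)" .
  have "avg S (\<lambda>a. exp (u a)) = avg S (\<lambda>a. exp (avg S u) * exp (t a))"
    by (intro avg_cong) (simp add: t_def exp_add[symmetric])
  also have "\<dots> = exp (avg S u) * avg S (\<lambda>a. exp (t a))" by (rule avg_cmult)
  also have "\<dots> \<le> exp (avg S u) * exp (c\<^sup>2)" using * by (intro mult_left_mono) auto
  finally show ?thesis by (simp add: exp_add)
qed

text \<open>Conditional mean given the coordinates outside the list, written so that the result is
  again a function on the whole product.\<close>

primrec avg_coords :: "'s set \<Rightarrow> 'v list \<Rightarrow> (('v \<Rightarrow> 's) \<Rightarrow> real) \<Rightarrow> ('v \<Rightarrow> 's) \<Rightarrow> real" where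
  "avg_coords S [] f = f"
| "avg_coords S (v # vs) f = (\<lambda>x. avg S (\<lambda>s. avg_coords S vs f (x(v := s))))"

lemma avg_coords_cong:
  assumes "\<And>v. v \<notin> set vs \<Longrightarrow> x v = y v"
  shows "avg_coords S vs f x = avg_coords S vs f y"
  using assms
proof (induction vs arbitrary: x y)
  case Nil
  then have "x = y" by auto
  then show ?case by simp
next
  case (Cons v vs)
  show ?case unfolding avg_coords.simps
    by (intro avg_cong Cons.IH) (use Cons.prems in auto)
qed

lemma fun_upd_PiE: "x \<in> V \<rightarrow>\<^sub>E S \<Longrightarrow> v \<in> V \<Longrightarrow> a \<in> S \<Longrightarrow> x(v := a) \<in> V \<rightarrow>\<^sub>E S"
  by (auto simp: PiE_iff extensional_def)

text \<open>McDiarmid's argument for exponential moments. Averaging out one coordinate costs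
  \<open>exp (c\<^sup>2)\<close> by \<open>avg_exp_le\<close> and preserves bounded differences;
  once every coordinate is averaged out, only the mean is left.\<close>

theorem avg_exp_bounded_differences:
  fixes f :: "('v \<Rightarrow> 's) \<Rightarrow> real"
  assumes V: "finite V" and S: "finite S" "S \<noteq> {}" and c: "0 \<le> c" "c \<le> 1"
    and f: "\<And>x v a b. x \<in> V \<rightarrow>\<^sub>E S \<Longrightarrow> v \<in> V \<Longrightarrow> a \<in> S \<Longrightarrow> b \<in> S \<Longrightarrow> \<bar>f (x(v := a)) - f (x(v := b))\<bar> \<le> c"
  shows "avg (V \<rightarrow>\<^sub>E S) (\<lambda>x. exp (f x)) \<le> exp (avg (V \<rightarrow>\<^sub>E S) f + c\<^sup>2 * card V)"
proof -
  let ?X = "V \<rightarrow>\<^sub>E S"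
  have X: "finite ?X" "?X \<noteq> {}" using V S by (auto intro: finite_PiE simp: PiE_eq_empty_iff)
  have diff: "\<bar>avg_coords S vs f (x(v := a)) - avg_coords S vs f (x(v := b))\<bar> \<le> c"
    if "set vs \<subseteq> V" "x \<in> ?X" "v \<in> V" "a \<in> S" "b \<in> S" for vs x v a b
    using that
  proof (induction vs arbitrary: x)
    case (Cons u vs)
    have "\<bar>avg_coords S (u # vs) f (x(v := a)) - avg_coords S (u # vs) f (x(v := b))\<bar>
      = norm (avg S (\<lambda>s. avg_coords S vs f (x(v := a, u := s)) - avg_coords S vs f (x(v := b, u := s))))"
      by (simp add: avg_diff)
    also have "\<dots> \<le> avg S (\<lambda>s. norm (avg_coords S vs f (x(v := a, u := s)) - avg_coords S vs f (x(v := b, u := s))))"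
      by (rule norm_avg_le)
    also have "\<dots> \<le> c"
    proof (rule avg_le_const[OF S])
      fix s assume s: "s \<in> S"
      show "norm (avg_coords S vs f (x(v := a, u := s)) - avg_coords S vs f (x(v := b, u := s))) \<le> c"
      proof (cases "u = v")
        case False
        then have e: "x(v := a, u := s) = x(u := s, v := a)" "x(v := b, u := s) = x(u := s, v := b)"
          by (auto intro: fun_upd_twist)
        have "x(u := s) \<in> ?X" using Cons.prems s by (intro fun_upd_PiE) auto
        then show ?thesis unfolding e real_norm_def using Cons.prems by (intro Cons.IH) auto
      qed (use c in simp)
    qed
    finally show ?case .
  qed (use f in auto)
  have av: "set vs \<subseteq> V \<Longrightarrow> avg ?X (avg_coords S vs f) = avg ?X f" for vs
  proof (induction vs)
    case (Cons v vs)
    then show ?case using avg_fun_upd[of v V S "avg_coords S vs f"] S by simp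
  qed simp
  have main: "set vs \<subseteq> V \<Longrightarrow> avg ?X (\<lambda>x. exp (f x)) \<le> avg ?X (\<lambda>x. exp (avg_coords S vs f x)) * exp (c\<^sup>2 * length vs)" for vs
  proof (induction vs)
    case (Cons v vs)
    have "avg ?X (\<lambda>x. exp (avg_coords S vs f x)) = avg ?X (\<lambda>x. avg S (\<lambda>s. exp (avg_coords S vs f (x(v := s)))))"
      using Cons.prems S by (intro avg_fun_upd) auto
    also have "\<dots> \<le> avg ?X (\<lambda>x. exp (avg S (\<lambda>s. avg_coords S vs f (x(v := s))) + c\<^sup>2))"
      using Cons.prems S c diff by (intro avg_mono avg_exp_le) auto
    also have "\<dots> = avg ?X (\<lambda>x. exp (avg_coords S (v # vs) f x)) * exp (c\<^sup>2)"
      by (simp add: exp_add avg_multc)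
    finally have "avg ?X (\<lambda>x. exp (avg_coords S vs f x)) * exp (c\<^sup>2 * length vs)
       \<le> avg ?X (\<lambda>x. exp (avg_coords S (v # vs) f x)) * exp (c\<^sup>2) * exp (c\<^sup>2 * length vs)"
      by (intro mult_right_mono) auto
    also have "\<dots> = avg ?X (\<lambda>x. exp (avg_coords S (v # vs) f x)) * exp (c\<^sup>2 * length (v # vs))"
      by (simp add: exp_add[symmetric] algebra_simps)
    finally show ?case using Cons by simp
  qed simp
  obtain vs where vs: "set vs = V" "length vs = card V"
    using V by (metis finite_distinct_list distinct_card)
  obtain x0 where x0: "x0 \<in> ?X" using X by blast
  have const: "avg_coords S vs f x = avg_coords S vs f x0" if "x \<in> ?X" for x
    by (rule avg_coords_cong) (use that x0 vs in \<open>auto simp: PiE_iff extensional_def\<close>)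
  have "avg ?X f = avg ?X (avg_coords S vs f)" using av[of vs] vs by simp
  also have "\<dots> = avg ?X (\<lambda>x. avg_coords S vs f x0)" by (intro avg_cong const)
  finally have "avg ?X f = avg ?X (\<lambda>x. avg_coords S vs f x0)" .
  then have x0': "avg_coords S vs f x0 = avg ?X f" using X by (simp add: avg_const)
  have "avg ?X (\<lambda>x. exp (avg_coords S vs f x)) = avg ?X (\<lambda>x. exp (avg ?X f))"
    by (rule avg_cong) (simp add: const x0')
  then show ?thesis using main[of vs] vs X by (simp add: avg_const exp_add)
qed

text \<open>The constants are fixed in the order \<open>Dm\<close>, \<open>z\<close>,
  \<open>\<eta>\<close>, \<open>\<theta>\<close>, \<open>a\<close>. None of them depends on
  \<open>n\<close>, the states or the transitions, so one linear memory threshold serves all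
  algorithms.\<close>

theorem hidden_indistinguishable:
  fixes q k T :: nat and \<epsilon> :: real
  assumes q: "2 \<le> q" and \<epsilon>: "0 < \<epsilon>"
  obtains c :: real and N :: nat where "0 < c" "\<And>n s (\<Sigma> :: nat set) Yk ini. N \<le> n \<Longrightarrow> hidden n q (12 * n) k \<Sigma> Yk ini \<Longrightarrow>
     card \<Sigma> \<le> 2 ^ s \<Longrightarrow> real s \<le> c * n \<Longrightarrow> hidden.Dv n q (12 * n) \<Sigma> Yk ini T \<le> \<epsilon>"
proof -
  define Q where "Q = real (q ^ k)"
  have Q1: "1 \<le> Q" using q by (simp add: Q_def)
  define Dm where "Dm = (\<Sum>t\<le>T. Dc Q t)"
  have Dm: "Dc Q t \<le> Dm" if "t \<le> T" for t
    unfolding Dm_def using that order_trans[OF zero_le_one Dc_ge_1] by (intro member_le_sum) auto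
  have Dm1: "1 \<le> Dm" using Dm[of 0] Dc_ge_1[of Q 0] by simp
  \<comment> \<open>Each of the \<open>T\<close> rounds loses \<open>2 * z\<close>, together at most
    \<open>\<epsilon> / 2\<close>.\<close>
  define z where "z = min (1/2) (\<epsilon> / (4 * (real T + 1)))"
  have z: "0 < z" "z \<le> 1/2" using \<epsilon> unfolding z_def by (simp) (rule min.cobounded1)
  have Tz: "T * (2 * z) \<le> \<epsilon> / 2"
  proof -
    have "T * (2 * z) \<le> (real T + 1) * (2 * (\<epsilon> / (4 * (real T + 1))))"
      using z by (intro mult_mono) (auto simp: z_def)
    also have "\<dots> = \<epsilon> / 2"
    proof -
      have "0 < real T + 1" by simp
      then show ?thesis by (simp add: field_simps)
    qed
    finally show ?thesis .
  qed
  \<comment> \<open>The three bounds serve, in this order, \<open>Dv_step\<close>, the assumption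
    \<open>\<eta>D\<close> and the assumption \<open>\<theta>q\<close>.\<close>
  define \<eta> where "\<eta> = min (z ^ 4 / Dm) (min (3 / (4 * Q\<^sup>2 * Dm)) (1 / (16 * q * exp 4)))"
  define \<theta> where "\<theta> = \<eta>\<^sup>2"
  have q0: "0 < real q" using q by simp
  have \<eta>0: "0 < \<eta>" using z Q1 Dm1 q0 by (simp add: \<eta>_def)
  have \<eta>1: "\<eta> \<le> 1"
  proof -
    have "1 \<le> real (16 * q) * exp 4"
      using q mult_mono[of 1 "real (16 * q)" 1 "exp 4"] by simp
    then have "1 / (16 * q * exp 4) \<le> 1" by simp
    then show ?thesis unfolding \<eta>_def by linarith
  qed
  have \<eta>a: "\<eta> * Dm \<le> z ^ 4"
  proof -
    have "\<eta> \<le> z ^ 4 / Dm" by (simp add: \<eta>_def)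
    then show ?thesis using Dm1 by (simp add: field_simps)
  qed
  have \<eta>b: "Q\<^sup>2 * Dm * \<eta> \<le> 3 / 4"
  proof -
    have "\<eta> \<le> 3 / (4 * Q\<^sup>2 * Dm)" by (simp add: \<eta>_def)
    moreover have "0 < 4 * Q\<^sup>2 * Dm" using Q1 Dm1 by simp
    ultimately have "\<eta> * (4 * Q\<^sup>2 * Dm) \<le> 3" by (simp only: pos_le_divide_eq)
    then show ?thesis by (simp add: algebra_simps)
  qed
  have \<theta>0: "0 < \<theta>" using \<eta>0 by (simp add: \<theta>_def)
  have \<theta>\<eta>: "\<theta> \<le> \<eta>" unfolding \<theta>_def power2_eq_square using \<eta>0 \<eta>1 mult_left_le[of \<eta> \<eta>] by simp
  have \<theta>c: "\<theta> * (16 * q * exp 4) \<le> 1"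
  proof -
    have p: "0 < 16 * real q * exp 4" using q0 by simp
    have "\<theta> \<le> 1 / (16 * real q * exp 4)" using \<theta>\<eta> by (simp add: \<eta>_def)
    then show ?thesis using p by (simp only: pos_le_divide_eq of_nat_mult of_nat_numeral)
  qed
  define a where "a = \<theta> / 16 ^ T"
  have a0: "0 < a" using \<theta>0 by (simp add: a_def)
  have "(\<lambda>n. T * exp (- (a * real n / 2))) \<longlonglongrightarrow> real T * 0"
  proof (intro tendsto_mult tendsto_const)
    have "filterlim (\<lambda>n. a / 2 * real n) at_top sequentially"
      using a0 by (intro filterlim_tendsto_pos_mult_at_top[OF tendsto_const] filterlim_real_sequentially) simp
    then have "filterlim (\<lambda>n. - (a / 2 * real n)) at_bot sequentially"
      by (simp add: filterlim_uminus_at_bot)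
    then show "(\<lambda>n. exp (- (a * real n / 2))) \<longlonglongrightarrow> 0"
      using filterlim_compose[OF exp_at_bot, of "\<lambda>n. - (a / 2 * real n)" sequentially] by simp
  qed
  then have "\<forall>\<^sub>F n in sequentially. T * exp (- (a * real n / 2)) < \<epsilon> / 2"
    using \<epsilon> by (intro order_tendstoD(2)) auto
  then obtain N0 where N0: "\<And>n. N0 \<le> n \<Longrightarrow> T * exp (- (a * real n / 2)) < \<epsilon> / 2"
    by (auto simp: eventually_sequentially)
  show ?thesis
  proof (rule that[where c = a and N = "max 1 N0"])
    show "0 < a" by (rule a0)
  next
    fix n s and \<Sigma> :: "nat set" and Yk ini
    assume n: "max 1 N0 \<le> n" and hid: "hidden n q (12 * n) k \<Sigma> Yk ini" and c: "card \<Sigma> \<le> 2 ^ s" and s: "real s \<le> a * n"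
    interpret hd: hidden n q "12 * n" k \<Sigma> Yk ini by (rule hid)
    interpret h12: hidden12 n q "12 * n" k \<Sigma> Yk ini \<eta> \<theta> "a * n" T
    proof unfold_locales
      have "real (card \<Sigma>) \<le> 2 ^ s" using c by (metis of_nat_le_iff of_nat_numeral of_nat_power)
      also have "(2::real) ^ s \<le> exp 1 ^ s" using exp_ge_add_one_self[of "1::real"] by (intro power_mono) auto
      also have "\<dots> = exp (real s)" by (simp add: exp_of_nat_mult[symmetric])
      also have "\<dots> \<le> exp (a * n)" using s by simp
      finally show "real (card \<Sigma>) \<le> exp (a * n)" .
      fix t assume t: "t \<le> T"
      have "Q\<^sup>2 * Dc Q t * \<eta> \<le> Q\<^sup>2 * Dm * \<eta>"
        using Dm[OF t] \<eta>0 by (intro mult_right_mono mult_left_mono) auto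
      then show "(real (q ^ k))\<^sup>2 * Dc (real (q ^ k)) t * \<eta> \<le> 3 / 4"
        using \<eta>b unfolding Q_def by linarith
    qed (use n \<eta>0 \<eta>1 a0 \<theta>c in \<open>auto simp: \<theta>_def a_def\<close>)
    have "hd.Dv T \<le> T * (2 * z + exp (- (\<theta> * n / 16 ^ T / 2)))"
    proof (rule h12.Dv_bound)
      fix t assume t: "t \<le> T"
      have "Dc Q t * \<eta> / 3 \<le> Dm * \<eta> / 3" using Dm[OF t] \<eta>0 by simp
      also have "\<dots> \<le> z ^ 4"
      proof -
        have "0 \<le> z ^ 4" "Dm * \<eta> \<le> z ^ 4" using \<eta>a by (simp_all add: mult.commute)
        then show ?thesis by linarith
      qed
      finally show "Dc (real (q ^ k)) t * \<eta> / 3 \<le> z ^ 4" unfolding Q_def .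
    qed (use z in auto)
    also have "\<dots> = T * (2 * z) + T * exp (- (a * n / 2))" by (simp add: a_def algebra_simps)
    also have "\<dots> \<le> \<epsilon>" using Tz N0[of n] n by simp
    finally show "hd.Dv T \<le> \<epsilon>" .
  qed
qed

section \<open>The hard instances\<close>


text \<open>On a nonempty list this is nonnegative exactly if \<open>\<nu>\<close> satisfies a
  fraction of at least \<open>\<tau>\<close>. Unlike the fraction it is additive under
  concatenation, so its exponential moments multiply over independent rounds.\<close>

definition excess :: "real \<Rightarrow> (nat \<Rightarrow> nat) \<Rightarrow> constr list \<Rightarrow> real" where
  "excess \<tau> \<nu> \<Psi> = real (num_sat \<nu> \<Psi>) - \<tau> * real (length \<Psi>)"

lemma excess_Nil: "excess \<tau> \<nu> [] = 0" by (simp add: excess_def num_sat_def)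

lemma excess_append: "excess \<tau> \<nu> (xs @ ys) = excess \<tau> \<nu> xs + excess \<tau> \<nu> ys"
  by (simp add: excess_def num_sat_def algebra_simps)

lemma excess_concat: "excess \<tau> \<nu> (concat xss) = (\<Sum>xs\<leftarrow>xss. excess \<tau> \<nu> xs)"
  by (induction xss) (simp_all add: excess_Nil excess_append)

lemma excess_sum_list: "excess \<tau> \<nu> \<Psi> = (\<Sum>c\<leftarrow>\<Psi>. of_bool (satisfies \<nu> c) - \<tau>)"
  by (induction \<Psi>) (simp_all add: excess_def num_sat_def algebra_simps)

lemma abs_excess_le: "0 \<le> \<tau> \<Longrightarrow> \<bar>excess \<tau> \<nu> \<Psi>\<bar> \<le> (1 + \<tau>) * length \<Psi>"
proof -
  assume t: "0 \<le> \<tau>"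
  have "num_sat \<nu> \<Psi> \<le> length \<Psi>" by (simp add: num_sat_def)
  then have "real (num_sat \<nu> \<Psi>) \<le> length \<Psi>" by simp
  moreover have "0 \<le> \<tau> * length \<Psi>" using t by simp
  ultimately show ?thesis by (simp add: excess_def algebra_simps abs_le_iff)
qed

lemma finite_csp_values: "finite {real (num_sat \<nu> \<Psi>) / real (length \<Psi>) | \<nu>. assignment q n \<nu>}"
proof (rule finite_subset)
  show "{real (num_sat \<nu> \<Psi>) / real (length \<Psi>) | \<nu>. assignment q n \<nu>} \<subseteq> (\<lambda>j. real j / real (length \<Psi>)) ` {..length \<Psi>}"
    by (auto simp: num_sat_def)
qed simp

lemma csp_val_ge: "assignment q n \<nu> \<Longrightarrow> real (num_sat \<nu> \<Psi>) / real (length \<Psi>) \<le> csp_val q n \<Psi>"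
  unfolding csp_val_def by (intro Max_ge finite_csp_values) auto

lemma csp_val_attained:
  assumes "1 \<le> q" shows "\<exists>\<nu>. assignment q n \<nu> \<and> csp_val q n \<Psi> = real (num_sat \<nu> \<Psi>) / real (length \<Psi>)"
proof -
  let ?A = "{real (num_sat \<nu> \<Psi>) / real (length \<Psi>) | \<nu>. assignment q n \<nu>}"
  have "assignment q n (\<lambda>_. 0)" using assms by (auto simp: assignment_def)
  then have "?A \<noteq> {}" by blast
  then have "csp_val q n \<Psi> \<in> ?A" unfolding csp_val_def by (intro Max_in finite_csp_values)
  then show ?thesis by blast
qed

lemma csp_val_bounds:
  assumes "1 \<le> q" shows "0 \<le> csp_val q n \<Psi>" "csp_val q n \<Psi> \<le> 1"
proof -
  obtain \<nu> where "csp_val q n \<Psi> = real (num_sat \<nu> \<Psi>) / real (length \<Psi>)" using csp_val_attained[OF assms] by blast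
  moreover have "num_sat \<nu> \<Psi> \<le> length \<Psi>" by (simp add: num_sat_def)
  ultimately show "0 \<le> csp_val q n \<Psi>" "csp_val q n \<Psi> \<le> 1" by (simp_all add: divide_le_eq_1)
qed

lemma card_PiE_map_eq:
  assumes I: "finite I" and vs: "distinct vs" "set vs \<subseteq> I" "length w = length vs"
    and w: "\<And>i. i < length vs \<Longrightarrow> w ! i \<in> G (vs ! i)"
  shows "card {f\<in>PiE I G. map f vs = w} = (\<Prod>v\<in>I - set vs. card (G v))"
proof -
  let ?g = "\<lambda>v. the (map_of (zip vs w) v)"
  have g: "?g (vs ! i) = w ! i" if "i < length vs" for i
    using vs that by (simp add: map_of_zip_nth)
  have eq: "map f vs = w \<longleftrightarrow> (\<forall>v\<in>set vs. f v = ?g v)" for f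
    using vs(3) by (simp add: list_eq_iff_nth_eq all_set_conv_all_nth g)
  have "{f\<in>PiE I G. map f vs = w} = PiE I (\<lambda>v. if v \<in> set vs then {?g v} else G v)"
  proof (intro set_eqI iffI)
    fix f assume "f \<in> {f\<in>PiE I G. map f vs = w}"
    then show "f \<in> PiE I (\<lambda>v. if v \<in> set vs then {?g v} else G v)" unfolding eq by (auto simp: PiE_iff)
  next
    fix f assume f: "f \<in> PiE I (\<lambda>v. if v \<in> set vs then {?g v} else G v)"
    have "f v = ?g v" if "v \<in> set vs" for v using PiE_mem[OF f, of v] that vs by auto
    moreover have "f v \<in> G v" if v: "v \<in> I" for v
    proof (cases "v \<in> set vs")
      case True
      then obtain i where "i < length vs" "v = vs ! i" by (auto simp: in_set_conv_nth)
      then show ?thesis using PiE_mem[OF f v] True g w by auto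
    qed (use PiE_mem[OF f v] in simp)
    ultimately show "f \<in> {f\<in>PiE I G. map f vs = w}" using f unfolding eq by (auto simp: PiE_iff)
  qed
  then have "card {f\<in>PiE I G. map f vs = w} = (\<Prod>v\<in>I. card (if v \<in> set vs then {?g v} else G v))"
    using I by (simp add: card_PiE)
  also have "\<dots> = (\<Prod>v\<in>I - set vs. card (if v \<in> set vs then {?g v} else G v))"
    using I by (intro prod.mono_neutral_right) auto
  also have "\<dots> = (\<Prod>v\<in>I - set vs. card (G v))" by (rule prod.cong) auto
  finally show ?thesis .
qed

lemma card_slot_eq:
  assumes "B \<subseteq> {..<n}" "i < m"
  shows "card {h\<in>{..<n} \<rightarrow>\<^sub>E {..<m}. slot n h i = B} = (m - 1) ^ (n - card B)"
proof -
  have "{h\<in>{..<n} \<rightarrow>\<^sub>E {..<m}. slot n h i = B} = PiE {..<n} (\<lambda>v. if v \<in> B then {i} else {..<m} - {i})"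
  proof (intro set_eqI iffI)
    fix h assume "h \<in> {h\<in>{..<n} \<rightarrow>\<^sub>E {..<m}. slot n h i = B}"
    then show "h \<in> PiE {..<n} (\<lambda>v. if v \<in> B then {i} else {..<m} - {i})"
      unfolding slot_def by (auto simp: PiE_iff)
  next
    fix h assume h: "h \<in> PiE {..<n} (\<lambda>v. if v \<in> B then {i} else {..<m} - {i})"
    have 1: "v < n \<Longrightarrow> h v = i \<longleftrightarrow> v \<in> B" for v using PiE_mem[OF h, of v] by (auto split: if_splits)
    have 2: "v < n \<Longrightarrow> h v < m" for v using PiE_mem[OF h, of v] assms by (auto split: if_splits)
    have "slot n h i = B" using 1 assms by (auto simp: slot_def)
    then show "h \<in> {h\<in>{..<n} \<rightarrow>\<^sub>E {..<m}. slot n h i = B}" using 2 h by (auto simp: PiE_iff)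
  qed
  then have "card {h\<in>{..<n} \<rightarrow>\<^sub>E {..<m}. slot n h i = B} = (\<Prod>v<n. card (if v \<in> B then {i} else {..<m} - {i}))"
    by (simp add: card_PiE)
  also have "\<dots> = (\<Prod>v\<in>{..<n} - B. card (if v \<in> B then {i} else {..<m} - {i}))"
    by (intro prod.mono_neutral_right) auto
  also have "\<dots> = (\<Prod>v\<in>{..<n} - B. m - 1)" using assms by (intro prod.cong) auto
  also have "\<dots> = (m - 1) ^ (n - card B)"
    using assms finite_subset[of B "{..<n}"] by (simp add: card_Diff_subset)
  finally show ?thesis .
qed

lemma avg_of_bool:
  assumes "finite S"
  shows "avg S (\<lambda>x. of_bool (P x) :: real) = card {x\<in>S. P x} / card S"
proof -
  have "(\<Sum>x\<in>S. of_bool (P x) :: real) = card {x\<in>S. P x}"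
    using assms by (simp add: of_bool_def sum.If_cases Int_def)
  then show ?thesis by (simp add: avg_def)
qed

text \<open>The variable \<open>v < n0 * N\<close> is a copy of the variable \<open>v mod n0\<close> of \<open>\<Psi>0\<close>. A lift of \<open>c\<close> to the
  tuple \<open>vs\<close> is emitted if \<open>vs\<close> fills a slot and \<open>y\<close> shows on it the satisfying pattern \<open>wit c\<close>.\<close>

locale hard_csp =
  fixes q k n0 N :: nat and F :: "(nat list \<Rightarrow> bool) set" and \<Psi>0 :: "constr list"
    and wit :: "constr \<Rightarrow> nat list" and \<tau> :: real
  assumes q2: "2 \<le> q" and N: "1 \<le> N" and inst: "is_instance F k n0 \<Psi>0" and k1: "1 \<le> k"
    and wit: "\<And>c. c \<in> set \<Psi>0 \<Longrightarrow> length (wit c) = k \<and> set (wit c) \<subseteq> {..<q} \<and> fst c (wit c)"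
    and \<tau>: "csp_val q n0 \<Psi>0 < \<tau>"
begin

abbreviation "n \<equiv> n0 * N"
abbreviation "m \<equiv> 12 * n"
abbreviation "H \<equiv> {..<n} \<rightarrow>\<^sub>E {..<m}"
abbreviation "X \<equiv> {..<n} \<rightarrow>\<^sub>E {..<q}"

definition tuples :: "constr \<Rightarrow> nat list list" where
  "tuples c = filter (\<lambda>vs. map (\<lambda>v. v mod n0) vs = snd c) (List.n_lists k [0..<n])"

definition emit :: "nat set \<Rightarrow> (nat \<Rightarrow> nat) \<Rightarrow> constr \<Rightarrow> constr list" where
  "emit B y c = map (Pair (fst c)) (filter (\<lambda>vs. set vs = B \<and> map y vs = wit c) (tuples c))"

definition cons_slot :: "nat set \<Rightarrow> (nat \<Rightarrow> nat) \<Rightarrow> constr list" where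
  "cons_slot B y = concat (map (emit B y) \<Psi>0)"

definition cons :: "(nat \<Rightarrow> nat) \<Rightarrow> (nat \<Rightarrow> nat) \<Rightarrow> constr list" where
  "cons h y = concat (map (\<lambda>i. cons_slot (slot n h i) y) [0..<m])"

lemma valid0: "c \<in> set \<Psi>0 \<Longrightarrow> valid_constraint F k n0 c" using inst by (simp add: is_instance_def)

lemma \<Psi>0_ne: "\<Psi>0 \<noteq> []" using inst by (simp add: is_instance_def)

lemma k_le_n0: "k \<le> n0"
proof -
  obtain c where "c \<in> set \<Psi>0" using \<Psi>0_ne by (cases \<Psi>0) auto
  then have "length (snd c) = k" "distinct (snd c)" "set (snd c) \<subseteq> {..<n0}"
    using valid0 by (auto simp: valid_constraint_def)
  then show ?thesis using distinct_card[of "snd c"] card_mono[of "{..<n0}" "set (snd c)"] by simp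
qed

lemma n0_pos: "0 < n0" using k_le_n0 k1 by simp

lemma n_pos: "0 < n" using n0_pos N by simp

lemma k_le_n: "k \<le> n"
proof -
  have "n0 * 1 \<le> n0 * N" using N by (rule mult_le_mono2)
  then show ?thesis using k_le_n0 by linarith
qed

lemma \<tau>_pos: "0 < \<tau>" using \<tau> csp_val_bounds(1)[of q n0 \<Psi>0] q2 by linarith

lemma finH: "finite H" "H \<noteq> {}" and cardH: "card H = m ^ n"
  using n_pos by (auto intro!: finite_PiE simp: PiE_eq_empty_iff lessThan_empty_iff card_PiE)

lemma finX: "finite X" "X \<noteq> {}" and cardX: "card X = q ^ n"
  using q2 by (auto intro!: finite_PiE simp: PiE_eq_empty_iff lessThan_empty_iff card_PiE)

lemma tuples_iff: "vs \<in> set (tuples c) \<longleftrightarrow> length vs = k \<and> set vs \<subseteq> {..<n} \<and> map (\<lambda>v. v mod n0) vs = snd c"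
  unfolding tuples_def by (auto simp: set_n_lists atLeast0LessThan)

lemma distinct_tuples: "distinct (tuples c)"
  unfolding tuples_def by (intro distinct_filter distinct_n_lists) simp

lemma tuple_distinct: "c \<in> set \<Psi>0 \<Longrightarrow> vs \<in> set (tuples c) \<Longrightarrow> distinct vs"
proof -
  assume "c \<in> set \<Psi>0" "vs \<in> set (tuples c)"
  then have "distinct (map (\<lambda>v. v mod n0) vs)" using valid0[of c] by (simp add: tuples_iff valid_constraint_def)
  then show ?thesis by (simp add: distinct_map)
qed

text \<open>The entries of a lift are told apart by their residues modulo \<open>n0\<close>, so
  their set already fixes their order. Hence a slot emits at most one lift of each constraint of
  \<open>\<Psi>0\<close>, which bounds the influence of a slot.\<close>

lemma tuple_unique:
  assumes c: "c \<in> set \<Psi>0" and v: "vs \<in> set (tuples c)" "us \<in> set (tuples c)" "set vs = set us"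
  shows "vs = us"
proof (rule nth_equalityI)
  show l: "length vs = length us" using v(1,2) by (simp add: tuples_iff)
  have inj: "inj_on (\<lambda>v. v mod n0) (set us)"
  proof -
    have "distinct (map (\<lambda>v. v mod n0) us)" using valid0[OF c] v(2) by (simp add: tuples_iff valid_constraint_def)
    then show ?thesis by (simp add: distinct_map)
  qed
  fix i assume i: "i < length vs"
  have "map (\<lambda>v. v mod n0) vs = map (\<lambda>v. v mod n0) us" using v(1,2) unfolding tuples_iff by argo
  then have "map (\<lambda>v. v mod n0) vs ! i = map (\<lambda>v. v mod n0) us ! i" by (rule arg_cong)
  then have "(vs ! i) mod n0 = (us ! i) mod n0" using i l by simp
  moreover have "vs ! i \<in> set us" unfolding v(3)[symmetric] using i by (rule nth_mem)
  moreover have "us ! i \<in> set us" using i unfolding l by (rule nth_mem)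
  ultimately show "vs ! i = us ! i" by (rule inj_onD[OF inj])
qed

lemma cons_slot_valid: "c \<in> set (cons_slot B y) \<Longrightarrow> valid_constraint F k n c"
proof -
  assume "c \<in> set (cons_slot B y)"
  then obtain d vs where d: "d \<in> set \<Psi>0" "vs \<in> set (tuples d)" "c = (fst d, vs)"
    unfolding cons_slot_def emit_def by auto
  then show ?thesis using valid0[OF d(1)] tuple_distinct[OF d(1,2)] by (simp add: valid_constraint_def tuples_iff)
qed

lemma cons_valid: "c \<in> set (cons h y) \<Longrightarrow> valid_constraint F k n c"
proof -
  assume "c \<in> set (cons h y)"
  then obtain i where "c \<in> set (cons_slot (slot n h i) y)" by (auto simp: cons_def)
  then show ?thesis by (rule cons_slot_valid)
qed

text \<open>A lift has \<open>k\<close> distinct entries. This is the source of the invariance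
  \<open>Y_bad\<close>.\<close>

lemma cons_slot_card: "card B \<noteq> k \<Longrightarrow> cons_slot B y = []"
proof -
  assume B: "card B \<noteq> k"
  have "emit B y c = []" if c: "c \<in> set \<Psi>0" for c
  proof -
    have "set vs \<noteq> B" if "vs \<in> set (tuples c)" for vs
      using distinct_card[OF tuple_distinct[OF c that]] that B by (auto simp: tuples_iff)
    then show ?thesis unfolding emit_def by (auto simp: filter_empty_conv)
  qed
  then show ?thesis by (simp add: cons_slot_def)
qed

lemma cons_slot_cong: "(\<And>v. v \<in> B \<Longrightarrow> y v = y' v) \<Longrightarrow> cons_slot B y = cons_slot B y'"
proof -
  assume y: "\<And>v. v \<in> B \<Longrightarrow> y v = y' v"
  have "emit B y c = emit B y' c" for c
  proof -
    have "set vs = B \<and> map y vs = wit c \<longleftrightarrow> set vs = B \<and> map y' vs = wit c" for vs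
    proof -
      have "map y vs = map y' vs" if "set vs = B" using that y by auto
      then have "set vs = B \<Longrightarrow> map y vs = wit c \<longleftrightarrow> map y' vs = wit c" by (simp only:)
      then show ?thesis by blast
    qed
    then show ?thesis unfolding emit_def by simp
  qed
  then have "emit B y = emit B y'" by (rule ext)
  then show ?thesis by (simp add: cons_slot_def)
qed

lemma length_cons_slot: "length (cons_slot B y) \<le> length \<Psi>0"
proof -
  have "length (emit B y c) \<le> 1" if c: "c \<in> set \<Psi>0" for c
  proof -
    let ?l = "filter (\<lambda>vs. set vs = B \<and> map y vs = wit c) (tuples c)"
    have "card (set ?l) \<le> 1"
      using tuple_unique[OF c] by (intro card_le_Suc0_iff_eq[THEN iffD2, unfolded One_nat_def[symmetric]]) auto
    then show ?thesis using distinct_card[of ?l] distinct_tuples[of c] by (simp add: emit_def)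
  qed
  then have "(\<Sum>c\<leftarrow>\<Psi>0. length (emit B y c)) \<le> (\<Sum>c\<leftarrow>\<Psi>0. 1)" by (intro sum_list_mono) auto
  then show ?thesis by (simp add: cons_slot_def length_concat comp_def sum_list_triv)
qed

definition "K = (1 + \<tau>) * length \<Psi>0"

lemma abs_excess_slot: "\<bar>excess \<tau> \<nu> (cons_slot B y)\<bar> \<le> K"
proof -
  have "\<bar>excess \<tau> \<nu> (cons_slot B y)\<bar> \<le> (1 + \<tau>) * length (cons_slot B y)" using \<tau>_pos by (intro abs_excess_le) simp
  also have "\<dots> \<le> K" unfolding K_def using \<tau>_pos length_cons_slot by (intro mult_left_mono) auto
  finally show ?thesis .
qed

lemma excess_cons: "excess \<tau> \<nu> (cons h y) = (\<Sum>i<m. excess \<tau> \<nu> (cons_slot (slot n h i) y))"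
proof -
  have "excess \<tau> \<nu> (cons h y) = (\<Sum>i\<leftarrow>[0..<m]. excess \<tau> \<nu> (cons_slot (slot n h i) y))"
    unfolding cons_def excess_concat by (simp add: comp_def)
  then show ?thesis by (simp add: sum_list_distinct_conv_sum_set atLeast0LessThan)
qed

lemma excess_slot:
  "excess \<tau> \<nu> (cons_slot B y) = (\<Sum>c\<leftarrow>\<Psi>0. \<Sum>vs\<in>set (tuples c).
      of_bool (B = set vs) * (of_bool (map y vs = wit c) * (of_bool (fst c (map \<nu> vs)) - \<tau>)))"
proof -
  have "excess \<tau> \<nu> (emit B y c) = (\<Sum>vs\<in>set (tuples c).
      of_bool (B = set vs) * (of_bool (map y vs = wit c) * (of_bool (fst c (map \<nu> vs)) - \<tau>)))" for c
  proof -
    let ?l = "filter (\<lambda>vs. set vs = B \<and> map y vs = wit c) (tuples c)"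
    have "excess \<tau> \<nu> (emit B y c) = (\<Sum>vs\<leftarrow>?l. of_bool (fst c (map \<nu> vs)) - \<tau>)"
      unfolding excess_sum_list emit_def by (simp add: satisfies_def comp_def)
    also have "\<dots> = (\<Sum>vs\<in>set ?l. of_bool (fst c (map \<nu> vs)) - \<tau>)"
      using distinct_tuples by (intro sum_list_distinct_conv_sum_set) simp
    also have "\<dots> = (\<Sum>vs\<in>set (tuples c). if set vs = B \<and> map y vs = wit c then of_bool (fst c (map \<nu> vs)) - \<tau> else 0)"
      by (simp add: sum.inter_filter)
    also have "\<dots> = (\<Sum>vs\<in>set (tuples c).
      of_bool (B = set vs) * (of_bool (map y vs = wit c) * (of_bool (fst c (map \<nu> vs)) - \<tau>)))"
      by (intro sum.cong) auto
    finally show ?thesis .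
  qed
  then show ?thesis unfolding cons_slot_def excess_concat by (simp add: comp_def)
qed

text \<open>The expected number of slots whose content is exactly a given set of \<open>k\<close>
  variables.\<close>

definition "\<kappa> = real m * real (m - 1) ^ (n - k) / real m ^ n"

lemma avg_map_eq:
  assumes c: "c \<in> set \<Psi>0" and vs: "vs \<in> set (tuples c)"
  shows "avg X (\<lambda>y. of_bool (map y vs = wit c)) = 1 / real q ^ k"
proof -
  have l: "length vs = k" "set vs \<subseteq> {..<n}" using vs by (auto simp: tuples_iff)
  have d: "distinct vs" by (rule tuple_distinct[OF c vs])
  have w: "length (wit c) = length vs" using wit[OF c] l by simp
  have "wit c ! i \<in> {..<q}" if "i < length vs" for i
    using wit[OF c] that w by (metis nth_mem subsetD)
  then have "card {y\<in>X. map y vs = wit c} = (\<Prod>v\<in>{..<n} - set vs. card {..<q})"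
    using d l w by (intro card_PiE_map_eq) auto
  also have "\<dots> = q ^ (n - k)" using l distinct_card[OF d] by (simp add: card_Diff_subset)
  finally have "avg X (\<lambda>y. of_bool (map y vs = wit c) :: real) = real (q ^ (n - k)) / real (q ^ n)"
    using finX by (simp add: avg_of_bool cardX)
  also have "\<dots> = 1 / real q ^ k"
  proof -
    have "real q ^ n = real q ^ (n - k) * real q ^ k" using k_le_n by (simp add: power_add[symmetric])
    then show ?thesis using q2 by simp
  qed
  finally show ?thesis .
qed

lemma avg_slot_eq:
  assumes c: "c \<in> set \<Psi>0" and vs: "vs \<in> set (tuples c)"
  shows "(\<Sum>i<m. avg H (\<lambda>h. of_bool (slot n h i = set vs))) = \<kappa>"
proof -
  have l: "length vs = k" "set vs \<subseteq> {..<n}" using vs by (auto simp: tuples_iff)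
  have "card (set vs) = k" using distinct_card[OF tuple_distinct[OF c vs]] l by simp
  then have "avg H (\<lambda>h. of_bool (slot n h i = set vs) :: real) = real ((m - 1) ^ (n - k)) / real (m ^ n)" if "i < m" for i
    using finH card_slot_eq[OF l(2) that] by (simp add: avg_of_bool cardH)
  then have "(\<Sum>i<m. avg H (\<lambda>h. of_bool (slot n h i = set vs) :: real)) = (\<Sum>i<m. real ((m - 1) ^ (n - k)) / real (m ^ n))"
    by (intro sum.cong) auto
  then show ?thesis by (simp add: \<kappa>_def)
qed

text \<open>Slot map and \<open>y\<close> are independent, and all lifts have the same chance to
  fill a slot and the same chance to show their pattern. The mean is therefore a multiple of the
  excess of the list of all lifts.\<close>

lemma avg_excess_cons:
  "avg H (\<lambda>h. avg X (\<lambda>y. excess \<tau> \<nu> (cons h y)))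
    = \<kappa> / real q ^ k * (\<Sum>c\<leftarrow>\<Psi>0. \<Sum>vs\<in>set (tuples c). of_bool (fst c (map \<nu> vs)) - \<tau>)"
proof -
  have avg_sum_list: "avg S (\<lambda>x. \<Sum>c\<leftarrow>L. f c x) = (\<Sum>c\<leftarrow>L. avg S (f c))" for S :: "(nat \<Rightarrow> nat) set" and L :: "constr list" and f :: "constr \<Rightarrow> (nat \<Rightarrow> nat) \<Rightarrow> real"
    by (induction L) (simp_all add: avg_add avg_def)
  have sum_sum_list: "(\<Sum>i<j. \<Sum>c\<leftarrow>L. f c i) = (\<Sum>c\<leftarrow>L. \<Sum>i<j. f c i)" for j :: nat and L :: "constr list" and f :: "constr \<Rightarrow> nat \<Rightarrow> real"
    by (induction L) (simp_all add: sum.distrib)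
  let ?g = "\<lambda>c vs. of_bool (fst c (map \<nu> vs)) - \<tau>"
  have "avg H (\<lambda>h. avg X (\<lambda>y. excess \<tau> \<nu> (cons h y))) = (\<Sum>c\<leftarrow>\<Psi>0. \<Sum>vs\<in>set (tuples c).
     (\<Sum>i<m. avg H (\<lambda>h. of_bool (slot n h i = set vs))) * (avg X (\<lambda>y. of_bool (map y vs = wit c)) * ?g c vs))"
    unfolding excess_cons excess_slot avg_sum avg_sum_list avg_cmult avg_multc sum_sum_list
    by (simp only: sum.swap[of _ _ "{..<m}"] sum_distrib_right)
  also have "\<dots> = (\<Sum>c\<leftarrow>\<Psi>0. \<Sum>vs\<in>set (tuples c). \<kappa> / real q ^ k * ?g c vs)"
    by (intro arg_cong[where f=sum_list] map_cong sum.cong refl) (simp add: avg_map_eq avg_slot_eq)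
  also have "\<dots> = \<kappa> / real q ^ k * (\<Sum>c\<leftarrow>\<Psi>0. \<Sum>vs\<in>set (tuples c). ?g c vs)"
    unfolding sum_distrib_left[symmetric] sum_list_const_mult ..
  finally show ?thesis .
qed

definition "grp g = {v\<in>{..<n}. v mod n0 = g}"

lemma card_grp: "g < n0 \<Longrightarrow> card (grp g) = N"
proof -
  assume g: "g < n0"
  have "grp g = (\<lambda>j. g + n0 * j) ` {..<N}"
  proof (intro set_eqI iffI)
    fix v assume "v \<in> grp g"
    then have v: "v < n" "v mod n0 = g" by (auto simp: grp_def)
    then have "v = g + n0 * (v div n0)" by (metis add.commute mult_div_mod_eq)
    moreover have "v div n0 < N" using v(1) n0_pos by (simp add: less_mult_imp_div_less mult.commute)
    ultimately show "v \<in> (\<lambda>j. g + n0 * j) ` {..<N}" by blast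
  next
    fix v assume "v \<in> (\<lambda>j. g + n0 * j) ` {..<N}"
    then obtain j where j: "j < N" "v = g + n0 * j" by auto
    have "g + n0 * j < n0 + n0 * j" using g by simp
    also have "\<dots> = n0 * (j + 1)" by simp
    also have "\<dots> \<le> n0 * N" using j by (intro mult_le_mono2) simp
    finally show "v \<in> grp g" using g j by (simp add: grp_def)
  qed
  moreover have "inj_on (\<lambda>j. g + n0 * j) {..<N}" using n0_pos by (auto simp: inj_on_def)
  ultimately show ?thesis by (simp add: card_image)
qed

text \<open>A section \<open>\<xi>\<close> picks one copy of each variable of
  \<open>\<Psi>0\<close>; a given lift arises from all sections that extend it freely on the other
  \<open>n0 - k\<close> groups.\<close>

lemma sum_tuples_lift:
  assumes c: "c \<in> set \<Psi>0"
  shows "(\<Sum>\<xi>\<in>PiE {..<n0} grp. \<phi> (map \<xi> (snd c))) = real (N ^ (n0 - k)) * (\<Sum>vs\<in>set (tuples c). \<phi> vs)"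
proof -
  let ?\<Xi> = "PiE {..<n0} grp"
  have js: "length (snd c) = k" "distinct (snd c)" "set (snd c) \<subseteq> {..<n0}"
    using valid0[OF c] by (auto simp: valid_constraint_def)
  have fin: "finite ?\<Xi>" by (intro finite_PiE) (auto simp: grp_def)
  have im: "map \<xi> (snd c) \<in> set (tuples c)" if "\<xi> \<in> ?\<Xi>" for \<xi>
  proof -
    have "\<xi> j \<in> grp j" if "j \<in> set (snd c)" for j using PiE_mem[OF \<open>\<xi> \<in> ?\<Xi>\<close>] that js by auto
    then show ?thesis using js unfolding tuples_iff by (auto simp: grp_def intro!: map_idI)
  qed
  have "(\<Sum>\<xi>\<in>?\<Xi>. \<phi> (map \<xi> (snd c))) = (\<Sum>vs\<in>set (tuples c). \<Sum>\<xi>\<in>{\<xi>\<in>?\<Xi>. map \<xi> (snd c) = vs}. \<phi> (map \<xi> (snd c)))"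
    using fin im by (intro sum.group[symmetric]) auto
  also have "\<dots> = (\<Sum>vs\<in>set (tuples c). real (N ^ (n0 - k)) * \<phi> vs)"
  proof (rule sum.cong[OF refl])
    fix vs assume vs: "vs \<in> set (tuples c)"
    then have v: "length vs = k" "set vs \<subseteq> {..<n}" "map (\<lambda>v. v mod n0) vs = snd c" by (auto simp: tuples_iff)
    have "vs ! i \<in> grp (snd c ! i)" if "i < length (snd c)" for i
    proof -
      have "i < length vs" using that v js by simp
      then have "(vs ! i) mod n0 = snd c ! i" unfolding v(3)[symmetric] by simp
      moreover have "vs ! i \<in> {..<n}" using v \<open>i < length vs\<close> nth_mem by blast
      ultimately show ?thesis by (simp add: grp_def)
    qed
    then have "card {\<xi>\<in>?\<Xi>. map \<xi> (snd c) = vs} = (\<Prod>g\<in>{..<n0} - set (snd c). card (grp g))"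
      using js v by (intro card_PiE_map_eq) auto
    also have "\<dots> = (\<Prod>g\<in>{..<n0} - set (snd c). N)" by (intro prod.cong) (auto simp: card_grp)
    also have "\<dots> = N ^ (n0 - k)" using js distinct_card[OF js(2)] by (simp add: card_Diff_subset)
    finally show "(\<Sum>\<xi>\<in>{\<xi>\<in>?\<Xi>. map \<xi> (snd c) = vs}. \<phi> (map \<xi> (snd c))) = real (N ^ (n0 - k)) * \<phi> vs" by simp
  qed
  also have "\<dots> = real (N ^ (n0 - k)) * (\<Sum>vs\<in>set (tuples c). \<phi> vs)" by (simp add: sum_distrib_left)
  finally show ?thesis .
qed

text \<open>Along each section \<open>\<nu>\<close> restricts to an assignment of
  \<open>\<Psi>0\<close>, which stays below \<open>\<tau>\<close> by a fixed margin. Averaging over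
  the sections transfers the margin to the list of all lifts.\<close>

lemma sum_tuples_le:
  assumes \<nu>: "\<And>v. v < n \<Longrightarrow> \<nu> v < q"
  shows "(\<Sum>c\<leftarrow>\<Psi>0. \<Sum>vs\<in>set (tuples c). of_bool (fst c (map \<nu> vs)) - \<tau>)
     \<le> - ((\<tau> - csp_val q n0 \<Psi>0) * length \<Psi>0 * real N ^ k)"
proof -
  let ?\<Xi> = "PiE {..<n0} grp" and ?g = "\<lambda>c vs. of_bool (fst c (map \<nu> vs)) - \<tau>"
  let ?\<delta> = "\<tau> - csp_val q n0 \<Psi>0"
  have card\<Xi>: "card ?\<Xi> = N ^ n0" by (simp add: card_PiE card_grp)
  have sum_sum_list: "(\<Sum>i\<in>I. \<Sum>c\<leftarrow>L. f c i) = (\<Sum>c\<leftarrow>L. \<Sum>i\<in>I. f c i)" for I :: "(nat \<Rightarrow> nat) set" and L :: "constr list" and f :: "constr \<Rightarrow> (nat \<Rightarrow> nat) \<Rightarrow> real"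
    by (induction L) (simp_all add: sum.distrib)
  have "real (N ^ (n0 - k)) * (\<Sum>c\<leftarrow>\<Psi>0. \<Sum>vs\<in>set (tuples c). ?g c vs)
     = (\<Sum>c\<leftarrow>\<Psi>0. \<Sum>\<xi>\<in>?\<Xi>. ?g c (map \<xi> (snd c)))"
    unfolding sum_list_const_mult[symmetric]
    by (intro arg_cong[where f=sum_list] map_cong refl sum_tuples_lift[symmetric])
  also have "\<dots> = (\<Sum>\<xi>\<in>?\<Xi>. excess \<tau> (\<nu> \<circ> \<xi>) \<Psi>0)"
    unfolding sum_sum_list[symmetric] excess_sum_list satisfies_def by simp
  also have "\<dots> \<le> (\<Sum>\<xi>\<in>?\<Xi>. - (?\<delta> * length \<Psi>0))"
  proof (rule sum_mono)
    fix \<xi> assume \<xi>: "\<xi> \<in> ?\<Xi>"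
    have "assignment q n0 (\<nu> \<circ> \<xi>)" unfolding assignment_def
      using PiE_mem[OF \<xi>] \<nu> by (auto simp: grp_def)
    then have "real (num_sat (\<nu> \<circ> \<xi>) \<Psi>0) / length \<Psi>0 \<le> csp_val q n0 \<Psi>0" by (rule csp_val_ge)
    then have "real (num_sat (\<nu> \<circ> \<xi>) \<Psi>0) \<le> csp_val q n0 \<Psi>0 * length \<Psi>0"
      using \<Psi>0_ne by (simp add: divide_le_eq)
    then show "excess \<tau> (\<nu> \<circ> \<xi>) \<Psi>0 \<le> - (?\<delta> * length \<Psi>0)" by (simp add: excess_def algebra_simps)
  qed
  also have "\<dots> = real (N ^ (n0 - k)) * (- (?\<delta> * length \<Psi>0 * real N ^ k))"
  proof -
    have "real N ^ n0 = real N ^ (n0 - k) * real N ^ k" using k_le_n0 by (simp add: power_add[symmetric])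
    then show ?thesis by (simp add: card\<Xi>)
  qed
  finally show ?thesis using N by (subst (asm) mult_le_cancel_left_pos) auto
qed

text \<open>Expected deficit per variable in one round. The powers of \<open>N\<close> cancel, so
  \<open>c1\<close>, then \<open>c2\<close>, and finally the number of rounds can be fixed before
  \<open>N\<close>.\<close>

definition "c1 = 11 * (\<tau> - csp_val q n0 \<Psi>0) * length \<Psi>0 / (real q ^ k * (12 * real n0) ^ k)"

text \<open>By Bernoulli's inequality the other variables avoid a given slot with probability at
  least \<open>1 - n / m\<close>, which is 11/12.\<close>

lemma \<kappa>_ge: "11 * real n / (real N ^ k * (12 * real n0) ^ k) \<le> \<kappa>"
proof -
  have m: "0 < real m" using n_pos by simp
  have m1: "1 \<le> m" using n_pos by linarith
  have "real (m - 1) ^ (n - k) = real m ^ (n - k) * (1 - 1 / m) ^ (n - k)"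
  proof -
    have "real (m - 1) = real m * (1 - 1 / m)" using m1 m by (simp only: of_nat_diff of_nat_1 right_diff_distrib) simp
    then show ?thesis by (simp only: power_mult_distrib)
  qed
  moreover have "(1 - 1 / real m) ^ (n - k) \<ge> 11 / 12"
  proof -
    have "11 / 12 \<le> 1 + real (n - k) * (- (1 / m))"
    proof -
      have "real (n - k) * (1 / m) \<le> real n * (1 / m)"
        using m by (intro mult_right_mono of_nat_mono diff_le_self) simp
      also have "\<dots> = 1 / 12" using n_pos by simp
      finally show ?thesis by simp
    qed
    also have "\<dots> \<le> (1 + (- (1 / m))) ^ (n - k)"
    proof (rule Bernoulli_inequality)
      have "1 \<le> real m" using m1 by linarith
      then have "1 / real m \<le> 1" using m by (simp only: divide_le_eq_1_pos)
      then show "- 1 \<le> - (1 / real m)" by linarith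
    qed
    finally show ?thesis by simp
  qed
  moreover have "real m ^ n = real m ^ (n - k) * real m ^ k"
    using power_add[of "real m" "n - k" k] k_le_n by (simp only: le_add_diff_inverse2)
  ultimately have \<kappa>: "\<kappa> = real m * (real m ^ (n - k) * (1 - 1 / real m) ^ (n - k)) / (real m ^ (n - k) * real m ^ k)"
    and b: "11 / 12 \<le> (1 - 1 / real m) ^ (n - k)" unfolding \<kappa>_def by (simp_all only:)
  have "real m * (real m ^ (n - k) * (11 / 12)) / (real m ^ (n - k) * real m ^ k) \<le> \<kappa>"
    unfolding \<kappa> using b m by (intro divide_right_mono mult_left_mono mult_nonneg_nonneg zero_le_power) auto
  also have "real m * (real m ^ (n - k) * (11 / 12)) / (real m ^ (n - k) * real m ^ k) = 11 * real n / real m ^ k"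
    using m by (simp add: field_simps)
  also have "real m ^ k = real N ^ k * (12 * real n0) ^ k" by (simp add: power_mult_distrib mult_ac)
  finally show ?thesis .
qed

lemma avg_excess_le:
  assumes \<nu>: "\<And>v. v < n \<Longrightarrow> \<nu> v < q"
  shows "avg H (\<lambda>h. avg X (\<lambda>y. excess \<tau> \<nu> (cons h y))) \<le> - (c1 * n)"
proof -
  let ?\<delta> = "\<tau> - csp_val q n0 \<Psi>0"
  have \<kappa>0: "0 \<le> \<kappa>" by (simp add: \<kappa>_def)
  have N0: "0 < real N" using N by simp
  have "avg H (\<lambda>h. avg X (\<lambda>y. excess \<tau> \<nu> (cons h y))) \<le> \<kappa> / real q ^ k * (- (?\<delta> * length \<Psi>0 * real N ^ k))"
    unfolding avg_excess_cons using sum_tuples_le[OF \<nu>] \<kappa>0 by (intro mult_left_mono) auto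
  also have "\<dots> = - (\<kappa> * (?\<delta> * length \<Psi>0 * real N ^ k / real q ^ k))" by simp
  also have "\<dots> \<le> - ((11 * real n / (real N ^ k * (12 * real n0) ^ k)) * (?\<delta> * length \<Psi>0 * real N ^ k / real q ^ k))"
    using \<kappa>_ge \<tau> by (intro le_imp_neg_le mult_right_mono) auto
  also have "\<dots> = - (c1 * n)"
    unfolding c1_def using N0 n0_pos q2 by (simp add: field_simps)
  finally show ?thesis .
qed

lemma c1_pos: "0 < c1"
  unfolding c1_def using \<tau> q2 n0_pos \<Psi>0_ne by (intro divide_pos_pos mult_pos_pos) auto

lemma K_pos: "0 < K" unfolding K_def using \<tau>_pos \<Psi>0_ne by (intro mult_pos_pos) auto

lemma c1_le_K: "c1 \<le> K"
proof -
  have "1 \<le> real q ^ k" using q2 by simp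
  moreover have "12 \<le> (12 * real n0) ^ k"
  proof -
    have "12 * real n0 \<le> (12 * real n0) ^ k" using n0_pos k1 by (intro self_le_power) auto
    moreover have "1 \<le> real n0" using n0_pos by simp
    ultimately show ?thesis by linarith
  qed
  ultimately have d: "1 * 12 \<le> real q ^ k * (12 * real n0) ^ k" by (intro mult_mono) auto
  have nn: "0 \<le> (\<tau> - csp_val q n0 \<Psi>0) * length \<Psi>0" using \<tau> by simp
  have "c1 \<le> 11 * (\<tau> - csp_val q n0 \<Psi>0) * length \<Psi>0 / 12"
    unfolding c1_def
  proof (rule divide_left_mono)
    show "0 \<le> 11 * (\<tau> - csp_val q n0 \<Psi>0) * length \<Psi>0"
      using \<tau> by (intro mult_nonneg_nonneg) auto
  qed (use d in auto)
  also have "\<dots> = 11 / 12 * ((\<tau> - csp_val q n0 \<Psi>0) * length \<Psi>0)" by (simp only: mult.assoc times_divide_eq_left)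
  also have "\<dots> \<le> (\<tau> - csp_val q n0 \<Psi>0) * length \<Psi>0" using nn by linarith
  also have "\<dots> \<le> K" unfolding K_def using csp_val_bounds(1)[of q n0 \<Psi>0] q2 by (intro mult_right_mono) auto
  finally show ?thesis .
qed

text \<open>Only the slot of \<open>v\<close> sees the value at \<open>v\<close>.\<close>

lemma excess_diff_y:
  assumes "v < n"
  shows "\<bar>excess \<tau> \<nu> (cons h (y(v := a))) - excess \<tau> \<nu> (cons h (y(v := b)))\<bar> \<le> 2 * K"
proof -
  let ?e = "\<lambda>i a. excess \<tau> \<nu> (cons_slot (slot n h i) (y(v := a)))"
  have "excess \<tau> \<nu> (cons h (y(v := a))) - excess \<tau> \<nu> (cons h (y(v := b))) = (\<Sum>i<m. ?e i a - ?e i b)"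
    unfolding excess_cons sum_subtractf ..
  also have "\<dots> = (\<Sum>i\<in>{..<m} \<inter> {h v}. ?e i a - ?e i b)"
  proof (rule sum.mono_neutral_right)
    show "\<forall>i\<in>{..<m} - {..<m} \<inter> {h v}. ?e i a - ?e i b = 0"
    proof
      fix i assume "i \<in> {..<m} - {..<m} \<inter> {h v}"
      then have "v \<notin> slot n h i" by (auto simp: slot_def)
      then have "cons_slot (slot n h i) (y(v := a)) = cons_slot (slot n h i) (y(v := b))"
        by (intro cons_slot_cong) auto
      then show "?e i a - ?e i b = 0" by simp
    qed
  qed auto
  finally have eq: "excess \<tau> \<nu> (cons h (y(v := a))) - excess \<tau> \<nu> (cons h (y(v := b)))
      = (\<Sum>i\<in>{..<m} \<inter> {h v}. ?e i a - ?e i b)" .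
  have "\<bar>excess \<tau> \<nu> (cons h (y(v := a))) - excess \<tau> \<nu> (cons h (y(v := b)))\<bar>
      \<le> (\<Sum>i\<in>{..<m} \<inter> {h v}. \<bar>?e i a - ?e i b\<bar>)" unfolding eq by (rule sum_abs)
  also have "\<dots> \<le> (\<Sum>i\<in>{h v}. 2 * K)"
  proof (rule order_trans[OF sum_mono])
    fix i
    show "\<bar>?e i a - ?e i b\<bar> \<le> 2 * K"
      using abs_excess_slot[of \<nu> "slot n h i" "y(v := a)"] abs_excess_slot[of \<nu> "slot n h i" "y(v := b)"] by linarith
  next
    show "(\<Sum>i\<in>{..<m} \<inter> {h v}. 2 * K) \<le> (\<Sum>i\<in>{h v}. 2 * K)" using K_pos by (intro sum_mono2) auto
  qed
  finally show ?thesis by simp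
qed

text \<open>Moving \<open>v\<close> affects only the slot it leaves and the slot it enters.\<close>

lemma excess_diff_h:
  assumes "v < n"
  shows "\<bar>excess \<tau> \<nu> (cons (h(v := a)) y) - excess \<tau> \<nu> (cons (h(v := b)) y)\<bar> \<le> 4 * K"
proof -
  let ?e = "\<lambda>i a. excess \<tau> \<nu> (cons_slot (slot n (h(v := a)) i) y)"
  have "excess \<tau> \<nu> (cons (h(v := a)) y) - excess \<tau> \<nu> (cons (h(v := b)) y) = (\<Sum>i<m. ?e i a - ?e i b)"
    unfolding excess_cons sum_subtractf ..
  also have "\<dots> = (\<Sum>i\<in>{..<m} \<inter> {a, b}. ?e i a - ?e i b)"
  proof (rule sum.mono_neutral_right)
    show "\<forall>i\<in>{..<m} - {..<m} \<inter> {a, b}. ?e i a - ?e i b = 0"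
    proof
      fix i assume "i \<in> {..<m} - {..<m} \<inter> {a, b}"
      then have "slot n (h(v := a)) i = slot n (h(v := b)) i" by (auto simp: slot_def)
      then show "?e i a - ?e i b = 0" by simp
    qed
  qed auto
  finally have eq: "excess \<tau> \<nu> (cons (h(v := a)) y) - excess \<tau> \<nu> (cons (h(v := b)) y)
      = (\<Sum>i\<in>{..<m} \<inter> {a, b}. ?e i a - ?e i b)" .
  have "\<bar>excess \<tau> \<nu> (cons (h(v := a)) y) - excess \<tau> \<nu> (cons (h(v := b)) y)\<bar>
      \<le> (\<Sum>i\<in>{..<m} \<inter> {a, b}. \<bar>?e i a - ?e i b\<bar>)" unfolding eq by (rule sum_abs)
  also have "\<dots> \<le> (\<Sum>i\<in>{a, b}. 2 * K)"
  proof (rule order_trans[OF sum_mono])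
    fix i
    show "\<bar>?e i a - ?e i b\<bar> \<le> 2 * K"
      using abs_excess_slot[of \<nu> "slot n (h(v := a)) i" y] abs_excess_slot[of \<nu> "slot n (h(v := b)) i" y] by linarith
  next
    show "(\<Sum>i\<in>{..<m} \<inter> {a, b}. 2 * K) \<le> (\<Sum>i\<in>{a, b}. 2 * K)" using K_pos by (intro sum_mono2) auto
  qed
  also have "\<dots> \<le> 4 * K" using K_pos by (cases "a = b") auto
  finally show ?thesis .
qed

text \<open>The minimiser in \<open>lam\<close> of \<open>32 * (lam * K)\<^sup>2 - lam * c1\<close>,
  whose minimum is \<open>- c2\<close>; the 32 exceeds the 20 that bounded differences
  produce.\<close>

definition "lam = c1 / (64 * K\<^sup>2)"
definition "c2 = c1\<^sup>2 / (128 * K\<^sup>2)"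

lemma lam_pos: "0 < lam" using c1_pos K_pos by (simp add: lam_def)

lemma c2_pos: "0 < c2" using c1_pos K_pos by (simp add: c2_def)

lemma lam_K: "4 * (lam * K) \<le> 1"
proof -
  have "lam * K = c1 / (64 * K)" using K_pos by (simp add: lam_def power2_eq_square)
  then have "4 * (lam * K) = c1 / (16 * K)" by simp
  also have "\<dots> \<le> 1" using c1_le_K K_pos by simp
  finally show ?thesis .
qed

text \<open>Bounded differences are applied in \<open>y\<close> for fixed \<open>h\<close>, then in
  \<open>h\<close> to the conditional mean \<open>f\<close>. They cost 4 and 16 times the square of
  \<open>lam * K\<close> per variable, which the linear gain from \<open>avg_excess_le\<close>
  outweighs.\<close>

theorem avg_exp_excess_le:
  assumes \<nu>: "\<And>v. v < n \<Longrightarrow> \<nu> v < q"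
  shows "avg H (\<lambda>h. avg X (\<lambda>y. exp (lam * excess \<tau> \<nu> (cons h y)))) \<le> exp (- (c2 * n))"
proof -
  let ?z = "\<lambda>h y. excess \<tau> \<nu> (cons h y)"
  define f where "f h = avg X (\<lambda>y. lam * ?z h y)" for h
  have K4: "0 \<le> 4 * (lam * K)" "0 \<le> 2 * (lam * K)" "2 * (lam * K) \<le> 1" using lam_pos K_pos lam_K by auto
  have mz: "m \<noteq> 0" using n_pos by simp
  have "avg H (\<lambda>h. avg X (\<lambda>y. exp (lam * ?z h y))) \<le> avg H (\<lambda>h. exp (f h) * exp ((2 * (lam * K))\<^sup>2 * n))"
  proof (rule avg_mono)
    fix h
    have "avg X (\<lambda>y. exp (lam * ?z h y)) \<le> exp (avg X (\<lambda>y. lam * ?z h y) + (2 * (lam * K))\<^sup>2 * card {..<n})"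
    proof (rule avg_exp_bounded_differences)
      fix y :: "nat \<Rightarrow> nat" and v a b assume "v \<in> {..<n}"
      then have "lam * \<bar>?z h (y(v := a)) - ?z h (y(v := b))\<bar> \<le> lam * (2 * K)"
        using lam_pos by (intro mult_left_mono excess_diff_y) auto
      then show "\<bar>lam * ?z h (y(v := a)) - lam * ?z h (y(v := b))\<bar> \<le> 2 * (lam * K)"
        using lam_pos by (simp add: right_diff_distrib[symmetric] abs_mult)
    qed (use K4 q2 in \<open>auto simp: lessThan_empty_iff\<close>)
    then show "avg X (\<lambda>y. exp (lam * ?z h y)) \<le> exp (f h) * exp ((2 * (lam * K))\<^sup>2 * n)"
      unfolding f_def by (simp add: exp_add)
  qed
  also have "\<dots> = avg H (\<lambda>h. exp (f h)) * exp ((2 * (lam * K))\<^sup>2 * n)" by (rule avg_multc)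
  also have "\<dots> \<le> exp (avg H f + (4 * (lam * K))\<^sup>2 * card {..<n}) * exp ((2 * (lam * K))\<^sup>2 * n)"
  proof (intro mult_right_mono avg_exp_bounded_differences)
    fix h :: "nat \<Rightarrow> nat" and v a b assume v: "v \<in> {..<n}"
    have "\<bar>f (h(v := a)) - f (h(v := b))\<bar> = norm (avg X (\<lambda>y. lam * (?z (h(v := a)) y - ?z (h(v := b)) y)))"
      unfolding f_def avg_diff[symmetric] by (simp add: right_diff_distrib)
    also have "\<dots> \<le> avg X (\<lambda>y. norm (lam * (?z (h(v := a)) y - ?z (h(v := b)) y)))" by (rule norm_avg_le)
    also have "\<dots> \<le> 4 * (lam * K)"
    proof (rule avg_le_const[OF finX])
      fix y
      have "lam * \<bar>?z (h(v := a)) y - ?z (h(v := b)) y\<bar> \<le> lam * (4 * K)"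
        using lam_pos v by (intro mult_left_mono excess_diff_h) auto
      then show "norm (lam * (?z (h(v := a)) y - ?z (h(v := b)) y)) \<le> 4 * (lam * K)"
        using lam_pos by (simp add: abs_mult)
    qed
    finally show "\<bar>f (h(v := a)) - f (h(v := b))\<bar> \<le> 4 * (lam * K)" .
  qed (use K4 lam_K mz in \<open>auto simp: lessThan_empty_iff\<close>)
  also have "\<dots> = exp (avg H f + 20 * (lam * K)\<^sup>2 * n)"
    by (simp add: exp_add[symmetric] power_mult_distrib)
  also have "\<dots> \<le> exp (- (c2 * n))"
  proof -
    have "avg H f = lam * avg H (\<lambda>h. avg X (?z h))" unfolding f_def avg_cmult ..
    also have "\<dots> \<le> lam * (- (c1 * n))" using lam_pos avg_excess_le[OF \<nu>] by (intro mult_left_mono) auto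
    finally have a: "avg H f \<le> - (lam * c1) * n" by simp
    have "20 * (lam * K)\<^sup>2 * n \<le> 32 * (lam * K)\<^sup>2 * n" by (intro mult_right_mono) auto
    then have "avg H f + 20 * (lam * K)\<^sup>2 * n \<le> (- (lam * c1) + 32 * (lam * K)\<^sup>2) * n"
      using a unfolding distrib_right by linarith
    also have "- (lam * c1) + 32 * (lam * K)\<^sup>2 = - c2"
      unfolding lam_def c2_def using K_pos by (simp add: field_simps power2_eq_square)
    finally show ?thesis by simp
  qed
  finally show ?thesis .
qed

end

section \<open>Streaming algorithms\<close>


lemma pmf_bind_finite:
  assumes "finite A" "set_pmf p \<subseteq> A"
  shows "pmf (bind_pmf p f) i = (\<Sum>x\<in>A. pmf p x * pmf (f x) i)"
  unfolding pmf_bind using assms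
  by (subst integral_measure_pmf_real[where A=A]) (auto simp: mult.commute)

lemma prob_bind_finite:
  assumes "finite A" "set_pmf p \<subseteq> A"
  shows "measure_pmf.prob (bind_pmf p f) E = (\<Sum>x\<in>A. pmf p x * measure_pmf.prob (f x) E)"
proof -
  have "ennreal (measure_pmf.prob (bind_pmf p f) E) = (\<integral>\<^sup>+x. emeasure (measure_pmf (f x)) E \<partial>p)"
    by (simp add: measure_pmf.emeasure_eq_measure[symmetric])
  also have "\<dots> = (\<Sum>x\<in>A. emeasure (measure_pmf (f x)) E * ennreal (pmf p x))"
    using assms by (intro nn_integral_measure_pmf_support) auto
  also have "\<dots> = (\<Sum>x\<in>A. ennreal (pmf p x * measure_pmf.prob (f x) E))"
    by (intro sum.cong) (simp_all add: measure_pmf.emeasure_eq_measure ennreal_mult mult.commute)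
  also have "\<dots> = ennreal (\<Sum>x\<in>A. pmf p x * measure_pmf.prob (f x) E)"
    by (intro sum_ennreal) auto
  finally show ?thesis by (subst (asm) ennreal_inj) (auto intro!: sum_nonneg)
qed

definition stream :: "salg \<Rightarrow> constr list \<Rightarrow> nat pmf \<Rightarrow> nat pmf" where
  "stream A \<Psi> = fold (\<lambda>c p. bind_pmf p (step A c)) \<Psi>"

lemma stream_append: "stream A (\<Psi> @ \<Phi>) p = stream A \<Phi> (stream A \<Psi> p)"
  by (simp add: stream_def)

lemma stream_bind: "stream A \<Psi> (bind_pmf p f) = bind_pmf p (\<lambda>x. stream A \<Psi> (f x))"
  unfolding stream_def by (induction \<Psi> arbitrary: f) (simp_all add: bind_assoc_pmf)

lemma stream_eq_bind: "stream A \<Psi> p = bind_pmf p (\<lambda>x. stream A \<Psi> (return_pmf x))"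
  using stream_bind[of A \<Psi> p return_pmf] by (simp add: bind_return_pmf')

lemma set_stream:
  assumes "\<And>c \<sigma>. valid_constraint F k n c \<Longrightarrow> \<sigma> < M \<Longrightarrow> set_pmf (step A c \<sigma>) \<subseteq> {..<M}"
    and "\<And>c. c \<in> set \<Psi> \<Longrightarrow> valid_constraint F k n c" and "set_pmf p \<subseteq> {..<M}"
  shows "set_pmf (stream A \<Psi> p) \<subseteq> {..<M}"
  using assms(2,3) unfolding stream_def
proof (induction \<Psi> arbitrary: p)
  case (Cons c \<Psi>)
  have "set_pmf (bind_pmf p (step A c)) \<subseteq> {..<M}"
  proof
    fix b assume "b \<in> set_pmf (bind_pmf p (step A c))"
    then obtain \<sigma> where \<sigma>: "\<sigma> \<in> set_pmf p" "b \<in> set_pmf (step A c \<sigma>)" by (auto simp: set_bind_pmf)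
    have "\<sigma> < M" using \<sigma>(1) Cons.prems(2) by blast
    moreover have "valid_constraint F k n c" by (rule Cons.prems(1)) simp
    ultimately show "b \<in> {..<M}" using assms(1)[of c \<sigma>] \<sigma>(2) by blast
  qed
  then show ?case using Cons by simp
qed simp

lemma num_sat_cong:
  assumes "\<And>c. c \<in> set \<Psi> \<Longrightarrow> valid_constraint F k n c" "\<And>v. v < n \<Longrightarrow> \<nu> v = \<nu>' v"
  shows "num_sat \<nu> \<Psi> = num_sat \<nu>' \<Psi>"
proof -
  have "satisfies \<nu> c = satisfies \<nu>' c" if "c \<in> set \<Psi>" for c
  proof -
    have "set (snd c) \<subseteq> {..<n}" using assms(1)[OF that] by (simp add: valid_constraint_def)
    then have "map \<nu> (snd c) = map \<nu>' (snd c)" using assms(2) by auto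
    then show ?thesis by (simp only: satisfies_def)
  qed
  then show ?thesis unfolding num_sat_def by (simp cong: filter_cong)
qed

locale stream_csp = hard_csp +
  fixes A :: salg and s :: nat
  assumes space: "space_bounded F k n s A"
begin

abbreviation "\<Sigma> \<equiv> {..<(2::nat) ^ s}"
abbreviation "Us \<equiv> {..<m} \<rightarrow>\<^sub>E {..<q}"

definition "yes_block h u x = cons h (vadd n q (\<lambda>v. u (h v)) x)"

definition Yk :: "(nat \<Rightarrow> nat) \<Rightarrow> nat \<Rightarrow> nat \<Rightarrow> (nat \<Rightarrow> nat) \<Rightarrow> real" where
  "Yk h a b x = avg Us (\<lambda>u. pmf (stream A (yes_block h u x) (return_pmf a)) b)"

definition "ini = pmf (init A)"

lemma finU: "finite Us" "Us \<noteq> {}"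
  using q2 by (auto intro!: finite_PiE simp: PiE_eq_empty_iff lessThan_empty_iff)

lemma set_init: "set_pmf (init A) \<subseteq> \<Sigma>" using space by (simp add: space_bounded_def)

lemma set_stream_valid:
  assumes v: "\<And>c. c \<in> set \<Psi> \<Longrightarrow> valid_constraint F k n c" and p: "set_pmf p \<subseteq> \<Sigma>"
  shows "set_pmf (stream A \<Psi> p) \<subseteq> \<Sigma>"
proof (rule set_stream[OF _ v p])
  have "\<forall>c \<sigma>. valid_constraint F k n c \<longrightarrow> \<sigma> < 2 ^ s \<longrightarrow> set_pmf (step A c \<sigma>) \<subseteq> \<Sigma>"
    using space unfolding space_bounded_def by (rule conjunct2)
  then show "set_pmf (step A c \<sigma>) \<subseteq> \<Sigma>" if "valid_constraint F k n c" "\<sigma> < 2 ^ s" for c \<sigma>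
    using that by (elim allE impE)
qed

lemma set_block: "a \<in> \<Sigma> \<Longrightarrow> set_pmf (stream A (cons h y) (return_pmf a)) \<subseteq> \<Sigma>"
proof (rule set_stream_valid)
  assume "a \<in> \<Sigma>"
  then show "set_pmf (return_pmf a) \<subseteq> \<Sigma>" by simp
qed (rule cons_valid)

text \<open>A shift of \<open>x\<close> on slot \<open>i\<close> is absorbed into
  \<open>u i\<close>, and adding 1 there permutes the uniform shifts; \<open>cube m q\<close>
  supplies this permutation of \<open>Us\<close>.\<close>

lemma Yk_slot:
  assumes h: "h \<in> H"
  shows "Yk h a b (vadd n q (\<lambda>v. if v \<in> slot n h i then 1 else 0) x) = Yk h a b x"
proof -
  interpret cm: cube m q using q2 by unfold_locales
  let ?u = "\<lambda>u. vadd m q (\<lambda>j. if j = i then 1 else 0) u"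
  have "yes_block h u (vadd n q (\<lambda>v. if v \<in> slot n h i then 1 else 0) x) = yes_block h (?u u) x" for u
  proof -
    have "vadd n q (\<lambda>v. u (h v)) (vadd n q (\<lambda>v. if v \<in> slot n h i then 1 else 0) x) = vadd n q (\<lambda>v. ?u u (h v)) x"
    proof (rule ext)
      fix v
      show "vadd n q (\<lambda>v. u (h v)) (vadd n q (\<lambda>v. if v \<in> slot n h i then 1 else 0) x) v = vadd n q (\<lambda>v. ?u u (h v)) x v"
      proof (cases "v < n")
        case True
        then have hv: "h v < m" using PiE_mem[OF h, of v] by simp
        have sl: "v \<in> slot n h i \<longleftrightarrow> h v = i" using True by (simp add: slot_def)
        have "((x v + e) mod q + u (h v)) mod q = (x v + (u (h v) + e) mod q) mod q" for e
          by (simp add: mod_add_left_eq mod_add_right_eq add_ac)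
        then show ?thesis using True hv by (simp add: vadd_def sl)
      qed (simp add: vadd_def)
    qed
    then show ?thesis by (simp only: yes_block_def)
  qed
  then have "Yk h a b (vadd n q (\<lambda>v. if v \<in> slot n h i then 1 else 0) x)
     = avg Us (\<lambda>u. pmf (stream A (yes_block h (?u u) x) (return_pmf a)) b)"
    unfolding Yk_def by simp
  also have "\<dots> = Yk h a b x"
    unfolding Yk_def by (rule avg_bij[OF cm.bij_vadd])
  finally show ?thesis .
qed

text \<open>The slot of \<open>w\<close> emits nothing, and no other slot contains
  \<open>w\<close>.\<close>

lemma cons_bad:
  assumes "card (slot n h (h w)) \<noteq> k" "\<And>v. v < n \<Longrightarrow> v \<noteq> w \<Longrightarrow> y v = y' v"
  shows "cons h y = cons h y'"
proof -
  have "cons_slot (slot n h i) y = cons_slot (slot n h i) y'" for i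
  proof (cases "i = h w")
    case True
    then show ?thesis using assms(1) by (simp add: cons_slot_card)
  next
    case False
    show ?thesis by (intro cons_slot_cong assms(2)) (use False in \<open>auto simp: slot_def\<close>)
  qed
  then show ?thesis by (simp add: cons_def)
qed

lemma Yk_bad:
  assumes "card (slot n h (h w)) \<noteq> k"
  shows "Yk h a b (vadd n q (\<lambda>v. if v \<in> {w} then 1 else 0) x) = Yk h a b x"
proof -
  have "yes_block h u (vadd n q (\<lambda>v. if v \<in> {w} then 1 else 0) x) = yes_block h u x" for u
    unfolding yes_block_def by (rule cons_bad[OF assms]) (simp add: vadd_def mod_add_left_eq)
  then show ?thesis by (simp add: Yk_def)
qed

lemma sum_Yk: "a \<in> \<Sigma> \<Longrightarrow> (\<Sum>b\<in>\<Sigma>. Yk h a b x) = 1"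
proof -
  assume a: "a \<in> \<Sigma>"
  have "(\<Sum>b\<in>\<Sigma>. Yk h a b x) = avg Us (\<lambda>u. \<Sum>b\<in>\<Sigma>. pmf (stream A (yes_block h u x) (return_pmf a)) b)"
    unfolding Yk_def avg_sum ..
  also have "\<dots> = avg Us (\<lambda>u. 1)"
    unfolding yes_block_def by (intro avg_cong sum_pmf_eq_1 set_block a) simp
  finally show ?thesis using finU by (simp add: avg_const)
qed

lemma sum_ini: "(\<Sum>a\<in>\<Sigma>. ini a) = 1"
  unfolding ini_def using set_init by (intro sum_pmf_eq_1) auto

sublocale hd: hidden n q m k \<Sigma> Yk ini
proof (intro hidden.intro cube.intro hidden_axioms.intro)
  show "2 \<le> q" by (rule q2)
  show "n \<le> m" by simp
  show "0 < m" using n_pos by simp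
  show "finite \<Sigma>" by simp
  show "\<Sigma> \<noteq> {}" by (simp add: lessThan_empty_iff)
  show "0 \<le> Yk h a b x" for h a b x unfolding Yk_def by (rule avg_nonneg) simp
  show "0 \<le> ini a" for a by (simp add: ini_def)
qed (use sum_Yk sum_ini Yk_slot Yk_bad in blast)+

text \<open>The mean of \<open>G\<close> over YES streams of \<open>t\<close> rounds, as a
  functional that averages the last round first; this avoids a distribution on streams.\<close>

primrec Eyes :: "nat \<Rightarrow> (nat \<Rightarrow> nat) \<Rightarrow> (constr list \<Rightarrow> real) \<Rightarrow> real" where
  "Eyes 0 x G = G []"
| "Eyes (Suc t) x G = Eyes t x (\<lambda>\<Psi>. avg H (\<lambda>h. avg Us (\<lambda>u. G (\<Psi> @ yes_block h u x))))"

primrec Eno :: "nat \<Rightarrow> (constr list \<Rightarrow> real) \<Rightarrow> real" where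
  "Eno 0 G = G []"
| "Eno (Suc t) G = Eno t (\<lambda>\<Psi>. avg H (\<lambda>h. avg X (\<lambda>y. G (\<Psi> @ cons h y))))"

text \<open>The invariant \<open>P\<close> confines the comparison to streams that can
  occur.\<close>

lemma Eyes_mono:
  assumes "P []" "\<And>\<Psi> h u. P \<Psi> \<Longrightarrow> h \<in> H \<Longrightarrow> P (\<Psi> @ yes_block h u x)" "\<And>\<Psi>. P \<Psi> \<Longrightarrow> G \<Psi> \<le> G' \<Psi>"
  shows "Eyes t x G \<le> Eyes t x G'"
  using assms(3)
proof (induction t arbitrary: G G')
  case (Suc t)
  show ?case unfolding Eyes.simps using Suc.prems assms(2) by (intro Suc.IH avg_mono) auto
qed (use assms in simp)

lemma Eno_mono:
  assumes "P []" "\<And>\<Psi> h y. P \<Psi> \<Longrightarrow> P (\<Psi> @ cons h y)" "\<And>\<Psi>. P \<Psi> \<Longrightarrow> G \<Psi> \<le> G' \<Psi>"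
  shows "Eno t G \<le> Eno t G'"
  using assms(3)
proof (induction t arbitrary: G G')
  case (Suc t)
  show ?case unfolding Eno.simps using Suc.prems assms(2) by (intro Suc.IH avg_mono) auto
qed (use assms in simp)

definition "vld \<Psi> \<longleftrightarrow> (\<forall>c\<in>set \<Psi>. valid_constraint F k n c)"

lemma vld: "vld []" "vld \<Psi> \<Longrightarrow> vld (\<Psi> @ cons h y)" "vld \<Psi> \<Longrightarrow> vld (\<Psi> @ yes_block h u x)"
  using cons_valid by (auto simp: vld_def yes_block_def)

lemma Eyes_cong: "(\<And>\<Psi>. vld \<Psi> \<Longrightarrow> G \<Psi> = G' \<Psi>) \<Longrightarrow> Eyes t x G = Eyes t x G'"
  by (intro antisym Eyes_mono[where P=vld]) (auto simp: vld)

lemma Eno_cong: "(\<And>\<Psi>. vld \<Psi> \<Longrightarrow> G \<Psi> = G' \<Psi>) \<Longrightarrow> Eno t G = Eno t G'"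
  by (intro antisym Eno_mono[where P=vld]) (auto simp: vld)

lemma Eyes_sum: "Eyes t x (\<lambda>\<Psi>. \<Sum>a\<in>S. G a \<Psi> * c a) = (\<Sum>a\<in>S. Eyes t x (G a) * c a)"
  by (induction t arbitrary: G) (simp_all add: avg_sum avg_multc)

lemma Eno_sum: "Eno t (\<lambda>\<Psi>. \<Sum>a\<in>S. G a \<Psi> * c a) = (\<Sum>a\<in>S. Eno t (G a) * c a)"
  by (induction t arbitrary: G) (simp_all add: avg_sum avg_multc)

lemma Eyes_const: "Eyes t x (\<lambda>\<Psi>. c) = c"
  by (induction t) (use finH finU in \<open>simp_all add: avg_const\<close>)

lemma Eno_const: "Eno t (\<lambda>\<Psi>. c) = c"
  by (induction t) (use finH finX in \<open>simp_all add: avg_const\<close>)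

definition "st \<Psi> = stream A \<Psi> (init A)"

lemma set_st: "vld \<Psi> \<Longrightarrow> set_pmf (st \<Psi>) \<subseteq> \<Sigma>"
  unfolding st_def vld_def by (rule set_stream_valid[OF _ set_init]) blast

lemma pmf_st_append: "vld \<Psi> \<Longrightarrow> pmf (st (\<Psi> @ \<Phi>)) b = (\<Sum>a\<in>\<Sigma>. pmf (st \<Psi>) a * pmf (stream A \<Phi> (return_pmf a)) b)"
  unfolding st_def stream_append
  by (subst stream_eq_bind, rule pmf_bind_finite) (use set_st in \<open>auto simp: st_def\<close>)

lemma Eyes_st: "Eyes t x (\<lambda>\<Psi>. pmf (st \<Psi>) b) = hd.F t b x"
proof (induction t arbitrary: b)
  case (Suc t)
  have "Eyes (Suc t) x (\<lambda>\<Psi>. pmf (st \<Psi>) b)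
    = Eyes t x (\<lambda>\<Psi>. \<Sum>a\<in>\<Sigma>. pmf (st \<Psi>) a * avg H (\<lambda>h. Yk h a b x))"
    unfolding Eyes.simps Yk_def
    by (rule Eyes_cong) (simp only: pmf_st_append avg_sum avg_cmult)
  then show ?case unfolding Eyes_sum Suc hd.F.simps .
qed (simp add: st_def stream_def ini_def[symmetric])

text \<open>For every fixed \<open>u\<close> the map from \<open>x\<close> to the shown assignment
  is a bijection, so a YES round with \<open>x\<close> averaged out is a NO round. This identifies
  the chain \<open>hd.p\<close> with the NO stream.\<close>

lemma avg_Yk: "avg X (Yk h a b) = avg X (\<lambda>y. pmf (stream A (cons h y) (return_pmf a)) b)"
proof -
  have "avg X (Yk h a b) = avg Us (\<lambda>u. avg X (\<lambda>x. pmf (stream A (yes_block h u x) (return_pmf a)) b))"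
    unfolding Yk_def by (rule avg_swap)
  also have "\<dots> = avg Us (\<lambda>u. avg X (\<lambda>y. pmf (stream A (cons h y) (return_pmf a)) b))"
    unfolding yes_block_def by (intro avg_cong avg_bij[OF hd.bij_vadd])
  finally show ?thesis using finU by (simp add: avg_const)
qed

lemma Eno_st: "Eno t (\<lambda>\<Psi>. pmf (st \<Psi>) b) = hd.p t b"
proof (induction t arbitrary: b)
  case (Suc t)
  have "Eno (Suc t) (\<lambda>\<Psi>. pmf (st \<Psi>) b)
    = Eno t (\<lambda>\<Psi>. \<Sum>a\<in>\<Sigma>. pmf (st \<Psi>) a * avg H (\<lambda>h. avg X (Yk h a b)))"
    unfolding Eno.simps avg_Yk
    by (rule Eno_cong) (simp only: pmf_st_append avg_sum avg_cmult)
  then show ?case unfolding Eno_sum Suc hd.p.simps .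
qed (simp add: st_def stream_def ini_def[symmetric])

lemma prob_run: "vld \<Psi> \<Longrightarrow> measure_pmf.prob (run A \<Psi>) E = (\<Sum>a\<in>\<Sigma>. pmf (st \<Psi>) a * measure_pmf.prob (out A a) E)"
  unfolding run_def stream_def[symmetric] st_def[symmetric]
  using set_st by (intro prob_bind_finite) auto

text \<open>The output depends on the stream through the final state only, and a test with values in
  [0, 1] does not increase the l1 distance.\<close>

lemma yes_no_close:
  "\<bar>avg X (\<lambda>x. Eyes t x (\<lambda>\<Psi>. measure_pmf.prob (run A \<Psi>) E)) - Eno t (\<lambda>\<Psi>. measure_pmf.prob (run A \<Psi>) E)\<bar> \<le> hd.Dv t"
proof -
  let ?o = "\<lambda>a. measure_pmf.prob (out A a) E"
  have "Eyes t x (\<lambda>\<Psi>. measure_pmf.prob (run A \<Psi>) E) = (\<Sum>a\<in>\<Sigma>. hd.F t a x * ?o a)" for x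
  proof -
    have "Eyes t x (\<lambda>\<Psi>. measure_pmf.prob (run A \<Psi>) E) = Eyes t x (\<lambda>\<Psi>. \<Sum>a\<in>\<Sigma>. pmf (st \<Psi>) a * ?o a)"
      by (rule Eyes_cong) (rule prob_run)
    then show ?thesis unfolding Eyes_sum Eyes_st .
  qed
  then have y: "avg X (\<lambda>x. Eyes t x (\<lambda>\<Psi>. measure_pmf.prob (run A \<Psi>) E)) = (\<Sum>a\<in>\<Sigma>. hd.\<mu> t a * ?o a)"
    unfolding hd.\<mu>_def by (simp only: avg_sum avg_multc)
  have "Eno t (\<lambda>\<Psi>. measure_pmf.prob (run A \<Psi>) E) = Eno t (\<lambda>\<Psi>. \<Sum>a\<in>\<Sigma>. pmf (st \<Psi>) a * ?o a)"
    by (rule Eno_cong) (rule prob_run)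
  then have no: "Eno t (\<lambda>\<Psi>. measure_pmf.prob (run A \<Psi>) E) = (\<Sum>a\<in>\<Sigma>. hd.p t a * ?o a)"
    unfolding Eno_sum Eno_st .
  have "\<bar>(\<Sum>a\<in>\<Sigma>. hd.\<mu> t a * ?o a) - (\<Sum>a\<in>\<Sigma>. hd.p t a * ?o a)\<bar> = \<bar>\<Sum>a\<in>\<Sigma>. (hd.\<mu> t a - hd.p t a) * ?o a\<bar>"
    by (simp add: sum_subtractf left_diff_distrib)
  also have "\<dots> \<le> (\<Sum>a\<in>\<Sigma>. \<bar>(hd.\<mu> t a - hd.p t a) * ?o a\<bar>)" by (rule sum_abs)
  also have "\<dots> \<le> (\<Sum>a\<in>\<Sigma>. \<bar>hd.\<mu> t a - hd.p t a\<bar>)"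
    by (intro sum_mono) (simp add: abs_mult mult_left_le)
  finally show ?thesis unfolding y no hd.Dv_def .
qed

text \<open>The excess is additive and the rounds are independent. The sum over one index only
  brings the constant factor into the form of \<open>Eno_sum\<close>.\<close>

lemma Eno_exp: "Eno t (\<lambda>\<Psi>. exp (lam * excess \<tau> \<nu> \<Psi>)) = (avg H (\<lambda>h. avg X (\<lambda>y. exp (lam * excess \<tau> \<nu> (cons h y))))) ^ t"
proof (induction t)
  case (Suc t)
  let ?a = "avg H (\<lambda>h. avg X (\<lambda>y. exp (lam * excess \<tau> \<nu> (cons h y))))"
  have "Eno (Suc t) (\<lambda>\<Psi>. exp (lam * excess \<tau> \<nu> \<Psi>)) = Eno t (\<lambda>\<Psi>. \<Sum>i\<in>{0::nat}. exp (lam * excess \<tau> \<nu> \<Psi>) * ?a)"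
    by (simp add: excess_append distrib_left exp_add avg_cmult)
  also have "\<dots> = Eno t (\<lambda>\<Psi>. exp (lam * excess \<tau> \<nu> \<Psi>)) * ?a" unfolding Eno_sum by simp
  finally show ?case using Suc by simp
qed (simp add: excess_Nil)

lemma Eno_exp_le:
  assumes "\<And>v. v < n \<Longrightarrow> \<nu> v < q"
  shows "Eno t (\<lambda>\<Psi>. exp (lam * excess \<tau> \<nu> \<Psi>)) \<le> exp (- (c2 * n)) ^ t"
  unfolding Eno_exp using avg_exp_excess_le[OF assms] by (intro power_mono avg_nonneg) auto

text \<open>Counts pairs of a constraint and a global shift of \<open>x\<close> satisfying it. The
  count is additive, so it can be carried along the stream.\<close>

definition "yes_ok x \<Psi> \<longleftrightarrow> vld \<Psi> \<and> length \<Psi> \<le> (\<Sum>c<q. num_sat (\<lambda>v. (x v + c) mod q) \<Psi>)"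

lemma yes_ok_append:
  assumes \<Psi>: "yes_ok x \<Psi>" and h: "h \<in> H"
  shows "yes_ok x (\<Psi> @ yes_block h u x)"
proof -
  let ?y = "vadd n q (\<lambda>v. u (h v)) x"
  have sat: "1 \<le> (\<Sum>c<q. of_bool (satisfies (\<lambda>v. (x v + c) mod q) d) :: nat)" if d: "d \<in> set (yes_block h u x)" for d
  proof -
    obtain i e vs where e: "e \<in> set \<Psi>0" "vs \<in> set (tuples e)" "set vs = slot n h i" "map ?y vs = wit e" "d = (fst e, vs)"
      using d unfolding yes_block_def cons_def cons_slot_def emit_def by auto
    \<comment> \<open>Slot \<open>i\<close> was shifted by \<open>u i\<close>, so this global shift
      agrees with the shown assignment on it; \<open>u\<close> is arbitrary here, hence the
      reduction modulo \<open>q\<close>.\<close>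
    let ?c = "u i mod q"
    have "map (\<lambda>v. (x v + ?c) mod q) vs = map ?y vs"
    proof (rule map_cong[OF refl])
      fix v assume "v \<in> set vs"
      then have "v < n" "h v = i" unfolding e(3) by (auto simp: slot_def)
      then show "(x v + ?c) mod q = ?y v" by (simp add: vadd_def mod_add_right_eq)
    qed
    then have "satisfies (\<lambda>v. (x v + ?c) mod q) d" using wit[OF e(1)] e by (simp add: satisfies_def)
    moreover have "?c \<in> {..<q}" using q2 by simp
    ultimately have "of_bool (satisfies (\<lambda>v. (x v + ?c) mod q) d) \<le> (\<Sum>c<q. of_bool (satisfies (\<lambda>v. (x v + c) mod q) d) :: nat)"
      by (intro member_le_sum) auto
    then show ?thesis using \<open>satisfies (\<lambda>v. (x v + ?c) mod q) d\<close> by simp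
  qed
  have "length L \<le> (\<Sum>c<q. num_sat (\<lambda>v. (x v + c) mod q) L)" if "set L \<subseteq> set (yes_block h u x)" for L
    using that
  proof (induction L)
    case (Cons d L)
    have "(\<Sum>c<q. num_sat (\<lambda>v. (x v + c) mod q) (d # L))
       = (\<Sum>c<q. of_bool (satisfies (\<lambda>v. (x v + c) mod q) d)) + (\<Sum>c<q. num_sat (\<lambda>v. (x v + c) mod q) L)"
      unfolding sum.distrib[symmetric] by (intro sum.cong) (auto simp: num_sat_def)
    then show ?case using Cons sat[of d] by auto
  qed simp
  then have "length (yes_block h u x) \<le> (\<Sum>c<q. num_sat (\<lambda>v. (x v + c) mod q) (yes_block h u x))" by simp
  then show ?thesis using \<Psi> vld by (auto simp: yes_ok_def num_sat_def sum.distrib)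
qed

lemma yes_val:
  assumes ok: "yes_ok x \<Psi>" and ne: "\<Psi> \<noteq> []"
  shows "1 / q \<le> csp_val q n \<Psi>"
proof -
  let ?\<nu> = "\<lambda>c v. (x v + c) mod q"
  have len: "0 < real (length \<Psi>)" using ne by simp
  have "num_sat (?\<nu> c) \<Psi> \<le> csp_val q n \<Psi> * length \<Psi>" if "c < q" for c
  proof -
    have "assignment q n (?\<nu> c)" using q2 by (simp add: assignment_def)
    then have "num_sat (?\<nu> c) \<Psi> / length \<Psi> \<le> csp_val q n \<Psi>" by (rule csp_val_ge)
    then show ?thesis using len by (simp add: divide_le_eq)
  qed
  then have "real (\<Sum>c<q. num_sat (?\<nu> c) \<Psi>) \<le> (\<Sum>c<q. csp_val q n \<Psi> * length \<Psi>)"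
    unfolding of_nat_sum by (intro sum_mono) auto
  moreover have "real (length \<Psi>) \<le> real (\<Sum>c<q. num_sat (?\<nu> c) \<Psi>)" using ok by (simp add: yes_ok_def del: of_nat_sum)
  ultimately have "real (length \<Psi>) * 1 \<le> real (length \<Psi>) * (q * csp_val q n \<Psi>)" by (simp add: mult_ac)
  then have "1 \<le> q * csp_val q n \<Psi>" using len by (simp only: mult_le_cancel_left_pos)
  then show ?thesis using q2 by (simp add: field_simps)
qed

lemma instance_of_vld: "vld \<Psi> \<Longrightarrow> \<Psi> \<noteq> [] \<Longrightarrow> is_instance F k n \<Psi>"
  by (simp add: is_instance_def vld_def)

text \<open>The guarantee concerns nonempty streams. An empty stream is charged to its last block:
  with \<open>x\<close> averaged out this is a NO block, and the exponential moment bounds the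
  chance that it is empty, since the empty list has excess 0.\<close>

lemma yes_lower:
  assumes alg: "is_approx_alg F q k n \<alpha> A" and \<alpha>: "0 < \<alpha>" and E: "E = {\<eta>. \<alpha> / q \<le> \<eta>}"
  shows "2/3 - exp (- (c2 * n)) \<le> avg X (\<lambda>x. Eyes (Suc t) x (\<lambda>\<Psi>. measure_pmf.prob (run A \<Psi>) E))"
proof -
  let ?P = "\<lambda>\<Psi>. measure_pmf.prob (run A \<Psi>) E"
  let ?b = "\<lambda>h u x. of_bool (yes_block h u x = []) :: real"
  have one: "2/3 - avg H (\<lambda>h. avg Us (\<lambda>u. ?b h u x)) \<le> Eyes (Suc t) x ?P" if x: "x \<in> X" for x
  proof -
    have "Eyes (Suc t) x (\<lambda>\<Psi>. 2/3 - of_bool (\<Psi> = [])) \<le> Eyes (Suc t) x ?P"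
    proof (rule Eyes_mono[where P="yes_ok x"])
      show "yes_ok x []" by (simp add: yes_ok_def vld)
      fix \<Psi> assume ok: "yes_ok x \<Psi>"
      show "2/3 - of_bool (\<Psi> = []) \<le> ?P \<Psi>"
      proof (cases "\<Psi> = []")
        case False
        have "is_instance F k n \<Psi>" using ok False by (intro instance_of_vld) (simp_all add: yes_ok_def)
        then have "2/3 \<le> measure_pmf.prob (run A \<Psi>) {\<eta>. \<alpha> * csp_val q n \<Psi> \<le> \<eta> \<and> \<eta> \<le> csp_val q n \<Psi>}"
          using alg by (simp add: is_approx_alg_def)
        also have "\<dots> \<le> ?P \<Psi>"
        proof (rule measure_pmf.finite_measure_mono)
          have "\<alpha> * (1 / q) \<le> \<alpha> * csp_val q n \<Psi>" using yes_val[OF ok False] \<alpha> by (intro mult_left_mono) auto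
          then show "{\<eta>. \<alpha> * csp_val q n \<Psi> \<le> \<eta> \<and> \<eta> \<le> csp_val q n \<Psi>} \<subseteq> E" unfolding E by auto
        qed simp
        finally show ?thesis using False by simp
      next
        case True
        have "0 \<le> ?P \<Psi>" by simp
        then show ?thesis using True by (simp del: measure_nonneg)
      qed
    qed (rule yes_ok_append)
    moreover have "Eyes (Suc t) x (\<lambda>\<Psi>. 2/3 - of_bool (\<Psi> = [])) \<ge> Eyes t x (\<lambda>\<Psi>. 2/3 - avg H (\<lambda>h. avg Us (\<lambda>u. ?b h u x)))"
      unfolding Eyes.simps
    proof (rule Eyes_mono[where P="\<lambda>_. True"])
      fix \<Psi>
      have "2/3 - avg H (\<lambda>h. avg Us (\<lambda>u. ?b h u x)) = avg H (\<lambda>h. avg Us (\<lambda>u. 2/3 - ?b h u x))"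
        using finH finU by (simp add: avg_diff avg_const)
      also have "\<dots> \<le> avg H (\<lambda>h. avg Us (\<lambda>u. 2/3 - of_bool (\<Psi> @ yes_block h u x = [])))"
        by (intro avg_mono) auto
      finally show "2/3 - avg H (\<lambda>h. avg Us (\<lambda>u. ?b h u x)) \<le> avg H (\<lambda>h. avg Us (\<lambda>u. 2/3 - of_bool (\<Psi> @ yes_block h u x = [])))" .
    qed auto
    ultimately show ?thesis unfolding Eyes_const by linarith
  qed
  have "avg X (\<lambda>x. avg H (\<lambda>h. avg Us (\<lambda>u. ?b h u x))) \<le> exp (- (c2 * n))"
  proof -
    have "avg X (\<lambda>x. avg H (\<lambda>h. avg Us (\<lambda>u. ?b h u x))) = avg H (\<lambda>h. avg Us (\<lambda>u. avg X (\<lambda>x. ?b h u x)))"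
      by (subst avg_swap) (subst (2) avg_swap, rule refl)
    also have "\<dots> = avg H (\<lambda>h. avg Us (\<lambda>u. avg X (\<lambda>y. of_bool (cons h y = []))))"
      unfolding yes_block_def by (intro avg_cong avg_bij[OF hd.bij_vadd])
    also have "\<dots> = avg H (\<lambda>h. avg X (\<lambda>y. of_bool (cons h y = [])))" using finU by (simp add: avg_const)
    also have "\<dots> \<le> avg H (\<lambda>h. avg X (\<lambda>y. exp (lam * excess \<tau> (\<lambda>_. 0) (cons h y))))"
      by (intro avg_mono) (auto simp: excess_Nil)
    also have "\<dots> \<le> exp (- (c2 * n))" using q2 by (intro avg_exp_excess_le) auto
    finally show ?thesis .
  qed
  moreover have "avg X (\<lambda>x. 2/3 - avg H (\<lambda>h. avg Us (\<lambda>u. ?b h u x))) \<le> avg X (\<lambda>x. Eyes (Suc t) x ?P)"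
    by (rule avg_mono[OF one])
  moreover have "avg X (\<lambda>x. 2/3 - avg H (\<lambda>h. avg Us (\<lambda>u. ?b h u x))) = 2/3 - avg X (\<lambda>x. avg H (\<lambda>h. avg Us (\<lambda>u. ?b h u x)))"
    using finX by (simp add: avg_diff avg_const)
  ultimately show ?thesis by linarith
qed

text \<open>Either some assignment reaches \<open>\<tau>\<close>, which the sum of exponential
  moments pays for, or the value is below \<open>\<alpha> / q\<close> and a correct output misses
  \<open>E\<close>. The empty stream has excess 0 and falls under the first case.\<close>

lemma no_upper:
  assumes alg: "is_approx_alg F q k n \<alpha> A" and \<alpha>: "\<tau> \<le> \<alpha> / q" and E: "E = {\<eta>. \<alpha> / q \<le> \<eta>}"
  shows "Eno t (\<lambda>\<Psi>. measure_pmf.prob (run A \<Psi>) E) \<le> 1/3 + real q ^ n * exp (- (c2 * n)) ^ t"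
proof -
  let ?P = "\<lambda>\<Psi>. measure_pmf.prob (run A \<Psi>) E"
  let ?e = "\<lambda>\<nu> \<Psi>. exp (lam * excess \<tau> \<nu> \<Psi>)"
  \<comment> \<open>\<open>None\<close> carries the constant 1/3, so that one use of
    \<open>Eno_sum\<close> splits the whole bound.\<close>
  let ?I = "insert None (Some ` X)"
  define G where "G i \<Psi> = (case i of None \<Rightarrow> 1/3 | Some \<nu> \<Rightarrow> ?e \<nu> \<Psi>)" for i \<Psi>
  have fI: "finite (Some ` X)" using finX by simp
  have sumG: "(\<Sum>i\<in>?I. g i) = g None + (\<Sum>\<nu>\<in>X. g (Some \<nu>))" for g :: "(nat \<Rightarrow> nat) option \<Rightarrow> real"
  proof -
    have "(\<Sum>i\<in>?I. g i) = g None + (\<Sum>i\<in>Some ` X. g i)" using fI by (rule sum.insert) blast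
    also have "(\<Sum>i\<in>Some ` X. g i) = (\<Sum>\<nu>\<in>X. g (Some \<nu>))" by (subst sum.reindex) (simp_all add: comp_def)
    finally show ?thesis .
  qed
  have "Eno t ?P \<le> Eno t (\<lambda>\<Psi>. \<Sum>i\<in>?I. G i \<Psi> * 1)"
  proof (rule Eno_mono[where P=vld])
    fix \<Psi> assume v: "vld \<Psi>"
    have "?P \<Psi> \<le> 1/3 + (\<Sum>\<nu>\<in>X. ?e \<nu> \<Psi>)"
    proof (cases "\<exists>\<nu>\<in>X. 0 \<le> excess \<tau> \<nu> \<Psi>")
      case True
      then obtain \<nu> where \<nu>: "\<nu> \<in> X" "0 \<le> excess \<tau> \<nu> \<Psi>" by blast
      have "1 \<le> ?e \<nu> \<Psi>" using \<nu> lam_pos by simp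
      also have "\<dots> \<le> (\<Sum>\<nu>\<in>X. ?e \<nu> \<Psi>)" using \<nu> finX by (intro member_le_sum) auto
      finally show ?thesis using measure_pmf.prob_le_1[of "run A \<Psi>" E] by linarith
    next
      case False
      obtain \<nu>0 where "\<nu>0 \<in> X" using finX by blast
      then have "\<not> 0 \<le> excess \<tau> \<nu>0 \<Psi>" using False by blast
      then have ne: "\<Psi> \<noteq> []" by (cases \<Psi>) (simp_all add: excess_Nil)
      obtain \<nu> where \<nu>: "assignment q n \<nu>" "csp_val q n \<Psi> = real (num_sat \<nu> \<Psi>) / real (length \<Psi>)"
        using csp_val_attained[of q n \<Psi>] q2 by auto
      let ?\<nu> = "restrict \<nu> {..<n}"
      have "?\<nu> \<in> X" using \<nu> by (auto simp: assignment_def)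
      then have "\<not> 0 \<le> excess \<tau> ?\<nu> \<Psi>" using False by blast
      then have "excess \<tau> ?\<nu> \<Psi> < 0" by simp
      moreover have "num_sat ?\<nu> \<Psi> = num_sat \<nu> \<Psi>"
        using v by (intro num_sat_cong[where F=F and k=k and n=n]) (auto simp: vld_def)
      ultimately have "real (num_sat \<nu> \<Psi>) < \<tau> * length \<Psi>" by (simp add: excess_def)
      moreover have "0 < real (length \<Psi>)" using ne by simp
      ultimately have lt: "csp_val q n \<Psi> < \<tau>" unfolding \<nu>(2) by (simp only: pos_divide_less_eq)
      let ?S = "{\<eta>. \<alpha> * csp_val q n \<Psi> \<le> \<eta> \<and> \<eta> \<le> csp_val q n \<Psi>}"
      have "2/3 \<le> measure_pmf.prob (run A \<Psi>) ?S"
        using alg instance_of_vld[OF v ne] by (simp add: is_approx_alg_def)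
      moreover have "measure_pmf.prob (run A \<Psi>) E \<le> measure_pmf.prob (run A \<Psi>) (UNIV - ?S)"
        using lt \<alpha> by (intro measure_pmf.finite_measure_mono) (auto simp: E)
      moreover have "measure_pmf.prob (run A \<Psi>) (UNIV - ?S) = 1 - measure_pmf.prob (run A \<Psi>) ?S"
        using measure_pmf.prob_compl[of ?S "run A \<Psi>"] by simp
      moreover have "0 \<le> (\<Sum>\<nu>\<in>X. ?e \<nu> \<Psi>)" by (intro sum_nonneg) simp
      ultimately show ?thesis by linarith
    qed
    then show "?P \<Psi> \<le> (\<Sum>i\<in>?I. G i \<Psi> * 1)" unfolding sumG by (simp add: G_def)
  qed (simp_all add: vld)
  also have "\<dots> = Eno t (G None) + (\<Sum>\<nu>\<in>X. Eno t (G (Some \<nu>)))"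
    by (rule trans[OF Eno_sum]) (simp only: sumG mult_1_right)
  also have "\<dots> \<le> 1/3 + (\<Sum>\<nu>\<in>X. exp (- (c2 * n)) ^ t)"
  proof (rule add_mono)
    show "Eno t (G None) \<le> 1/3" by (simp add: G_def[abs_def] Eno_const)
    show "(\<Sum>\<nu>\<in>X. Eno t (G (Some \<nu>))) \<le> (\<Sum>\<nu>\<in>X. exp (- (c2 * n)) ^ t)"
      unfolding G_def[abs_def] option.case by (intro sum_mono Eno_exp_le) (auto simp: PiE_iff)
  qed
  also have "(\<Sum>\<nu>\<in>X. exp (- (c2 * n)) ^ t) = real q ^ n * exp (- (c2 * n)) ^ t" by (simp add: cardX)
  finally show ?thesis .
qed

end


section \<open>The upper bound by contradiction and the constant algorithm\<close>

lemma instance_exists: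
  assumes F: "F \<noteq> {}"
  shows "\<exists>\<Psi>. is_instance F k k \<Psi>"
proof -
  obtain f where f: "f \<in> F" using F by blast
  have "is_instance F k k [(f, [0..<k])]"
    using f by (auto simp: is_instance_def valid_constraint_def)
  then show ?thesis by blast
qed

lemma rho_min_le: "1 \<le> q \<Longrightarrow> is_instance F k n \<Psi> \<Longrightarrow> rho_min F q k \<le> csp_val q n \<Psi>"
  unfolding rho_min_def by (rule cInf_lower) (auto intro!: bdd_belowI[of _ 0] simp: csp_val_bounds)

lemma rho_min_nonneg:
  assumes "1 \<le> q" "F \<noteq> {}"
  shows "0 \<le> rho_min F q k"
  unfolding rho_min_def using instance_exists[OF assms(2), of k] assms(1)
  by (intro cInf_greatest) (auto simp: csp_val_bounds)

lemma rho_min_approximated: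
  assumes "F \<noteq> {}" "rho_min F q k < b"
  obtains n \<Psi> where "is_instance F k n \<Psi>" "csp_val q n \<Psi> < b"
proof -
  let ?S = "{csp_val q n \<Psi> | n \<Psi>. is_instance F k n \<Psi>}"
  have "?S \<noteq> {}" using instance_exists[OF assms(1), of k] by blast
  then obtain v where "v \<in> ?S" "v < b" using assms(2) cInf_lessD[of ?S b] unfolding rho_min_def by blast
  then show ?thesis using that by blast
qed

text \<open>If the bound failed, some instance would have value below \<open>\<alpha> / q\<close>.
  YES streams have value at least \<open>1 / q\<close>, so the algorithm must report at least
  \<open>\<alpha> / q\<close> on them, while on NO streams built from this instance it must mostly
  report less. Linear memory would be needed to tell them apart.\<close>

theorem sublinear_approx_le:
  fixes q k :: nat and F :: "(nat list \<Rightarrow> bool) set"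
  assumes q: "2 \<le> q" and k: "2 \<le> k" and F: "F \<noteq> {}"
    and sat: "\<forall>f\<in>F. \<exists>a. length a = k \<and> set a \<subseteq> {..<q} \<and> f a"
    and alg: "has_sublinear_approx F q k \<alpha>"
  shows "\<alpha> \<le> real q * rho_min F q k"
proof (rule ccontr)
  assume "\<not> ?thesis"
  then have gt: "rho_min F q k < \<alpha> / q" using q by (simp add: field_simps)
  have q0: "0 < real q" using q by simp
  have "0 < \<alpha> / q" using gt rho_min_nonneg[of q F k] q F by linarith
  then have \<alpha>0: "0 < \<alpha>" using q0 by (simp add: zero_less_divide_iff)
  obtain n0 \<Psi>0 where inst: "is_instance F k n0 \<Psi>0" and val: "csp_val q n0 \<Psi>0 < \<alpha> / q"
    using rho_min_approximated[OF F gt] by blast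
  define wit where "wit c = (SOME a. length a = k \<and> set a \<subseteq> {..<q} \<and> fst c a)" for c :: constr
  have wit: "length (wit c) = k \<and> set (wit c) \<subseteq> {..<q} \<and> fst c (wit c)" if "c \<in> set \<Psi>0" for c
  proof -
    have "fst c \<in> F" using inst that by (auto simp: is_instance_def valid_constraint_def)
    then have "\<exists>a. length a = k \<and> set a \<subseteq> {..<q} \<and> fst c a" using sat by blast
    then show ?thesis unfolding wit_def by (rule someI_ex)
  qed
  define \<tau> where "\<tau> = \<alpha> / q"
  have hc: "hard_csp q k n0 N F \<Psi>0 wit \<tau>" if "1 \<le> N" for N
    using q k inst wit val that by unfold_locales (auto simp: \<tau>_def)
  define C where "C = hard_csp.c2 q k n0 \<Psi>0 \<tau>"
  have C0: "0 < C" unfolding C_def using hard_csp.c2_pos[OF hc[of 1]] by simp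
  have n0: "0 < n0" using hard_csp.n0_pos[OF hc[of 1]] by simp
  \<comment> \<open>Enough rounds for the union bound over \<open>q ^ n\<close> assignments, with a
    factor \<open>exp (- n)\<close> to spare.\<close>
  obtain T0 :: nat where T0: "ln q + 1 < T0 * C"
    using reals_Archimedean3[OF C0] by blast
  define T where "T = Suc T0"
  have TC: "ln q + 1 \<le> T * C" using T0 C0 by (simp add: T_def algebra_simps)
  obtain c :: real and N0 :: nat where c: "0 < c"
    and ind: "\<And>n s (\<Sigma> :: nat set) Yk ini. N0 \<le> n \<Longrightarrow> hidden n q (12 * n) k \<Sigma> Yk ini \<Longrightarrow>
     card \<Sigma> \<le> 2 ^ s \<Longrightarrow> real s \<le> c * n \<Longrightarrow> hidden.Dv n q (12 * n) \<Sigma> Yk ini T \<le> 1/10"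
  proof (rule hidden_indistinguishable[OF q, where \<epsilon> = "1/10" and k = k and T = T])
    show "(0::real) < 1/10" by simp
  next
    fix c :: real and N :: nat
    assume "0 < c" "\<And>n s (\<Sigma> :: nat set) Yk ini. N \<le> n \<Longrightarrow> hidden n q (12 * n) k \<Sigma> Yk ini \<Longrightarrow>
     card \<Sigma> \<le> 2 ^ s \<Longrightarrow> real s \<le> c * n \<Longrightarrow> hidden.Dv n q (12 * n) \<Sigma> Yk ini T \<le> 1/10"
    then show thesis by (rule that)
  qed
  obtain A s where so: "(\<lambda>n. real (s n)) \<in> o(\<lambda>n. real n)"
    and A: "\<And>n. space_bounded F k n (s n) (A n)" "\<And>n. is_approx_alg F q k n \<alpha> (A n)"
    using alg unfolding has_sublinear_approx_def by blast
  have "\<forall>\<^sub>F n in sequentially. norm (real (s n)) \<le> c * norm (real n)"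
    using so c by (rule landau_o.smallD)
  then obtain N1 where N1: "\<And>n. N1 \<le> n \<Longrightarrow> real (s n) \<le> c * n"
    by (auto simp: eventually_sequentially)
  have exp_small: "\<exists>N. \<forall>n\<ge>N. exp (- (b * real n)) < 1/10" if b: "0 < b" for b :: real
  proof -
    obtain N :: nat where N: "10 < N * b" using reals_Archimedean3[OF b] by blast
    have "exp (- (b * real n)) < 1/10" if "N \<le> n" for n
    proof -
      have "real N * b \<le> real n * b" using that b by (intro mult_right_mono) auto
      then have "10 < b * real n" using N by (simp add: mult.commute)
      moreover have "1 + b * real n \<le> exp (b * real n)" by (rule exp_ge_add_one_self)
      ultimately have "10 < exp (b * real n)" by linarith
      then show ?thesis by (simp add: exp_minus field_simps)
    qed
    then show ?thesis by blast
  qed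
  obtain N2 where N2: "\<And>n. N2 \<le> n \<Longrightarrow> exp (- (C * real n)) < 1/10" using exp_small[OF C0] by blast
  obtain N3 where N3: "\<And>n. N3 \<le> n \<Longrightarrow> exp (- (1 * real n)) < 1/10" using exp_small[of 1] by auto
  define N where "N = Max {1, N0, N1, N2, N3}"
  have Nge: "1 \<le> N" "N0 \<le> N" "N1 \<le> N" "N2 \<le> N" "N3 \<le> N" by (auto simp: N_def)
  let ?n = "n0 * N"
  have nN: "N \<le> ?n" using n0 by simp
  interpret stream_csp q k n0 N F \<Psi>0 wit \<tau> "A ?n" "s ?n"
    using hc[OF Nge(1)] A(1)[of ?n] by (simp add: stream_csp_def stream_csp_axioms_def)
  let ?E = "{\<eta>. \<alpha> / q \<le> \<eta>}"
  have close: "hd.Dv T \<le> 1/10"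
  proof (rule ind)
    show "N0 \<le> ?n" using Nge nN by linarith
    show "hidden ?n q (12 * ?n) k {..<2 ^ s ?n} Yk ini" by (rule hd.hidden_axioms)
    show "card {..<(2::nat) ^ s ?n} \<le> 2 ^ s ?n" by simp
    show "real (s ?n) \<le> c * ?n" using Nge nN by (intro N1) linarith
  qed
  have lower: "2/3 - exp (- (C * ?n)) \<le> avg X (\<lambda>x. Eyes T x (\<lambda>\<Psi>. measure_pmf.prob (run (A ?n) \<Psi>) ?E))"
    unfolding T_def C_def by (rule yes_lower[OF A(2) \<alpha>0 refl])
  have upper: "Eno T (\<lambda>\<Psi>. measure_pmf.prob (run (A ?n) \<Psi>) ?E) \<le> 1/3 + real q ^ ?n * exp (- (C * ?n)) ^ T"
    unfolding C_def by (rule no_upper[OF A(2) _ refl]) (simp add: \<tau>_def)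
  have "real q ^ ?n * exp (- (C * ?n)) ^ T = exp (?n * (ln q - T * C))"
  proof -
    have "real q ^ ?n = exp (?n * ln q)" unfolding exp_of_nat_mult using q0 by (simp only: exp_ln)
    moreover have "exp (- (C * ?n)) ^ T = exp (T * (- (C * ?n)))" by (rule exp_of_nat_mult[symmetric])
    ultimately show ?thesis by (simp add: exp_add[symmetric] algebra_simps)
  qed
  also have "\<dots> \<le> exp (real ?n * (- 1))"
  proof -
    have "ln q - T * C \<le> - 1" using TC by linarith
    then show ?thesis unfolding exp_le_cancel_iff by (intro mult_left_mono) auto
  qed
  also have "\<dots> = exp (- (1 * real ?n))" by simp
  also have "\<dots> < 1/10" using Nge nN by (intro N3) linarith
  finally have small: "real q ^ ?n * exp (- (C * ?n)) ^ T < 1/10" .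
  have "exp (- (C * real ?n)) < 1/10" using Nge nN by (intro N2) linarith
  \<comment> \<open>Three errors of at most 1/10 fit into the gap between 2/3 and 1/3.\<close>
  then show False using lower upper small close yes_no_close[of T ?E] by linarith
qed

text \<open>Every value lies between \<open>rho_min F q k\<close> and 1, so the constant answer
  \<open>rho_min F q k\<close> is at most the value and at least \<open>rho_min F q k\<close> times
  it. Zero bits suffice, since the memory stays in state 0.\<close>

lemma constant_approx:
  assumes q: "1 \<le> q" and F: "F \<noteq> {}"
  shows "has_sublinear_approx F q k (rho_min F q k)"
proof -
  let ?\<rho> = "rho_min F q k"
  define A where "A = \<lparr>init = return_pmf 0, step = (\<lambda>c \<sigma>. return_pmf 0), out = (\<lambda>\<sigma>. return_pmf ?\<rho>)\<rparr>"
  have "space_bounded F k n 0 A" for n by (simp add: space_bounded_def A_def)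
  moreover have "is_approx_alg F q k n ?\<rho> A" for n
    unfolding is_approx_alg_def
  proof (intro allI impI)
    fix \<Psi> assume i: "is_instance F k n \<Psi>"
    have "run A \<Psi> = return_pmf ?\<rho>" by (simp add: run_def A_def bind_pmf_const)
    moreover have "?\<rho> * csp_val q n \<Psi> \<le> ?\<rho>"
      using rho_min_nonneg[OF q F, of k] csp_val_bounds[OF q, of n \<Psi>] by (simp add: mult_left_le)
    ultimately show "2/3 \<le> measure_pmf.prob (run A \<Psi>) {\<eta>. ?\<rho> * csp_val q n \<Psi> \<le> \<eta> \<and> \<eta> \<le> csp_val q n \<Psi>}"
      using rho_min_le[OF q i] by (simp add: measure_return_pmf indicator_def)
  qed
  ultimately show ?thesis
    unfolding has_sublinear_approx_def by (intro exI[of _ "\<lambda>_. A"] exI[of _ "\<lambda>_. 0"]) simp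
qed

theorem theorem1p2:
  fixes q k :: nat and F :: "(nat list \<Rightarrow> bool) set"
  assumes "q \<ge> 2" and "k \<ge> 2" and "F \<noteq> {}"
    and "\<forall>f\<in>F. \<exists>a. length a = k \<and> set a \<subseteq> {..<q} \<and> f a"
  shows "(\<forall>\<alpha>. has_sublinear_approx F q k \<alpha> \<longrightarrow> \<alpha> \<le> real q * rho_min F q k) \<and>
         (\<forall>\<alpha>. approximable F q k \<alpha> \<longrightarrow>
              rho_min F q k \<le> \<alpha> \<and> \<alpha> \<le> real q * rho_min F q k)"
proof -
  have upper: "\<alpha> \<le> real q * rho_min F q k" if "has_sublinear_approx F q k \<alpha>" for \<alpha>
    using sublinear_approx_le[OF assms that] .
  have "has_sublinear_approx F q k (rho_min F q k)"
    using assms(1,3) by (intro constant_approx) auto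
  then show ?thesis using upper unfolding approximable_def by blast
qed

end
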